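(* Fix $d>0$. For every compact set $S\subset[0,2\pi]$ of positive measure there exists a set $\Lambda\subset\mathbb{Z}$ having uniform density $D(\Lambda)<(1+d)|S|$ such that \[ C(d)\,|S|\,\|f\|_{L^2(\mathbb{R})}^2\le \sum_{\lambda\in\Lambda}|f(\lambda)|^2\qquad\text{for all } f\in PW_S, \] where $C(d)>0$ is a constant depending only on $d$ (and not on $S$).
   Context: $|S|$ denotes the normalized Lebesgue measure on $[0,2\pi]$, i.e. $|S|=\frac{1}{2\pi}\,\mathrm{Leb}(S)$. The Fourier transform is $\hat f(t)=\int_{\mathbb{R}}e^{-ixt}f(x)\,\frac{dx}{2\pi}$. For $S\subset[0,2\pi]$, $PW_S$ is the space of all $f\in L^2(\mathbb{R})$ whose Fourier transform is supported in $S$, with the $L^2(\mathbb{R})$ norm (such $f$ are continuous, so $f(\lambda)$ makes sense). For $\Lambda\subset\mathbb{Z}$ set $D^-(\Lambda)=\lim_{r\to\infty}\frac{\min_{x\in\mathbb{R}}|\Lambda\cap[x,x+r]|}{r}$ and $D^+(\Lambda)=\lim_{r\to\infty}\frac{\max_{x\in\mathbb{R}}|\Lambda\cap[x,x+r]|}{r}$, where $|\cdot|$ of a finite set is its cardinality. $\Lambda$ has uniform density $D(\Lambda)$ if $D^-(\Lambda)=D^+(\Lambda)=:D(\Lambda)$. *)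

theory Defs
  imports "HOL-Analysis.Analysis"
begin

definition nmeasure :: "real set \<Rightarrow> real" where
  "nmeasure S = measure lborel S / (2 * pi)"

definition window_count :: "int set \<Rightarrow> real \<Rightarrow> real \<Rightarrow> nat" where
  "window_count \<Lambda> x r = card {l \<in> \<Lambda>. x \<le> real_of_int l \<and> real_of_int l \<le> x + r}"

definition min_window :: "int set \<Rightarrow> real \<Rightarrow> real" where
  "min_window \<Lambda> r = Inf ((\<lambda>x. real (window_count \<Lambda> x r)) ` UNIV)"

definition max_window :: "int set \<Rightarrow> real \<Rightarrow> real" where
  "max_window \<Lambda> r = Sup ((\<lambda>x. real (window_count \<Lambda> x r)) ` UNIV)"

definition has_uniform_density :: "int set \<Rightarrow> real \<Rightarrow> bool" where
  "has_uniform_density \<Lambda> D \<longleftrightarrow>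
     ((\<lambda>r. min_window \<Lambda> r / r) \<longlongrightarrow> D) at_top \<and>
     ((\<lambda>r. max_window \<Lambda> r / r) \<longlongrightarrow> D) at_top"

definition square_integrable :: "(real \<Rightarrow> complex) \<Rightarrow> bool" where
  "square_integrable f \<longleftrightarrow> f \<in> borel_measurable lborel \<and>
     integrable lborel (\<lambda>x. (cmod (f x))\<^sup>2)"

definition L2_norm_sq :: "(real \<Rightarrow> complex) \<Rightarrow> real" where
  "L2_norm_sq f = integral\<^sup>L lborel (\<lambda>x. (cmod (f x))\<^sup>2)"

text \<open>The Fourier transform of f (as a tempered distribution) is supported in the closed
  set S: its pairing with every continuous compactly supported test function phi whose
  support is disjoint from S vanishes. The pairing is
  <hat f, phi> = int f(x) (int e^{-ixt} phi(t) dt/2pi) dx.\<close>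
definition fourier_supported_in :: "(real \<Rightarrow> complex) \<Rightarrow> real set \<Rightarrow> bool" where
  "fourier_supported_in f S \<longleftrightarrow>
     (\<forall>\<phi> :: real \<Rightarrow> complex. \<forall>K. continuous_on UNIV \<phi> \<and> compact K \<and> K \<inter> S = {} \<and>
        (\<forall>t. t \<notin> K \<longrightarrow> \<phi> t = 0) \<longrightarrow>
        integral\<^sup>L lborel (\<lambda>x. f x * integral\<^sup>L lborel (\<lambda>t. cis (- (x * t)) * \<phi> t) / (2 * pi)) = 0)"

definition PW :: "real set \<Rightarrow> (real \<Rightarrow> complex) set" where
  "PW S = {f. continuous_on UNIV f \<and> square_integrable f \<and> fourier_supported_in f S}"

end

theory Submission
  imports Defs "HOL-Probability.Probability" "Jordan_Normal_Form.Determinant"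
begin

text \<open>
  Enlarge \<open>S\<close> to a union of \<open>k\<close> cells of the grid \<open>2\<pi>/n\<close> with \<open>k/n\<close> close to \<open>|S|\<close>, and sample on
  \<open>\<Lambda> = J + n\<int>\<close>.  Periodization turns the sampling inequality into the statement that the
  rows \<open>J\<close> of the \<open>n \<times> k\<close> Fourier submatrix are bounded below.  Such a \<open>J\<close> with
  \<open>|J| \<le> (1 + d) k\<close> is found greedily with the lower barrier of Batson, Spielman and Srivastava:
  with \<open>B\<close> the sum of the chosen \<open>v v\<^sup>*\<close>, one keeps \<open>tr (B - l)\<^sup>-\<^sup>1\<close> bounded while \<open>l\<close> increases by
  a fixed amount at each step.  No upper barrier is needed, because vectors are not reused; this
  requires \<open>k/n\<close> to be small, which is arranged by splitting every row into \<open>Q = Q(d)\<close> equal copies.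

  A Paley--Wiener function \<open>f\<close> is replaced by \<open>f(x) F(\<epsilon>x)\<close> with the Fejer kernel \<open>0 \<le> F \<le> 1\<close>, whose
  Fourier transform has compact support: this makes \<open>f\<close> integrable, enlarges the spectrum by \<open>\<epsilon>\<close>
  only, and does not increase the samples.
\<close>

section \<open>Positive semidefinite matrices and traces\<close>

no_notation Matrix.vec_index (infixl \<open>$\<close> 100)

text \<open>The constant may depend on d alone, so nothing may be lost that grows with the grid.
  This shapes the selection step: \<open>c\<close> in \<open>Fourier_matrix_row_selection\<close> is
  fixed before \<open>n\<close> and \<open>L\<close>, and its lower bound scales with
  \<open>card L\<close>, which becomes the factor |S| after division by \<open>n\<close>. Choosing
  rows at random would in general cost a logarithm; the barrier does not. The trace of an inverse
  bounds the smallest eigenvalue, so all spectral facts are stated through traces and quadratic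
  forms. Copying rows keeps the frame tight, and going back to single rows costs only the factor
  \<open>Q\<close>.

  Matrices enter pointwise. The samples on one class j + nZ are the Fourier coefficients, on a
  single cell, of a combination of translates of the spectrum whose coefficients are the entries of
  row j. The row bound is applied at each point of the cell and then integrated.

  The obstacle on the analytic side is that integer samples cannot tell t from t + 2 \<pi>, while
  smoothing pushes spectrum past both end points of [0, 2 \<pi>]. Hence the end points are treated
  as part of the spectrum when cells are chosen, and the mass near them has to be shown to be
  negligible.\<close>

definition quad_form :: "nat \<Rightarrow> complex mat \<Rightarrow> (nat \<Rightarrow> complex) \<Rightarrow> complex" where
  "quad_form k A x = (\<Sum>a<k. \<Sum>b<k. cnj (x a) * A $$ (a, b) * x b)"

definition hermitian_mat :: "nat \<Rightarrow> complex mat \<Rightarrow> bool" where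
  "hermitian_mat k A \<longleftrightarrow> A \<in> carrier_mat k k \<and> (\<forall>a<k. \<forall>b<k. A $$ (a, b) = cnj (A $$ (b, a)))"

definition psd_mat :: "nat \<Rightarrow> complex mat \<Rightarrow> bool" where
  "psd_mat k A \<longleftrightarrow> hermitian_mat k A \<and> (\<forall>x. 0 \<le> Re (quad_form k A x))"

definition re_trace :: "complex mat \<Rightarrow> real" where
  "re_trace A = (\<Sum>a<dim_row A. Re (A $$ (a, a)))"

lemma mat_mult_entry:
  assumes "A \<in> carrier_mat k k" "B \<in> carrier_mat k k" "a < k" "b < k"
  shows "(A * B) $$ (a, b) = (\<Sum>c<k. A $$ (a, c) * B $$ (c, b))"
  using assms by (simp add: scalar_prod_def atLeast0LessThan)

lemma hermitian_matD:
  assumes "hermitian_mat k A"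
  shows "A \<in> carrier_mat k k" "\<And>a b. a < k \<Longrightarrow> b < k \<Longrightarrow> cnj (A $$ (a, b)) = A $$ (b, a)"
  using assms unfolding hermitian_mat_def by metis+

lemma psd_matD:
  assumes "psd_mat k A"
  shows "hermitian_mat k A" "A \<in> carrier_mat k k" "0 \<le> Re (quad_form k A x)"
  using assms unfolding psd_mat_def hermitian_mat_def by blast+

lemma re_trace_add:
  "A \<in> carrier_mat k k \<Longrightarrow> B \<in> carrier_mat k k \<Longrightarrow> re_trace (A + B) = re_trace A + re_trace B"
  by (auto simp: re_trace_def sum.distrib)

lemma re_trace_diff:
  "A \<in> carrier_mat k k \<Longrightarrow> B \<in> carrier_mat k k \<Longrightarrow> re_trace (A - B) = re_trace A - re_trace B"
  by (auto simp: re_trace_def sum_subtractf)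

lemma re_trace_smult:
  "A \<in> carrier_mat k k \<Longrightarrow> re_trace (complex_of_real c \<cdot>\<^sub>m A) = c * re_trace A"
  unfolding re_trace_def sum_distrib_left by (auto intro!: sum.cong)

lemma re_trace_one: "re_trace (1\<^sub>m k) = real k"
  by (simp add: re_trace_def)

lemma re_trace_mult:
  assumes "A \<in> carrier_mat k k" "B \<in> carrier_mat k k"
  shows "re_trace (A * B) = Re (\<Sum>a<k. \<Sum>b<k. A $$ (a, b) * B $$ (b, a))"
  using assms by (simp add: re_trace_def mat_mult_entry[OF assms] del: index_mult_mat(1))

lemma re_trace_mult_comm:
  assumes "A \<in> carrier_mat k k" "B \<in> carrier_mat k k"
  shows "re_trace (A * B) = re_trace (B * A)"
  unfolding re_trace_mult[OF assms] re_trace_mult[OF assms(2,1)]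
  by (subst sum.swap) (simp add: mult.commute)

text \<open>The trace is the sum of the values of the form of \<open>R\<close> at the columns of
  \<open>X\<close>. So tr (X R Y) is a positive semidefinite form on Hermitian matrices, which
  serves as the inner product below.\<close>

lemma psd_re_trace_sandwich_nonneg:
  assumes R: "psd_mat k R" and X: "hermitian_mat k X"
  shows "0 \<le> re_trace (X * (R * X))"
proof -
  note c = psd_matD(2)[OF R] hermitian_matD(1)[OF X]
  have "re_trace (X * (R * X)) = Re (\<Sum>a<k. quad_form k R (\<lambda>b. X $$ (b, a)))"
    unfolding quad_form_def
    by (subst re_trace_mult[of _ k])
      (auto simp: c mult_carrier_mat[OF c] mat_mult_entry[of _ k] hermitian_matD(2)[OF X] sum_distrib_left mult.assoc
        simp del: index_mult_mat(1) intro!: sum.cong)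
  also have "\<dots> \<ge> 0"
    by (simp add: sum_nonneg psd_matD(3)[OF R])
  finally show ?thesis .
qed

lemma nonneg_quadratic_discriminant:
  fixes a b c :: real
  assumes "\<And>x. 0 \<le> a * x\<^sup>2 + 2 * b * x + c"
  shows "b\<^sup>2 \<le> a * c"
proof -
  have c: "0 \<le> c" using assms[of 0] by simp
  show ?thesis
  proof (cases "a = 0")
    case True
    have "b = 0"
    proof (rule ccontr)
      assume "b \<noteq> 0"
      \<comment> \<open>At this point the linear polynomial takes the value -1.\<close>
      then show False using assms[of "- (c + 1) / (2 * b)"] True by simp
    qed
    then show ?thesis using True by simp
  next
    case False
    have "a > 0"
    proof (rule ccontr)
      assume "\<not> a > 0"
      then have neg: "a < 0" using False by simp
      \<comment> \<open>For negative \<open>a\<close> this makes \<open>a * x\<close> equal to -(c +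
        1) + a - 2|b|, so the bracket in the next estimate equals a - 1 < 0.\<close>
      define x where "x = (c + 1) / \<bar>a\<bar> + 1 + 2 * \<bar>b\<bar> / \<bar>a\<bar>"
      have x1: "x \<ge> 1" using c by (simp add: x_def)
      have "a * x\<^sup>2 + 2 * b * x + c \<le> x * (a * x + 2 * \<bar>b\<bar> + c)"
      proof -
        have "b * x \<le> \<bar>b\<bar> * x" "c * 1 \<le> c * x"
          using x1 c by (intro mult_right_mono mult_left_mono; simp)+
        then show ?thesis by (simp add: algebra_simps power2_eq_square)
      qed
      also have "a * x = - (c + 1) + a - 2 * \<bar>b\<bar>"
        using neg by (simp add: x_def field_simps)
      finally show False using assms[of x] neg x1
        by (smt (verit) mult_pos_neg)
    qed
    then have "0 \<le> a * (a * (- b / a)\<^sup>2 + 2 * b * (- b / a) + c)"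
      by (intro mult_nonneg_nonneg assms) simp
    also have "\<dots> = a * c - b\<^sup>2"
      using False by (simp add: field_simps power2_eq_square)
    finally show ?thesis by simp
  qed
qed

lemma hermitian_one: "hermitian_mat k (1\<^sub>m k)"
  by (auto simp: hermitian_mat_def)

lemma hermitian_add_scalar:
  assumes "hermitian_mat k A"
  shows "hermitian_mat k (complex_of_real c \<cdot>\<^sub>m 1\<^sub>m k + A)"
  unfolding hermitian_mat_def
  using hermitian_matD(1)[OF assms] by (auto simp: hermitian_matD(2)[OF assms])

text \<open>Cauchy-Schwarz for tr (X R Y) between the identity and \<open>X\<close>: the form is
  nonnegative at x + X for every real x, and the discriminant does the rest. The trace inequalities
  of the barrier argument are instances of it.\<close>

lemma re_trace_Cauchy_Schwarz:
  assumes R: "psd_mat k R" and X: "hermitian_mat k X"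
  shows "(re_trace (R * X))\<^sup>2 \<le> re_trace R * re_trace (X * (R * X))"
proof (rule nonneg_quadratic_discriminant)
  fix x :: real
  note c [simp] = psd_matD(2)[OF R] hermitian_matD(1)[OF X]
  note [simp] = mult_carrier_mat[of _ k k _ k]
  let ?s = "complex_of_real x"
  let ?Y = "?s \<cdot>\<^sub>m 1\<^sub>m k + X"
  have RY: "R * ?Y = ?s \<cdot>\<^sub>m R + R * X"
    by (subst mult_add_distrib_mat[of _ k k _ k])
      (simp_all add: mult_smult_distrib[of _ k k _ k] right_mult_one_mat[OF c(1)])
  have "?Y * (R * ?Y) = (?s \<cdot>\<^sub>m (?s \<cdot>\<^sub>m R + R * X)) + (?s \<cdot>\<^sub>m (X * R) + X * (R * X))"
    unfolding RY
    by (subst add_mult_distrib_mat[of _ k k _ _ k])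
      (simp_all add: mult_add_distrib_mat[of _ k k _ k] mult_smult_distrib[of _ k k _ k] mult_smult_assoc_mat[of _ k k _ k]
        left_mult_one_mat[of _ k k] add_smult_distrib_left_mat[of _ k k])
  then have "re_trace (?Y * (R * ?Y)) = re_trace R * x\<^sup>2 + 2 * re_trace (R * X) * x + re_trace (X * (R * X))"
    by (simp add: re_trace_add[of _ k] re_trace_smult[of _ k] re_trace_mult_comm[of X k R] power2_eq_square
        algebra_simps del: assoc_mult_mat)
  then show "0 \<le> re_trace R * x\<^sup>2 + 2 * re_trace (R * X) * x + re_trace (X * (R * X))"
    using psd_re_trace_sandwich_nonneg[OF R hermitian_add_scalar[OF X, of x]] by simp
qed

lemma quad_form_scalar:
  "quad_form k (complex_of_real c \<cdot>\<^sub>m 1\<^sub>m k) x = complex_of_real (c * (\<Sum>a<k. (cmod (x a))\<^sup>2))"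
proof -
  have "(\<Sum>b<k. cnj (x a) * (complex_of_real c \<cdot>\<^sub>m 1\<^sub>m k) $$ (a, b) * x b)
      = complex_of_real (c * (cmod (x a))\<^sup>2)" if a: "a < k" for a
  proof -
    have "(\<Sum>b<k. cnj (x a) * (complex_of_real c \<cdot>\<^sub>m 1\<^sub>m k) $$ (a, b) * x b)
        = (\<Sum>b<k. if a = b then complex_of_real c * (cnj (x a) * x a) else 0)"
      using a by (intro sum.cong) auto
    also have "\<dots> = complex_of_real c * (cnj (x a) * x a)" using a by simp
    also have "cnj (x a) * x a = complex_of_real ((cmod (x a))\<^sup>2)"
      by (simp only: complex_norm_square mult.commute)
    finally show ?thesis by simp
  qed
  then show ?thesis
    unfolding quad_form_def by (simp add: sum_distrib_left)
qed

lemma hermitian_scalar: "hermitian_mat k (complex_of_real c \<cdot>\<^sub>m 1\<^sub>m k)"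
  by (auto simp: hermitian_mat_def)

lemma psd_scalar: "0 \<le> c \<Longrightarrow> psd_mat k (complex_of_real c \<cdot>\<^sub>m 1\<^sub>m k)"
  by (simp add: psd_mat_def hermitian_scalar quad_form_scalar sum_nonneg del: smult_carrier_mat)

lemma psd_one: "psd_mat k (1\<^sub>m k)"
proof -
  have "complex_of_real 1 \<cdot>\<^sub>m 1\<^sub>m k = 1\<^sub>m k" by auto
  then show ?thesis using psd_scalar[of 1 k] by simp
qed

lemma quad_form_add:
  "A \<in> carrier_mat k k \<Longrightarrow> B \<in> carrier_mat k k \<Longrightarrow> quad_form k (A + B) x = quad_form k A x + quad_form k B x"
  unfolding quad_form_def sum.distrib[symmetric] by (intro sum.cong refl) (simp add: algebra_simps)

text \<open>Cauchy-Schwarz for the form of \<open>A\<close> between a unit vector and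
  \<open>y\<close>. Summed over \<open>i\<close> it bounds the squared norm of A y by the trace of
  \<open>A\<close> times the form at \<open>y\<close>.\<close>

lemma psd_entry_Cauchy_Schwarz:
  assumes A: "psd_mat k A" and i: "i < k"
  shows "(cmod (\<Sum>b<k. A $$ (i, b) * y b))\<^sup>2 \<le> Re (A $$ (i, i)) * Re (quad_form k A y)"
proof -
  define z where "z = (\<Sum>b<k. A $$ (i, b) * y b)"
  note h = hermitian_matD(2)[OF psd_matD(1)[OF A]]
  have q: "Re (quad_form k A (\<lambda>a. y a + (if a = i then s else 0))) =
      Re (quad_form k A y) + 2 * Re (cnj s * z) + (cmod s)\<^sup>2 * Re (A $$ (i, i))" for s
  proof -
    define e where "e = (\<lambda>a. if a = i then s else 0)"
    have pick: "(\<Sum>b<k. F b * e b) = F i * s" "(\<Sum>b<k. cnj (e b) * F b) = cnj s * F i" for F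
    proof -
      have "(\<Sum>b<k. F b * e b) = (\<Sum>b<k. if b = i then F b * s else 0)"
        "(\<Sum>b<k. cnj (e b) * F b) = (\<Sum>b<k. if b = i then cnj s * F b else 0)"
        by (intro sum.cong; simp add: e_def)+
      then show "(\<Sum>b<k. F b * e b) = F i * s" "(\<Sum>b<k. cnj (e b) * F b) = cnj s * F i"
        using i by simp_all
    qed
    have "quad_form k A (\<lambda>a. y a + e a) = quad_form k A y
       + (\<Sum>a<k. \<Sum>b<k. cnj (y a) * A $$ (a, b) * e b)
       + (\<Sum>a<k. cnj (e a) * (\<Sum>b<k. A $$ (a, b) * y b))
       + (\<Sum>a<k. cnj (e a) * (\<Sum>b<k. A $$ (a, b) * e b))"
      by (simp add: quad_form_def sum.distrib sum_distrib_left algebra_simps)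
    also have "\<dots> = quad_form k A y + s * (\<Sum>a<k. cnj (y a) * A $$ (a, i)) + cnj s * z
        + cnj s * A $$ (i, i) * s"
      by (simp only: pick z_def) (simp add: sum_distrib_left mult.commute mult.left_commute)
    also have "(\<Sum>a<k. cnj (y a) * A $$ (a, i)) = cnj z"
      using i by (auto simp: z_def h intro!: sum.cong)
    also have "cnj s * A $$ (i, i) * s = (cmod s)\<^sup>2 * A $$ (i, i)"
      by (simp only: complex_norm_square) (simp add: algebra_simps)
    finally show ?thesis by (simp add: e_def)
  qed
  define w where "w = (cmod z)\<^sup>2"
  \<comment> \<open>Perturbing along a real multiple of \<open>z\<close> itself makes the cross term
    the real number 2 t w, so a real discriminant suffices. The price is a common factor
    \<open>w\<close>, cancelled at the end.\<close>
  have "0 \<le> (w * Re (A $$ (i, i))) * t\<^sup>2 + 2 * w * t + Re (quad_form k A y)" for t :: real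
  proof -
    have "cnj (complex_of_real t * z) * z = complex_of_real (t * w)"
      by (simp add: w_def complex_norm_square mult.commute mult.left_commute del: of_real_power)
    then show ?thesis
      using psd_matD(3)[OF A, of "\<lambda>a. y a + (if a = i then complex_of_real t * z else 0)"]
      unfolding q by (simp only: Re_complex_of_real) (simp add: norm_mult power_mult_distrib w_def algebra_simps)
  qed
  then have "w\<^sup>2 \<le> (w * Re (A $$ (i, i))) * Re (quad_form k A y)"
    by (rule nonneg_quadratic_discriminant)
  then have "w * w \<le> w * (Re (A $$ (i, i)) * Re (quad_form k A y))"
    by (simp add: power2_eq_square mult.assoc)
  moreover have "0 \<le> Re (A $$ (i, i)) * Re (quad_form k A y)"
  proof -
    have "quad_form k A (\<lambda>a. if a = i then 1 else 0)
        = (\<Sum>a<k. \<Sum>b<k. if b = i then if a = i then A $$ (i, i) else 0 else 0)"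
      unfolding quad_form_def by (intro sum.cong refl) simp
    also have "\<dots> = A $$ (i, i)" using i by simp
    finally show ?thesis
      using psd_matD(3)[OF A, of "\<lambda>a. if a = i then 1 else 0"] psd_matD(3)[OF A, of y] by simp
  qed
  moreover have "w \<ge> 0" by (simp add: w_def)
  ultimately have "w \<le> Re (A $$ (i, i)) * Re (quad_form k A y)"
    by (cases "w = 0") auto
  then show ?thesis by (simp add: w_def z_def)
qed

section \<open>Inverses of Hermitian and positive matrices\<close>

lemma hermitian_inverse:
  assumes M: "hermitian_mat k M" and R: "R \<in> carrier_mat k k" and MR: "M * R = 1\<^sub>m k"
  shows "hermitian_mat k R"
proof -
  note cM = hermitian_matD(1)[OF M]
  define R' where "R' = mat k k (\<lambda>(a, b). cnj (R $$ (b, a)))"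
  have cR': "R' \<in> carrier_mat k k" by (simp add: R'_def)
  have "R' * M = 1\<^sub>m k"
  proof (rule eq_matI)
    fix a b assume "a < dim_row (1\<^sub>m k :: complex mat)" "b < dim_col (1\<^sub>m k :: complex mat)"
    then have ab: "a < k" "b < k" by auto
    have "(R' * M) $$ (a, b) = cnj (\<Sum>c<k. M $$ (b, c) * R $$ (c, a))"
      unfolding mat_mult_entry[OF cR' cM ab]
      using ab by (simp add: R'_def hermitian_matD(2)[OF M] mult.commute)
    also have "\<dots> = cnj ((M * R) $$ (b, a))"
      using ab by (simp add: mat_mult_entry[OF cM R] del: index_mult_mat(1))
    finally show "(R' * M) $$ (a, b) = 1\<^sub>m k $$ (a, b)"
      using ab by (simp add: MR)
  qed (use cR' cM in auto)
  then have "R' = R"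
    using assoc_mult_mat[OF cR' cM R] left_mult_one_mat[OF R] right_mult_one_mat[OF cR'] by (simp add: MR)
  then have e: "R $$ (a, b) = cnj (R $$ (b, a))" if "a < k" "b < k" for a b
    using that unfolding R'_def by (metis (mono_tags, lifting) case_prod_conv index_mat(1))
  show ?thesis
    unfolding hermitian_mat_def
  proof (intro conjI allI impI R)
    fix a b assume "a < k" "b < k"
    then show "R $$ (a, b) = cnj (R $$ (b, a))" by (rule e)
  qed
qed

text \<open>Substituting y = M x turns the form of \<open>R\<close> at \<open>y\<close> into the
  form of \<open>M\<close> at \<open>x\<close>.\<close>

lemma psd_inverse:
  assumes M: "psd_mat k M" and R: "R \<in> carrier_mat k k" and MR: "M * R = 1\<^sub>m k"
  shows "psd_mat k R"
  unfolding psd_mat_def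
proof (intro conjI allI)
  note cM = psd_matD(2)[OF M]
  show hR: "hermitian_mat k R" by (rule hermitian_inverse[OF psd_matD(1)[OF M] R MR])
  fix y
  define x where "x = (\<lambda>a. \<Sum>b<k. R $$ (a, b) * y b)"
  have Mx: "(\<Sum>b<k. M $$ (a, b) * x b) = y a" if a: "a < k" for a
  proof -
    have "(\<Sum>b<k. M $$ (a, b) * x b) = (\<Sum>c<k. (\<Sum>b<k. M $$ (a, b) * R $$ (b, c)) * y c)"
      unfolding x_def sum_distrib_left sum_distrib_right by (subst sum.swap) (simp add: mult.assoc)
    also have "\<dots> = (\<Sum>c<k. (M * R) $$ (a, c) * y c)"
      using a by (simp add: mat_mult_entry[OF cM R] del: index_mult_mat(1))
    also have "\<dots> = (\<Sum>c<k. if a = c then y c else 0)"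
      unfolding MR using a by (intro sum.cong) auto
    finally show ?thesis using a by simp
  qed
  have "quad_form k R y = (\<Sum>a<k. cnj (y a) * x a)"
    unfolding quad_form_def x_def by (simp add: sum_distrib_left mult.assoc)
  also have "\<dots> = (\<Sum>a<k. \<Sum>b<k. cnj (x b) * M $$ (b, a) * x a)"
    by (intro sum.cong refl)
      (simp add: Mx[symmetric] sum_distrib_right sum_distrib_left hermitian_matD(2)[OF psd_matD(1)[OF M]] algebra_simps)
  also have "\<dots> = quad_form k M x"
    unfolding quad_form_def by (rule sum.swap)
  finally show "0 \<le> Re (quad_form k R y)"
    using psd_matD(3)[OF M, of x] by simp
qed

lemma pd_mat_invertible:
  assumes M: "hermitian_mat k M"
    and pos: "\<And>x. (\<exists>a<k. x a \<noteq> 0) \<Longrightarrow> 0 < Re (quad_form k M x)"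
  shows "\<exists>R. psd_mat k R \<and> M * R = 1\<^sub>m k \<and> R * M = 1\<^sub>m k"
proof -
  note cM = hermitian_matD(1)[OF M]
  have "det M \<noteq> 0"
  proof
    assume "det M = 0"
    then obtain v where v: "v \<in> carrier_vec k" "v \<noteq> 0\<^sub>v k" "M *\<^sub>v v = 0\<^sub>v k"
      using det_0_iff_vec_prod_zero_field[OF cM] by blast
    define x where "x = vec_index v"
    have "(\<Sum>b<k. M $$ (a, b) * x b) = 0" if "a < k" for a
    proof -
      have "vec_index (M *\<^sub>v v) a = (\<Sum>b<k. M $$ (a, b) * x b)"
        using that cM v(1) by (simp add: scalar_prod_def x_def atLeast0LessThan)
      then show ?thesis using v(3) that by simp
    qed
    then have "quad_form k M x = 0"
      unfolding quad_form_def mult.assoc sum_distrib_left[symmetric] by simp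
    moreover have "\<exists>a<k. x a \<noteq> 0"
      using v(1,2) unfolding x_def by (metis carrier_vecD eq_vecI index_zero_vec)
    ultimately show False using pos[of x] by simp
  qed
  from det_non_zero_imp_unit[OF cM this, of "()"]
  obtain R where R: "R \<in> carrier_mat k k" "M * R = 1\<^sub>m k"  "R * M = 1\<^sub>m k"
    unfolding Units_def ring_mat_def by auto
  have "psd_mat k M"
    unfolding psd_mat_def
  proof (intro conjI allI M)
    fix x show "0 \<le> Re (quad_form k M x)"
    proof (cases "\<exists>a<k. x a \<noteq> 0")
      case True
      then show ?thesis using pos by (simp add: less_imp_le)
    next
      case False
      then have "quad_form k M x = 0" unfolding quad_form_def by (intro sum.neutral) auto
      then show ?thesis by simp
    qed
  qed
  then show ?thesis using psd_inverse R by blast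
qed

text \<open>For positive definite \<open>M\<close> this is the bound of the smallest eigenvalue by
  the reciprocal trace of the inverse. With y = M x one has x = R y, and the norm of R y is
  controlled entry by entry through \<open>psd_entry_Cauchy_Schwarz\<close>.\<close>

lemma norm_sq_le_trace_inverse_quad_form:
  assumes R: "psd_mat k R" and M: "hermitian_mat k M" and RM: "R * M = 1\<^sub>m k"
  shows "(\<Sum>a<k. (cmod (x a))\<^sup>2) \<le> re_trace R * Re (quad_form k M x)"
proof -
  note c = psd_matD(2)[OF R] hermitian_matD(1)[OF M]
  define y where "y = (\<lambda>a. \<Sum>b<k. M $$ (a, b) * x b)"
  have Ry: "(\<Sum>b<k. R $$ (a, b) * y b) = x a" if a: "a < k" for a
  proof -
    have "(\<Sum>b<k. R $$ (a, b) * y b) = (\<Sum>c<k. (\<Sum>b<k. R $$ (a, b) * M $$ (b, c)) * x c)"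
      unfolding y_def sum_distrib_left sum_distrib_right by (subst sum.swap) (simp add: mult.assoc)
    also have "\<dots> = (\<Sum>c<k. (R * M) $$ (a, c) * x c)"
      using a by (simp add: mat_mult_entry[OF c] del: index_mult_mat(1))
    also have "\<dots> = (\<Sum>c<k. if a = c then x c else 0)"
      unfolding RM using a by (intro sum.cong) auto
    finally show ?thesis using a by simp
  qed
  have "quad_form k R y = (\<Sum>a<k. cnj (y a) * x a)"
    unfolding quad_form_def by (simp add: sum_distrib_left[symmetric] mult.assoc Ry)
  also have "\<dots> = (\<Sum>a<k. \<Sum>b<k. cnj (x b) * M $$ (b, a) * x a)"
    by (intro sum.cong refl)
      (simp add: y_def sum_distrib_right sum_distrib_left hermitian_matD(2)[OF M] algebra_simps)
  also have "\<dots> = quad_form k M x"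
    unfolding quad_form_def by (rule sum.swap)
  finally have q: "quad_form k R y = quad_form k M x" .
  have "(\<Sum>a<k. (cmod (x a))\<^sup>2) \<le> (\<Sum>a<k. Re (R $$ (a, a)) * Re (quad_form k R y))"
    using psd_entry_Cauchy_Schwarz[OF R, of _ y] by (intro sum_mono) (simp add: Ry)
  also have "\<dots> = re_trace R * Re (quad_form k M x)"
    using c by (simp add: q re_trace_def sum_distrib_right)
  finally show ?thesis .
qed

section \<open>Selecting vectors of a tight frame\<close>

definition frame_op :: "nat \<Rightarrow> ('i \<Rightarrow> nat \<Rightarrow> complex) \<Rightarrow> 'i set \<Rightarrow> complex mat" where
  "frame_op k v J = mat k k (\<lambda>(a, b). \<Sum>i\<in>J. v i a * cnj (v i b))"

text \<open>The matrix B - l of the barrier method. The trace of its inverse is the potential: while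
  B - l is positive definite, a bounded potential keeps \<open>l\<close> away from the smallest
  eigenvalue of B.\<close>

definition shifted_frame_op :: "nat \<Rightarrow> ('i \<Rightarrow> nat \<Rightarrow> complex) \<Rightarrow> 'i set \<Rightarrow> real \<Rightarrow> complex mat" where
  "shifted_frame_op k v J l = complex_of_real (- l) \<cdot>\<^sub>m 1\<^sub>m k + frame_op k v J"

lemma frame_op_carrier [simp]: "frame_op k v J \<in> carrier_mat k k"
  by (simp add: frame_op_def)

lemma shifted_frame_op_carrier [simp]: "shifted_frame_op k v J l \<in> carrier_mat k k"
  by (simp add: shifted_frame_op_def)

lemma hermitian_frame_op: "hermitian_mat k (frame_op k v J)"
  unfolding hermitian_mat_def by (auto simp: frame_op_def mult.commute intro!: sum.cong)

lemma hermitian_shifted_frame_op: "hermitian_mat k (shifted_frame_op k v J l)"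
  unfolding shifted_frame_op_def by (rule hermitian_add_scalar[OF hermitian_frame_op])

lemma quad_form_frame_op:
  "quad_form k (frame_op k v J) x = complex_of_real (\<Sum>i\<in>J. (cmod (\<Sum>a<k. cnj (x a) * v i a))\<^sup>2)"
proof -
  have "quad_form k (frame_op k v J) x = (\<Sum>a<k. \<Sum>b<k. \<Sum>i\<in>J. cnj (x a) * v i a * cnj (cnj (x b) * v i b))"
    unfolding quad_form_def
    by (intro sum.cong refl) (simp add: frame_op_def sum_distrib_left sum_distrib_right algebra_simps)
  also have "\<dots> = (\<Sum>a<k. \<Sum>i\<in>J. \<Sum>b<k. cnj (x a) * v i a * cnj (cnj (x b) * v i b))"
    by (intro sum.cong refl sum.swap)
  also have "\<dots> = (\<Sum>i\<in>J. \<Sum>a<k. \<Sum>b<k. cnj (x a) * v i a * cnj (cnj (x b) * v i b))"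
    by (rule sum.swap)
  also have "\<dots> = (\<Sum>i\<in>J. (\<Sum>a<k. cnj (x a) * v i a) * cnj (\<Sum>a<k. cnj (x a) * v i a))"
    by (simp only: cnj_sum sum_product)
  also have "\<dots> = complex_of_real (\<Sum>i\<in>J. (cmod (\<Sum>a<k. cnj (x a) * v i a))\<^sup>2)"
    by (simp only: complex_norm_square[symmetric] of_real_sum)
  finally show ?thesis .
qed

lemma quad_form_shifted_frame_op:
  "Re (quad_form k (shifted_frame_op k v J l) x) =
     (\<Sum>i\<in>J. (cmod (\<Sum>a<k. cnj (x a) * v i a))\<^sup>2) - l * (\<Sum>a<k. (cmod (x a))\<^sup>2)"
  unfolding shifted_frame_op_def
  by (subst quad_form_add) (simp_all add: quad_form_scalar quad_form_frame_op del: of_real_minus)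

lemma re_trace_mult_frame_op:
  assumes X: "X \<in> carrier_mat k k"
  shows "re_trace (X * frame_op k v J) = (\<Sum>i\<in>J. Re (quad_form k X (v i)))"
proof -
  have "(\<Sum>a<k. \<Sum>b<k. X $$ (a, b) * frame_op k v J $$ (b, a))
      = (\<Sum>a<k. \<Sum>b<k. \<Sum>i\<in>J. cnj (v i a) * X $$ (a, b) * v i b)"
    by (intro sum.cong refl) (simp add: frame_op_def sum_distrib_left algebra_simps)
  also have "\<dots> = (\<Sum>a<k. \<Sum>i\<in>J. \<Sum>b<k. cnj (v i a) * X $$ (a, b) * v i b)"
    by (intro sum.cong refl sum.swap)
  also have "\<dots> = (\<Sum>i\<in>J. quad_form k X (v i))"
    unfolding quad_form_def by (rule sum.swap)
  finally show ?thesis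
    by (simp add: re_trace_mult[OF X])
qed

text \<open>The inverse after a rank-one update is R - y y* / (1 + v* R v) with y = R v. Positivity
  of \<open>R\<close> keeps the denominator at least 1, and the trace drops by |y|^2 over it, where
  |y|^2 = v* R R v because \<open>R\<close> is Hermitian.\<close>

lemma Sherman_Morrison:
  fixes v :: "nat \<Rightarrow> complex"
  assumes M: "hermitian_mat k M" and R: "psd_mat k R" and MR: "M * R = 1\<^sub>m k"
    and M'[simp]: "M' \<in> carrier_mat k k"
    and M'_entry: "\<And>a b. a < k \<Longrightarrow> b < k \<Longrightarrow> M' $$ (a, b) = M $$ (a, b) + v a * cnj (v b)"
  shows "\<exists>R'. R' \<in> carrier_mat k k \<and> M' * R' = 1\<^sub>m k \<and>
     re_trace R' = re_trace R - Re (quad_form k (R * R) v) / (1 + Re (quad_form k R v))"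
proof -
  note c [simp] = psd_matD(2)[OF R] hermitian_matD(1)[OF M]
  note h = hermitian_matD(2)[OF psd_matD(1)[OF R]]
  define y where "y = (\<lambda>a. \<Sum>b<k. R $$ (a, b) * v b)"
  define s where "s = 1 + quad_form k R v"
  have q_real: "quad_form k R v = complex_of_real (Re (quad_form k R v))"
  proof -
    have "cnj (quad_form k R v) = (\<Sum>a<k. \<Sum>b<k. cnj (v b) * R $$ (b, a) * v a)"
      unfolding quad_form_def by (simp add: h algebra_simps)
    also have "\<dots> = quad_form k R v" unfolding quad_form_def by (rule sum.swap)
    finally show ?thesis by (simp add: complex_eq_iff)
  qed
  have s_real: "s = complex_of_real (1 + Re (quad_form k R v))"
    unfolding s_def using q_real by simp
  have s0: "s \<noteq> 0" using psd_matD(3)[OF R, of v] unfolding s_real of_real_eq_0_iff by linarith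
  have My: "(\<Sum>c<k. M $$ (a, c) * y c) = v a" if a: "a < k" for a
  proof -
    have "(\<Sum>c<k. M $$ (a, c) * y c) = (\<Sum>b<k. (\<Sum>c<k. M $$ (a, c) * R $$ (c, b)) * v b)"
      unfolding y_def sum_distrib_left sum_distrib_right by (subst sum.swap) (simp add: mult.assoc)
    also have "\<dots> = (\<Sum>b<k. (M * R) $$ (a, b) * v b)"
      using a by (simp add: mat_mult_entry[OF c(2,1)] del: index_mult_mat(1))
    also have "\<dots> = (\<Sum>b<k. if a = b then v b else 0)"
      unfolding MR using a by (intro sum.cong) auto
    finally show ?thesis using a by simp
  qed
  have vR: "(\<Sum>c<k. cnj (v c) * R $$ (c, b)) = cnj (y b)" if b: "b < k" for b
    unfolding y_def using b by (auto simp: h mult.commute intro!: sum.cong)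
  have vy: "(\<Sum>c<k. cnj (v c) * y c) = quad_form k R v"
    unfolding y_def quad_form_def by (simp add: sum_distrib_left mult.assoc)
  define R' where "R' = mat k k (\<lambda>(a, b). R $$ (a, b) - y a * cnj (y b) / s)"
  have R'c [simp]: "R' \<in> carrier_mat k k" by (simp add: R'_def)
  have R'_entry: "R' $$ (a, b) = R $$ (a, b) - y a * cnj (y b) / s" if "a < k" "b < k" for a b
    using that by (simp add: R'_def)
  have "M' * R' = 1\<^sub>m k"
  proof (rule eq_matI)
    fix a b assume "a < dim_row (1\<^sub>m k :: complex mat)" "b < dim_col (1\<^sub>m k :: complex mat)"
    then have ab: "a < k" "b < k" by auto
    have "(M' * R') $$ (a, b) = (\<Sum>c<k. M' $$ (a, c) * R' $$ (c, b))"
      by (rule mat_mult_entry[OF M' R'c ab])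
    also have "\<dots> = (\<Sum>c<k. (M $$ (a, c) + v a * cnj (v c)) * (R $$ (c, b) - y c * cnj (y b) / s))"
      using ab by (intro sum.cong refl) (simp add: M'_entry R'_entry)
    also have "\<dots> = (\<Sum>c<k. M $$ (a, c) * R $$ (c, b)) - (\<Sum>c<k. M $$ (a, c) * y c) * cnj (y b) / s
       + v a * (\<Sum>c<k. cnj (v c) * R $$ (c, b)) - v a * (\<Sum>c<k. cnj (v c) * y c) * cnj (y b) / s"
      by (simp add: ring_distribs sum.distrib sum_subtractf sum_distrib_left sum_distrib_right
          sum_divide_distrib add_divide_distrib mult.assoc)
    also have "\<dots> = (M * R) $$ (a, b) - v a * cnj (y b) / s + v a * cnj (y b) - v a * (s - 1) * cnj (y b) / s"
      using ab by (simp add: My vR vy s_def mat_mult_entry[OF c(2,1)] del: index_mult_mat(1))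
    also have "\<dots> = 1\<^sub>m k $$ (a, b)"
      using s0 unfolding MR by (simp add: field_simps)
    finally show "(M' * R') $$ (a, b) = 1\<^sub>m k $$ (a, b)" .
  qed (simp_all add: carrier_matD[OF M'] carrier_matD[OF R'c])
  moreover have "re_trace R' = re_trace R - Re (quad_form k (R * R) v) / (1 + Re (quad_form k R v))"
  proof -
    have "quad_form k (R * R) v = (\<Sum>a<k. \<Sum>b<k. \<Sum>c<k. cnj (v a) * R $$ (a, c) * R $$ (c, b) * v b)"
      unfolding quad_form_def
      by (intro sum.cong refl) (simp add: mat_mult_entry[OF c(1,1)] sum_distrib_left sum_distrib_right mult.assoc
          del: index_mult_mat(1))
    also have "\<dots> = (\<Sum>a<k. \<Sum>c<k. \<Sum>b<k. cnj (v a) * R $$ (a, c) * R $$ (c, b) * v b)"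
      by (intro sum.cong refl sum.swap)
    also have "\<dots> = (\<Sum>c<k. \<Sum>a<k. \<Sum>b<k. cnj (v a) * R $$ (a, c) * R $$ (c, b) * v b)"
      by (rule sum.swap)
    also have "\<dots> = (\<Sum>c<k. (\<Sum>a<k. cnj (v a) * R $$ (a, c)) * y c)"
      unfolding y_def by (simp only: sum_product mult.assoc)
    also have "\<dots> = (\<Sum>c<k. complex_of_real ((cmod (y c))\<^sup>2))"
      by (intro sum.cong refl) (simp only: vR lessThan_iff complex_norm_square mult.commute)
    finally have RRv: "Re (quad_form k (R * R) v) = (\<Sum>c<k. (cmod (y c))\<^sup>2)"
      by (simp del: of_real_power)
    have "re_trace R' = (\<Sum>a<k. Re (R $$ (a, a)) - (cmod (y a))\<^sup>2 / (1 + Re (quad_form k R v)))"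
      unfolding re_trace_def
    proof (intro sum.cong)
      fix a assume "a \<in> {..<k}"
      then have "R' $$ (a, a) = R $$ (a, a) - complex_of_real ((cmod (y a))\<^sup>2 / (1 + Re (quad_form k R v)))"
        by (simp only: R'_entry lessThan_iff of_real_divide complex_norm_square s_real)
      then show "Re (R' $$ (a, a)) = Re (R $$ (a, a)) - (cmod (y a))\<^sup>2 / (1 + Re (quad_form k R v))"
        by (simp only: minus_complex.sel Re_complex_of_real)
    qed (simp add: R'_def)
    then show ?thesis
      using carrier_matD(1)[OF c(1)] by (simp add: RRv sum_subtractf sum_divide_distrib re_trace_def)
  qed
  ultimately show ?thesis using R'c by blast
qed

text \<open>The common value of the squared norms is forced, since by tightness they add up to tr 1
  = k. Equal norms make the trace of the partial frame operator depend on the number of chosen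
  vectors only.\<close>

locale tight_frame =
  fixes k :: nat and I :: "'i set" and v :: "'i \<Rightarrow> nat \<Rightarrow> complex"
  assumes finite_index: "finite I"
    and dim_pos: "k > 0"
    and tight: "\<And>a b. a < k \<Longrightarrow> b < k \<Longrightarrow> (\<Sum>i\<in>I. v i a * cnj (v i b)) = (if a = b then 1 else 0)"
    and equal_norm: "\<And>i. i \<in> I \<Longrightarrow> (\<Sum>a<k. (cmod (v i a))\<^sup>2) = real k / real (card I)"
begin

abbreviation "M \<equiv> shifted_frame_op k v"

lemma re_trace_frame_op:
  assumes "J \<subseteq> I"
  shows "re_trace (frame_op k v J) = real (card J) * real k / real (card I)"
proof -
  have "1\<^sub>m k * frame_op k v J = frame_op k v J" by (simp add: left_mult_one_mat[of _ k k])
  moreover have "1\<^sub>m k = complex_of_real 1 \<cdot>\<^sub>m 1\<^sub>m k" by auto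
  ultimately have "re_trace (frame_op k v J) = (\<Sum>i\<in>J. \<Sum>a<k. (cmod (v i a))\<^sup>2)"
    using re_trace_mult_frame_op[of "1\<^sub>m k" k v J] quad_form_scalar[of k 1] by simp
  also have "\<dots> = (\<Sum>i\<in>J. real k / real (card I))"
    using assms by (intro sum.cong) (auto simp: equal_norm)
  finally show ?thesis by simp
qed

lemma re_trace_shifted:
  assumes "J \<subseteq> I"
  shows "re_trace (M J l) = real k * (real (card J) / real (card I) - l)"
  unfolding shifted_frame_op_def
  by (subst re_trace_add[of _ k]) (simp_all add: re_trace_smult[of _ k] re_trace_one re_trace_frame_op[OF assms]
      field_simps del: of_real_minus)

text \<open>The inequality between arithmetic and harmonic means of the eigenvalues of
  \<open>M J l\<close>. It bounds the potential from below, which controls the term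
  \<open>real k / (\<delta> * re_trace R)\<close> in \<open>barrier_step\<close>.\<close>

lemma re_trace_inverse_ge:
  assumes "J \<subseteq> I" and R: "psd_mat k R" and RM: "R * M J l = 1\<^sub>m k" and MR: "M J l * R = 1\<^sub>m k"
  shows "real k \<le> re_trace R * (real (card J) / real (card I) - l)"
proof -
  have "(real k)\<^sup>2 \<le> re_trace R * re_trace (M J l * (R * M J l))"
    using re_trace_Cauchy_Schwarz[OF R hermitian_shifted_frame_op[of k v J l]] by (simp add: RM re_trace_one)
  also have "M J l * (R * M J l) = M J l" by (simp add: RM right_mult_one_mat[of _ k k])
  finally have "real k * real k \<le> real k * (re_trace R * (real (card J) / real (card I) - l))"
    by (simp add: re_trace_shifted[OF assms(1)] power2_eq_square mult.left_commute)
  then show ?thesis using dim_pos by simp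
qed

text \<open>By tightness the unchosen vectors sum to the identity minus B, an affine function of
  \<open>M J l\<close>. Multiplied by powers of the inverse, averages over \<open>I - J\<close>
  therefore become traces of powers of the inverse.\<close>

lemma frame_op_complement:
  assumes "J \<subseteq> I"
  shows "frame_op k v (I - J) = complex_of_real (1 - l) \<cdot>\<^sub>m 1\<^sub>m k - M J l"
proof (rule eq_matI)
  fix a b assume "a < dim_row (complex_of_real (1 - l) \<cdot>\<^sub>m 1\<^sub>m k - M J l)"
    "b < dim_col (complex_of_real (1 - l) \<cdot>\<^sub>m 1\<^sub>m k - M J l)"
  then have ab: "a < k" "b < k" by (auto simp: shifted_frame_op_def frame_op_def)
  show "frame_op k v (I - J) $$ (a, b) = (complex_of_real (1 - l) \<cdot>\<^sub>m 1\<^sub>m k - M J l) $$ (a, b)"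
    using ab by (simp add: shifted_frame_op_def frame_op_def sum_diff[OF finite_index assms] tight)
qed (auto simp: shifted_frame_op_def frame_op_def)

lemma sum_quad_form_complement:
  assumes J: "J \<subseteq> I" and X: "X \<in> carrier_mat k k"
  shows "(\<Sum>i\<in>I - J. Re (quad_form k X (v i))) = (1 - l) * re_trace X - re_trace (X * M J l)"
proof -
  have "(\<Sum>i\<in>I - J. Re (quad_form k X (v i))) = re_trace (X * (complex_of_real (1 - l) \<cdot>\<^sub>m 1\<^sub>m k - M J l))"
    unfolding re_trace_mult_frame_op[OF X, symmetric] frame_op_complement[OF J, of l] ..
  also have "X * (complex_of_real (1 - l) \<cdot>\<^sub>m 1\<^sub>m k - M J l) = complex_of_real (1 - l) \<cdot>\<^sub>m X - X * M J l"
    using X by (subst mult_minus_distrib_mat[of _ k k _ k])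
      (simp_all add: mult_smult_distrib[of _ k k _ k] right_mult_one_mat[of _ k k] del: of_real_diff)
  also have "re_trace \<dots> = (1 - l) * re_trace X - re_trace (X * M J l)"
    using X mult_carrier_mat[OF X shifted_frame_op_carrier[of k v J l]]
    by (subst re_trace_diff[of _ k]) (simp_all add: re_trace_smult[of _ k] del: of_real_diff)
  finally show ?thesis .
qed

text \<open>The hypothesis \<open>room\<close> is what remains of the averaged inequality after
  division by \<open>\<delta>\<close> times t, where t = tr (R R') and R' is the inverse at the
  raised level: card I + 1 collects the terms proportional to \<open>\<delta>\<close> t, and k /
  (\<open>\<delta>\<close> tr R) dominates tr R / (\<open>\<delta>\<close> t).\<close>

lemma barrier_step:
  fixes \<delta> l :: real
  assumes J: "J \<subset> I" and R: "psd_mat k R" and RM: "R * M J l = 1\<^sub>m k" and MR: "M J l * R = 1\<^sub>m k"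
    and \<delta>: "0 < \<delta>" "\<delta> * re_trace R < 1" and l: "l + \<delta> \<le> 1"
    and room: "real (card I) + 1 + real k / (\<delta> * re_trace R) \<le> (1 - (l + \<delta>)) * (1 / \<delta> - re_trace R)"
  shows "\<exists>i\<in>I - J. \<exists>R'. psd_mat k R' \<and> R' * M (insert i J) (l + \<delta>) = 1\<^sub>m k \<and>
           M (insert i J) (l + \<delta>) * R' = 1\<^sub>m k \<and> re_trace R' \<le> re_trace R"
proof -
  have JI: "J \<subseteq> I" using J by blast
  note [simp] = mult_carrier_mat[of _ k k _ k] left_mult_one_mat[of _ k k] right_mult_one_mat[of _ k k]
  note cR [simp] = psd_matD(2)[OF R]
  define l' where "l' = l + \<delta>"
  define \<Phi> where "\<Phi> = re_trace R"
  have "0 \<le> re_trace R"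
    using psd_re_trace_sandwich_nonneg[OF R hermitian_one] by simp
  moreover have "re_trace R \<noteq> 0"
    using re_trace_inverse_ge[OF JI R RM MR] dim_pos by auto
  ultimately have \<Phi>: "\<Phi> > 0" by (simp add: \<Phi>_def)
  have M_eq: "M J l = complex_of_real \<delta> \<cdot>\<^sub>m 1\<^sub>m k + M J l'"
    unfolding shifted_frame_op_def l'_def frame_op_def by (rule eq_matI) auto
  \<comment> \<open>Raising the level by \<open>\<delta>\<close> preserves positive definiteness
    because the smallest eigenvalue of \<open>M J l\<close> is at least 1 / \<open>\<Phi>\<close>,
    which exceeds \<open>\<delta>\<close>.\<close>
  have pos: "0 < Re (quad_form k (M J l') x)" if x: "\<exists>a<k. x a \<noteq> 0" for x
  proof -
    define n where "n = (\<Sum>a<k. (cmod (x a))\<^sup>2)"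
    obtain a0 where a0: "a0 < k" "x a0 \<noteq> 0" using x by blast
    have "0 < (cmod (x a0))\<^sup>2" using a0 by simp
    also have "\<dots> \<le> n" unfolding n_def using a0 by (intro member_le_sum) auto
    finally have n: "0 < n" .
    have "n \<le> \<Phi> * Re (quad_form k (M J l) x)"
      unfolding n_def \<Phi>_def by (rule norm_sq_le_trace_inverse_quad_form[OF R hermitian_shifted_frame_op RM])
    also have "Re (quad_form k (M J l) x) = \<delta> * n + Re (quad_form k (M J l') x)"
      unfolding quad_form_shifted_frame_op n_def[symmetric] l'_def by (simp add: algebra_simps)
    finally have "n * (1 - \<delta> * \<Phi>) \<le> \<Phi> * Re (quad_form k (M J l') x)"
      by (simp add: algebra_simps)
    moreover have "0 < n * (1 - \<delta> * \<Phi>)" using n \<delta> by (simp add: \<Phi>_def)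
    ultimately show ?thesis using \<Phi> by (smt (verit) mult_nonneg_nonpos)
  qed
  obtain R' where R': "psd_mat k R'" and MR': "M J l' * R' = 1\<^sub>m k" and RM': "R' * M J l' = 1\<^sub>m k"
    using pd_mat_invertible[OF hermitian_shifted_frame_op pos] by blast
  note cR' [simp] = psd_matD(2)[OF R']
  \<comment> \<open>Resolvent identity R' = R + \<open>\<delta>\<close> R R', obtained by writing
    \<open>M J l\<close> between \<open>R\<close> and \<open>R'\<close> as \<open>\<delta>\<close>
    plus the shifted matrix. Its trace shows that the shift raises the potential by
    \<open>\<delta>\<close> t.\<close>
  have "R * (M J l * R') = R'" using assoc_mult_mat[OF cR shifted_frame_op_carrier cR', of v J l] by (simp add: RM)
  moreover have "M J l * R' = complex_of_real \<delta> \<cdot>\<^sub>m R' + 1\<^sub>m k"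
    unfolding M_eq by (subst add_mult_distrib_mat[of _ k k _ _ k]) (simp_all add: MR' mult_smult_assoc_mat[of _ k k _ k])
  moreover have "R * (complex_of_real \<delta> \<cdot>\<^sub>m R' + 1\<^sub>m k) = complex_of_real \<delta> \<cdot>\<^sub>m (R * R') + R"
    by (subst mult_add_distrib_mat[of _ k k _ k]) (simp_all add: mult_smult_distrib[of _ k k _ k])
  ultimately have R'_eq: "R' = complex_of_real \<delta> \<cdot>\<^sub>m (R * R') + R" by simp
  define t where "t = re_trace (R * R')"
  define u where "u = re_trace (R' * (R * R'))"
  have tr': "re_trace R' = \<delta> * t + \<Phi>"
    unfolding t_def \<Phi>_def by (subst R'_eq) (simp add: re_trace_add[of _ k] re_trace_smult[of _ k])
  have "R' * R' = complex_of_real \<delta> \<cdot>\<^sub>m (R' * (R * R')) + R' * R"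
    by (subst (2) R'_eq, subst mult_add_distrib_mat[of _ k k _ k]) (simp_all add: mult_smult_distrib[of _ k k _ k])
  then have trsq: "re_trace (R' * R') = \<delta> * u + t"
    unfolding t_def u_def
    by (simp add: re_trace_add[of _ k] re_trace_smult[of _ k] re_trace_mult_comm[of R' k R])
  have "R * R' = complex_of_real \<delta> \<cdot>\<^sub>m (R * (R * R')) + R * R"
    by (subst (1) R'_eq, subst mult_add_distrib_mat[of _ k k _ k]) (simp_all add: mult_smult_distrib[of _ k k _ k])
  then have "t = \<delta> * re_trace (R * (R * R')) + re_trace (R * R)"
    unfolding t_def by (metis cR cR' mult_carrier_mat re_trace_add re_trace_smult smult_carrier_mat)
  moreover have "re_trace (R * (R * R')) = re_trace (R * (R' * R))"
    using re_trace_mult_comm[of R k "R * R'"] assoc_mult_mat[OF cR cR' cR] by simp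
  moreover have "0 \<le> re_trace (R * (R' * R))"
    by (rule psd_re_trace_sandwich_nonneg[OF R' psd_matD(1)[OF R]])
  ultimately have t_ge: "re_trace (R * R) \<le> t" using \<delta> by simp
  have "(re_trace (1\<^sub>m k * R))\<^sup>2 \<le> re_trace (1\<^sub>m k) * re_trace (R * (1\<^sub>m k * R))"
    by (rule re_trace_Cauchy_Schwarz[OF psd_one psd_matD(1)[OF R]])
  then have "\<Phi>\<^sup>2 \<le> real k * re_trace (R * R)"
    by (simp add: \<Phi>_def re_trace_one)
  also have "\<dots> \<le> real k * t" using t_ge by (simp add: mult_left_mono)
  finally have kt: "\<Phi>\<^sup>2 \<le> real k * t" .
  have t: "t > 0"
    using kt \<Phi> dim_pos by (smt (verit) mult_nonneg_nonpos of_nat_0_le_iff zero_less_power)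
  have tu: "t\<^sup>2 \<le> \<Phi> * u"
    using re_trace_Cauchy_Schwarz[OF R psd_matD(1)[OF R']] by (simp add: t_def u_def \<Phi>_def)
  \<comment> \<open>The gain from u is needed at exactly this size: in the averaged inequality it
    cancels the quadratic term in \<open>\<delta>\<close> t.\<close>
  have "\<delta> * t\<^sup>2 \<le> \<delta> * (\<Phi> * u)" using tu \<delta> by (intro mult_left_mono) auto
  also have "\<dots> \<le> u"
  proof -
    have "u \<ge> 0" unfolding u_def by (rule psd_re_trace_sandwich_nonneg[OF R psd_matD(1)[OF R']])
    then show ?thesis using \<delta> mult_right_mono[of "\<delta> * \<Phi>" 1 u] by (simp add: \<Phi>_def mult.assoc)
  qed
  finally have ut: "\<delta> * t\<^sup>2 \<le> u" .
  \<comment> \<open>By the Sherman-Morrison formula, \<open>w i \<ge> 0\<close> says that adding \<open>v i\<close> makes up for the increase \<open>\<delta> t\<close>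
    of the trace under the shift \<open>l \<rightarrow> l'\<close>; we average \<open>w\<close> over the vectors not yet chosen.\<close>
  define w where "w = (\<lambda>i. Re (quad_form k (R' * R') (v i)) - \<delta> * t * (1 + Re (quad_form k R' (v i))))"
  have RRM: "(R' * R') * M J l' = R'"
    using assoc_mult_mat[OF cR' cR' shifted_frame_op_carrier, of v J l'] by (simp add: RM')
  have sum_w: "(\<Sum>i\<in>I - J. w i) = (1 - l') * (\<delta> * u + t) - (\<delta> * t + \<Phi>)
      - \<delta> * t * (real (card (I - J)) + (1 - l') * (\<delta> * t + \<Phi>) - real k)"
  proof -
    have "(\<Sum>i\<in>I - J. w i) = (\<Sum>i\<in>I - J. Re (quad_form k (R' * R') (v i)))
      - \<delta> * t * (real (card (I - J)) + (\<Sum>i\<in>I - J. Re (quad_form k R' (v i))))"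
      by (simp add: w_def sum_subtractf sum_distrib_left[symmetric] sum.distrib)
    then show ?thesis
      by (simp add: sum_quad_form_complement[OF JI, of _ l'] RRM RM' trsq tr' re_trace_one add_diff_eq
          del: assoc_mult_mat)
  qed
  have "0 \<le> (\<Sum>i\<in>I - J. w i)"
  proof -
    have c1: "(1 - l') * (\<delta> * u + t) \<ge> (1 - l') * (\<delta> * (\<delta> * t\<^sup>2) + t)"
      using ut \<delta> l by (intro mult_left_mono add_right_mono) (auto simp: l'_def)
    have c2: "real (card (I - J)) \<le> real (card I)"
      using finite_index by (simp add: card_mono)
    \<comment> \<open>The stray \<open>\<Phi>\<close> carries no factor t; the bound on
      \<open>\<Phi>\<close> squared by k t trades it for a multiple of \<open>\<delta>\<close>
      t.\<close>
    have "real k / (\<delta> * \<Phi>) * (\<delta> * t) = real k * t / \<Phi>" using \<delta> by simp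
    also have "\<dots> \<ge> \<Phi>" using kt \<Phi> by (simp add: field_simps power2_eq_square)
    finally have c3: "\<Phi> \<le> real k / (\<delta> * \<Phi>) * (\<delta> * t)" .
    have "(real (card I) + 1 + real k / (\<delta> * \<Phi>)) * (\<delta> * t) \<le> (1 - l') * (1 / \<delta> - \<Phi>) * (\<delta> * t)"
      using room \<delta> t by (intro mult_right_mono) (auto simp: l'_def \<Phi>_def)
    also have "\<dots> = (1 - l') * (t - \<delta> * t * \<Phi>)" using \<delta> by (simp add: field_simps)
    finally have c4: "real (card I) * (\<delta> * t) + \<delta> * t + \<Phi> \<le> (1 - l') * (t - \<delta> * t * \<Phi>)"
      using c3 by (simp add: algebra_simps)
    have "(1 - l') * (\<delta> * (\<delta> * t\<^sup>2) + t) - \<delta> * t * ((1 - l') * (\<delta> * t + \<Phi>)) = (1 - l') * (t - \<delta> * t * \<Phi>)"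
      by (simp add: algebra_simps power2_eq_square)
    moreover have "\<delta> * t * real (card (I - J)) \<le> real (card I) * (\<delta> * t)"
      using c2 \<delta> t by (simp add: mult.commute mult_left_mono)
    moreover have "0 \<le> \<delta> * t * real k" using \<delta> t by simp
    ultimately show ?thesis
      unfolding sum_w right_diff_distrib[of "\<delta> * t"] distrib_left[of "\<delta> * t" "real (card (I - J))"]
      using c1 c4 by linarith
  qed
  moreover have "(\<Sum>i\<in>I - J. w i) < (\<Sum>i\<in>I - J. 0)" if "\<forall>i\<in>I - J. w i < 0"
    using that J finite_index by (intro sum_strict_mono) auto
  ultimately obtain i where i: "i \<in> I - J" "0 \<le> w i"
    by (auto simp: not_less[symmetric])
  define M' where "M' = M (insert i J) l'"
  have M'_entry: "M' $$ (a, b) = M J l' $$ (a, b) + v i a * cnj (v i b)" if "a < k" "b < k" for a b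
    using that i finite_subset[OF JI finite_index] by (simp add: M'_def shifted_frame_op_def frame_op_def)
  obtain R'' where cR'': "R'' \<in> carrier_mat k k" and MR'': "M' * R'' = 1\<^sub>m k"
    and tr'': "re_trace R'' = re_trace R' - Re (quad_form k (R' * R') (v i)) / (1 + Re (quad_form k R' (v i)))"
    using Sherman_Morrison[OF hermitian_shifted_frame_op R' MR' _ M'_entry] by (auto simp: M'_def)
  have "psd_mat k M'"
    unfolding psd_mat_def
  proof (intro conjI allI)
    show "hermitian_mat k M'" unfolding M'_def by (rule hermitian_shifted_frame_op)
    fix x
    have "psd_mat k (M J l')" by (rule psd_inverse[OF R' _ RM']) simp
    then have "0 \<le> Re (quad_form k (M J l') x)" by (rule psd_matD(3))
    also have "\<dots> \<le> Re (quad_form k M' x)"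
      unfolding M'_def quad_form_shifted_frame_op using i finite_subset[OF JI finite_index] by simp
    finally show "0 \<le> Re (quad_form k M' x)" .
  qed
  then have R'': "psd_mat k R''" by (rule psd_inverse[OF _ cR'' MR''])
  have RM'': "R'' * M' = 1\<^sub>m k"
    by (rule mat_mult_left_right_inverse[OF _ cR'' MR'']) (simp add: M'_def)
  have "re_trace R'' \<le> re_trace R"
  proof -
    have q: "0 < 1 + Re (quad_form k R' (v i))" using psd_matD(3)[OF R', of "v i"] by simp
    have "\<delta> * t \<le> Re (quad_form k (R' * R') (v i)) / (1 + Re (quad_form k R' (v i)))"
      using i(2) q by (simp add: w_def pos_le_divide_eq)
    then show ?thesis unfolding tr'' tr' \<Phi>_def by simp
  qed
  then show ?thesis using i(1) R'' RM'' MR'' unfolding M'_def l'_def by blast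
qed

text \<open>The level starts at -k / \<open>\<Phi>\<close>, where the potential is exactly
  \<open>\<Phi>\<close>, and gains \<open>\<delta>\<close> per chosen vector while the potential
  never increases. The parameters are such that (1 + d/2) k steps bring it to 0. As m is at least (1
  + 3d/4) k, a surplus of d k / 4 steps remains, and it produces the frame bound.\<close>

theorem subset_lower_frame_bound:
  fixes d :: real and m :: nat
  assumes d: "0 < d" "d \<le> 1"
    and small: "real k \<le> d / (4 * (2 + d)\<^sup>2) * real (card I)"
    and m: "(1 + 3 * d / 4) * real k \<le> real m" "real m \<le> (1 + d) * real k"
  shows "\<exists>J\<subseteq>I. card J = m \<and> (\<forall>x. d\<^sup>2 / 96 * real k / real (card I) * (\<Sum>a<k. (cmod (x a))\<^sup>2)
            \<le> (\<Sum>i\<in>J. (cmod (\<Sum>a<k. cnj (x a) * v i a))\<^sup>2))"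
proof -
  define N where "N = real (card I)"
  \<comment> \<open>These choices give \<open>\<delta>\<close> \<open>\<Phi>\<close> = 2 / e < 1,
    the gap 1 / \<open>\<delta>\<close> - \<open>\<Phi>\<close> = 8 N required by
    \<open>room\<close>, and k / \<open>\<Phi>\<close> = (e / 2) k \<open>\<delta>\<close>, so the
    initial debt is paid after (e / 2) k steps.\<close>
  define e where "e = 2 + d"
  define \<delta> where "\<delta> = d / (8 * e * N)"
  define \<Phi> where "\<Phi> = 16 / d * N"
  define l where "l s = - real k / \<Phi> + real s * \<delta>" for s :: nat
  have e: "2 \<le> e" "e \<le> 3" using d by (auto simp: e_def)
  have k: "real k \<ge> 1" using dim_pos by simp
  have "0 < d / (4 * (2 + d)\<^sup>2) * N" using small k unfolding N_def by linarith
  then have N0: "N > 0" using d by (simp add: zero_less_mult_iff zero_less_divide_iff)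
  have kN: "real k * (4 * (2 + d)\<^sup>2) \<le> d * N"
    using small d unfolding N_def[symmetric] by (simp add: field_simps)
  have "real k * 16 \<le> real k * (4 * (2 + d)\<^sup>2)"
    using d power_mono[of 2 "2 + d" 2] by (intro mult_left_mono) auto
  also have "\<dots> \<le> d * N" by (rule kN)
  finally have k16: "real k * 16 \<le> d * N" .
  then have k16': "real k * 16 \<le> N" using mult_right_mono[OF d(2), of N] N0 by linarith
  have \<delta>0: "\<delta> > 0" and \<Phi>0: "\<Phi> > 0" using d N0 e by (auto simp: \<delta>_def \<Phi>_def)
  have \<delta>\<Phi>: "\<delta> * \<Phi> = 2 / e" using d N0 e by (simp add: \<delta>_def \<Phi>_def field_simps)
  have "\<exists>J R. J \<subseteq> I \<and> card J = s \<and> psd_mat k R \<and> R * M J (l s) = 1\<^sub>m k \<and> M J (l s) * R = 1\<^sub>m k \<and>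
      re_trace R \<le> \<Phi>" if "s \<le> m" for s
    using that
  proof (induction s)
    case 0
    define R where "R = complex_of_real (\<Phi> / real k) \<cdot>\<^sub>m 1\<^sub>m k"
    have M0: "M {} (l 0) = complex_of_real (real k / \<Phi>) \<cdot>\<^sub>m 1\<^sub>m k"
      unfolding shifted_frame_op_def frame_op_def l_def by (rule eq_matI) auto
    have c: "R \<in> carrier_mat k k" by (simp add: R_def)
    have "M {} (l 0) * R = complex_of_real (\<Phi> / real k) \<cdot>\<^sub>m (complex_of_real (real k / \<Phi>) \<cdot>\<^sub>m 1\<^sub>m k)"
      unfolding M0 R_def
      by (simp only: mult_smult_distrib[of _ k k _ k] one_carrier_mat smult_carrier_mat right_mult_one_mat[of _ k k])
    also have "\<dots> = 1\<^sub>m k"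
      using \<Phi>0 dim_pos by (intro eq_matI) auto
    finally have "M {} (l 0) * R = 1\<^sub>m k" .
    moreover from this have "R * M {} (l 0) = 1\<^sub>m k"
      by (rule mat_mult_left_right_inverse[OF shifted_frame_op_carrier c])
    moreover have "psd_mat k R" unfolding R_def using \<Phi>0 by (intro psd_scalar) simp
    moreover have "re_trace R = \<Phi>"
      unfolding R_def using dim_pos by (simp only: re_trace_smult[of _ k] one_carrier_mat re_trace_one) simp
    ultimately show ?case by (intro exI[of _ "{}"] exI[of _ R]) simp
  next
    case (Suc s)
    then obtain J R where J: "J \<subseteq> I" "card J = s" and R: "psd_mat k R"
      and RM: "R * M J (l s) = 1\<^sub>m k" and MR: "M J (l s) * R = 1\<^sub>m k" and tr: "re_trace R \<le> \<Phi>"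
      by auto
    have s: "real s + 1 \<le> (1 + d) * real k" using Suc.prems m(2) by linarith
    have sk: "real s + 1 \<le> 2 * real k" using s d mult_right_mono[of d 1 "real k"] by (simp add: distrib_right)
    have "real (card J) < N" using sk k16' k J by simp
    then have JI: "J \<subset> I" using J N_def by auto
    have lSuc: "l (Suc s) = l s + \<delta>" by (simp add: l_def algebra_simps)
    \<comment> \<open>The level never exceeds 1/8, so the factor 1 - l in \<open>room\<close> is at
      least 7/8.\<close>
    have "0 \<le> real k / \<Phi>" using \<Phi>0 by simp
    then have "l s + \<delta> \<le> (real s + 1) * \<delta>" by (simp add: l_def algebra_simps)
    also have "\<dots> \<le> 2 * real k * \<delta>" using sk \<delta>0 by (intro mult_right_mono) auto
    also have "\<dots> \<le> 2 * real k * (1 / (16 * N))"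
    proof (intro mult_left_mono)
      have "\<delta> \<le> 1 / (8 * e * N)" unfolding \<delta>_def using d e N0 by (intro divide_right_mono) auto
      also have "\<dots> \<le> 1 / (16 * N)" using e N0 by (intro divide_left_mono mult_right_mono) auto
      finally show "\<delta> \<le> 1 / (16 * N)" .
    qed simp
    also have "\<dots> \<le> 1 / 8" using k16' N0 by (simp add: field_simps)
    finally have l8: "l s + \<delta> \<le> 1 / 8" .
    have "real s / N - l s \<le> real s / N + real k / \<Phi>"
      using \<delta>0 by (simp add: l_def)
    also have "\<dots> \<le> ((1 + d) * real k) / N + real k / N"
    proof (intro add_mono divide_right_mono)
      show "real k / \<Phi> \<le> real k / N"
        using N0 d by (intro divide_left_mono mult_pos_pos) (auto simp: \<Phi>_def field_simps)
    qed (use s N0 in auto)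
    also have "\<dots> = (2 + d) * real k / N" by (simp add: add_divide_distrib[symmetric] algebra_simps)
    finally have gap: "real s / N - l s \<le> (2 + d) * real k / N" .
    \<comment> \<open>The potential is at least N / (2 + d). Together with the smallness of k / N
      this bounds k / (\<open>\<delta>\<close> tr R) by 2 N.\<close>
    have inv: "real k \<le> re_trace R * (real s / N - l s)"
      using re_trace_inverse_ge[OF J(1) R RM MR] by (simp add: J N_def)
    have trR0: "0 \<le> re_trace R"
      using psd_re_trace_sandwich_nonneg[OF R hermitian_one] psd_matD(2)[OF R]
      by (simp add: left_mult_one_mat[of _ k k] right_mult_one_mat[of _ k k])
    have "real k \<le> re_trace R * ((2 + d) * real k / N)"
      using inv mult_left_mono[OF gap trR0] by linarith
    then have "real k * N \<le> re_trace R * (2 + d) * real k" using N0 by (simp add: field_simps)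
    then have tr_ge: "N \<le> re_trace R * (2 + d)" using k by simp
    then have trR: "0 < re_trace R" using N0 d by (smt (verit) mult_nonpos_nonneg)
    have "real k / (\<delta> * re_trace R) \<le> 2 * N"
    proof -
      have "real k * (8 * e * N) \<le> real k * (8 * e * (re_trace R * e))"
        using tr_ge e by (intro mult_left_mono) (auto simp: e_def)
      also have "\<dots> = 2 * (real k * (4 * e\<^sup>2)) * re_trace R" by (simp add: power2_eq_square)
      also have "\<dots> \<le> 2 * (d * N) * re_trace R"
        using kN trR by (intro mult_right_mono mult_left_mono) (auto simp: e_def)
      finally have "real k * (8 * e * N) \<le> 2 * N * (d * re_trace R)" by (simp add: algebra_simps)
      then have "real k * (8 * e * N) / (d * re_trace R) \<le> 2 * N"
        using d trR by (subst pos_divide_le_eq) auto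
      then show ?thesis by (simp add: \<delta>_def)
    qed
    \<comment> \<open>The left side is at most 3 N + 1, well below 7 N since N is at least
      16.\<close>
    then have "N + 1 + real k / (\<delta> * re_trace R) \<le> 7 / 8 * (8 * N)" using k16' k by simp
    also have "\<dots> \<le> (1 - (l s + \<delta>)) * (1 / \<delta> - re_trace R)"
    proof (intro mult_mono)
      have "1 / \<delta> - \<Phi> = 8 * N" using d by (simp add: e_def \<delta>_def \<Phi>_def field_simps)
      then show "8 * N \<le> 1 / \<delta> - re_trace R" using tr by simp
    qed (use l8 N0 in auto)
    finally have room: "real (card I) + 1 + real k / (\<delta> * re_trace R) \<le> (1 - (l s + \<delta>)) * (1 / \<delta> - re_trace R)"
      by (simp add: N_def)
    have "\<delta> * re_trace R \<le> \<delta> * \<Phi>" using tr \<delta>0 by simp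
    then have "\<delta> * re_trace R < 1" using d unfolding \<delta>\<Phi> e_def by (smt (verit) divide_less_eq_1)
    then obtain i R' where i: "i \<in> I - J" and R': "psd_mat k R'" "R' * M (insert i J) (l s + \<delta>) = 1\<^sub>m k"
      "M (insert i J) (l s + \<delta>) * R' = 1\<^sub>m k" "re_trace R' \<le> re_trace R"
      using barrier_step[OF JI R RM MR \<delta>0 _ _ room] l8 by auto
    have "card (insert i J) = Suc s" using i J finite_subset[OF J(1) finite_index] by simp
    then show ?case
      using i J R' tr unfolding lSuc by (intro exI[of _ "insert i J"] exI[of _ R']) auto
  qed
  then obtain J R where J: "J \<subseteq> I" "card J = m" and R: "psd_mat k R" and RM: "R * M J (l m) = 1\<^sub>m k"
    by blast
  have psd: "psd_mat k (M J (l m))" by (rule psd_inverse[OF R _ RM]) simp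
  have l_ge: "d\<^sup>2 / 96 * real k / N \<le> l m"
  \<comment> \<open>The surplus of m over (e / 2) k is at least d k / 4; the 96 is 8 * 4 * 3, with e
    at most 3.\<close>
  proof -
    have "real k / \<Phi> = d / (8 * e * N) * (e / 2 * real k)"
      using d N0 e by (simp add: \<Phi>_def field_simps)
    moreover have "real m * \<delta> = d / (8 * e * N) * real m" by (simp add: \<delta>_def)
    ultimately have "l m = d / (8 * e * N) * (real m - e / 2 * real k)"
      unfolding l_def minus_divide_left[symmetric] right_diff_distrib by linarith
    also have "\<dots> \<ge> d / (8 * e * N) * (d / 4 * real k)"
      using d N0 m e by (intro mult_left_mono) (auto simp: e_def algebra_simps add_divide_distrib)
    also have "d / (8 * e * N) * (d / 4 * real k) = d\<^sup>2 * real k / (32 * e * N)"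
      by (simp add: power2_eq_square)
    also have "\<dots> \<ge> d\<^sup>2 * real k / (96 * N)"
      using d N0 e by (intro divide_left_mono mult_pos_pos mult_right_mono) auto
    finally show ?thesis by simp
  qed
  show ?thesis
  proof (intro exI[of _ J] conjI J allI)
    fix x
    have "d\<^sup>2 / 96 * real k / N * (\<Sum>a<k. (cmod (x a))\<^sup>2) \<le> l m * (\<Sum>a<k. (cmod (x a))\<^sup>2)"
      using l_ge by (intro mult_right_mono sum_nonneg) auto
    also have "\<dots> \<le> (\<Sum>i\<in>J. (cmod (\<Sum>a<k. cnj (x a) * v i a))\<^sup>2)"
      using psd_matD(3)[OF psd, of x] unfolding quad_form_shifted_frame_op by simp
    finally show "d\<^sup>2 / 96 * real k / real (card I) * (\<Sum>a<k. (cmod (x a))\<^sup>2)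
        \<le> (\<Sum>i\<in>J. (cmod (\<Sum>a<k. cnj (x a) * v i a))\<^sup>2)" by (simp add: N_def)
  qed
qed

end

section \<open>Selecting rows of the Fourier matrix\<close>

lemma sum_cis_roots_of_unity:
  fixes p q n :: nat
  assumes "p < n" "q < n"
  shows "(\<Sum>j<n. cis (2 * pi * real j * real p / real n) * cnj (cis (2 * pi * real j * real q / real n)))
     = (if p = q then of_nat n else 0)"
proof -
  define z where "z = cis (2 * pi * (real p - real q) / real n)"
  have "cis (2 * pi * real j * real p / real n) * cnj (cis (2 * pi * real j * real q / real n)) = z ^ j" for j
    unfolding z_def cis_cnj cis_mult Complex.DeMoivre
    by (rule arg_cong[of _ _ cis]) (simp add: algebra_simps diff_divide_distrib)
  then have "(\<Sum>j<n. cis (2 * pi * real j * real p / real n) * cnj (cis (2 * pi * real j * real q / real n)))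
     = (\<Sum>j<n. z ^ j)" by simp
  also have "\<dots> = (if p = q then of_nat n else 0)"
  proof (cases "p = q")
    case True then show ?thesis by (simp add: z_def)
  next
    case False
    have "real n * (2 * pi * (real p - real q) / real n) = 2 * pi * (real p - real q)"
      using assms by simp
    then have zn: "z ^ n = 1"
      unfolding z_def Complex.DeMoivre by (simp only: cis_multiple_2pi Ints_diff Ints_of_nat)
    have "z \<noteq> 1"
    proof
      assume "z = 1"
      have n: "real n > 0" using assms by simp
      from \<open>z = 1\<close> have "cos (2 * pi * (real p - real q) / real n) = 1"
        unfolding z_def by (metis cis.simps(1) one_complex.simps(1))
      then obtain m :: int where "2 * pi * (real p - real q) / real n = real_of_int m * 2 * pi"
        using cos_one_2pi_int by blast
      then have "pi * (real p - real q) = pi * (real_of_int m * real n)" using n by (simp add: field_simps)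
      then have "real p - real q = real_of_int m * real n" by simp
      then have "real_of_int (int p - int q) = real_of_int (m * int n)" by simp
      then have e: "int p - int q = m * int n" by (simp only: of_int_eq_iff)
      then have "\<bar>m * int n\<bar> < int n" using assms by linarith
      then have "\<bar>m\<bar> * int n < 1 * int n" by (simp add: abs_mult)
      then have "m = 0" by (simp only: mult_less_cancel_right) auto
      then show False using e False by simp
    qed
    then show ?thesis using False zn by (simp add: geometric_sum)
  qed
  finally show ?thesis .
qed

text \<open>All \<open>n\<close> rows together would give the factor \<open>n\<close> by
  orthogonality of the columns. For about \<open>card L\<close> rows a fixed multiple of
  \<open>card L\<close> is therefore the natural order.\<close>

definition Fourier_rows_bounded_below :: "real \<Rightarrow> nat \<Rightarrow> nat set \<Rightarrow> nat set \<Rightarrow> bool" where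
  "Fourier_rows_bounded_below c n L J \<longleftrightarrow>
    (\<forall>x :: nat \<Rightarrow> complex. c * real (card L) * (\<Sum>l\<in>L. (cmod (x l))\<^sup>2)
       \<le> (\<Sum>j\<in>J. (cmod (\<Sum>l\<in>L. x l * cis (2 * pi * real j * real l / real n)))\<^sup>2))"

text \<open>A pair (row, copy) indexes a frame of n Q vectors. The selected pairs are projected to
  their rows; a row is hit by at most \<open>Q\<close> pairs, which is the source of the factor 1 /
  \<open>Q\<close> in \<open>c\<close>.\<close>

theorem Fourier_matrix_row_selection:
  fixes d :: real
  assumes "0 < d"
  shows "\<exists>c>0. \<exists>k0. \<forall>n L. L \<subseteq> {..<n} \<and> k0 \<le> card L \<longrightarrow>
    (\<exists>J\<subseteq>{..<n}. real (card J) \<le> (1 + d) * real (card L) \<and>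
      Fourier_rows_bounded_below c n L J)"
proof -
  define e where "e = min d 1"
  have e: "0 < e" "e \<le> 1" "e \<le> d" using assms by (auto simp: e_def)
  \<comment> \<open>With k at most n, this number of copies makes k small enough relative to n Q for
    \<open>subset_lower_frame_bound\<close>, uniformly in k and n.\<close>
  define Q where "Q = nat \<lceil>4 * (2 + e)\<^sup>2 / e\<rceil>"
  have "0 < 4 * (2 + e)\<^sup>2 / e" using e by (intro divide_pos_pos mult_pos_pos zero_less_power) auto
  then have Q: "4 * (2 + e)\<^sup>2 / e \<le> real Q" "Q > 0" by (auto simp: Q_def real_nat_ceiling_ge)
  define c where "c = e\<^sup>2 / 96 / real Q"
  have c: "c > 0" using e Q by (simp add: c_def)
  \<comment> \<open>Rounding (1 + e) k down to an integer loses at most 1, which must fit into the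
    allowance e k / 4.\<close>
  define k0 where "k0 = max 1 (nat \<lceil>4 / e\<rceil>)"
  show ?thesis
  proof (rule exI[of _ c], intro conjI c exI[of _ k0] allI impI)
    fix n :: nat and L assume "L \<subseteq> {..<n} \<and> k0 \<le> card L"
    then have L: "L \<subseteq> {..<n}" "k0 \<le> card L" by auto
    have finL: "finite L" using L finite_subset by blast
    define k where "k = card L"
    have k: "1 \<le> k" "4 / e \<le> real k"
      using L unfolding k_def k0_def by linarith+
    then have ek: "1 \<le> e / 4 * real k" using e by (simp add: field_simps)
    have kn: "k \<le> n" unfolding k_def using card_mono[OF _ L(1)] by simp
    have n: "n > 0" using k kn by simp
    obtain h where h: "bij_betw h {..<k} L"
      using ex_bij_betw_nat_finite[OF finL] by (auto simp: k_def atLeast0LessThan)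
    have hL: "h a \<in> L" "h a < n" if "a < k" for a
      using that h L bij_betwE by (fastforce)+
    define I where "I = {..<n} \<times> {..<Q}"
    have cardI: "card I = n * Q" by (simp add: I_def)
    define r where "r = sqrt (real n * real Q)"
    have r: "r > 0" "r\<^sup>2 = real n * real Q" using n Q by (auto simp: r_def)
    define v where "v i a = cis (2 * pi * real (fst i) * real (h a) / real n) / complex_of_real r"
      for i :: "nat \<times> nat" and a
    interpret tight_frame k I v
    proof
      show "finite I" by (simp add: I_def)
      show "0 < k" using k by simp
    next
      fix a b assume ab: "a < k" "b < k"
      have "(\<Sum>i\<in>I. v i a * cnj (v i b)) = (\<Sum>j<n. \<Sum>q<Q. v (j, q) a * cnj (v (j, q) b))"
        unfolding I_def by (simp add: sum.cartesian_product)
      also have "\<dots> = (\<Sum>j<n. cis (2 * pi * real j * real (h a) / real n) *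
          cnj (cis (2 * pi * real j * real (h b) / real n))) * (of_nat Q / complex_of_real (r\<^sup>2))"
        unfolding sum_distrib_right by (intro sum.cong refl) (simp add: v_def power2_eq_square)
      also have "\<dots> = (if h a = h b then of_nat n else 0) * (of_nat Q / complex_of_real (r\<^sup>2))"
        using ab hL by (subst sum_cis_roots_of_unity) auto
      also have "\<dots> = (if a = b then 1 else 0)"
        using inj_onD[OF bij_betw_imp_inj_on[OF h], of a b] ab n Q unfolding r(2) by auto
      finally show "(\<Sum>i\<in>I. v i a * cnj (v i b)) = (if a = b then 1 else 0)" .
    next
      fix i assume "i \<in> I"
      show "(\<Sum>a<k. (cmod (v i a))\<^sup>2) = real k / real (card I)"
        using r by (simp add: v_def norm_divide power_divide cardI)
    qed
    define m where "m = nat \<lfloor>(1 + e) * real k\<rfloor>"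
    have "0 \<le> (1 + e) * real k" using e by simp
    then have m: "real m \<le> (1 + e) * real k" "(1 + e) * real k - 1 \<le> real m"
      unfolding m_def by linarith+
    have "real k \<le> e / (4 * (2 + e)\<^sup>2) * (4 * (2 + e)\<^sup>2 / e) * real n"
      using e kn by simp
    also have "\<dots> \<le> e / (4 * (2 + e)\<^sup>2) * real Q * real n"
      using e Q by (intro mult_right_mono mult_left_mono) auto
    finally have small: "real k \<le> e / (4 * (2 + e)\<^sup>2) * real (card I)"
      by (simp add: cardI mult.commute mult.left_commute)
    have "(1 + 3 * e / 4) * real k \<le> real m" using m ek by (simp add: algebra_simps)
    from subset_lower_frame_bound[OF e(1,2) small this m(1)]
    obtain J' where J': "J' \<subseteq> I" "card J' = m" and
      bound: "\<And>x. e\<^sup>2 / 96 * real k / real (card I) * (\<Sum>a<k. (cmod (x a))\<^sup>2)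
            \<le> (\<Sum>i\<in>J'. (cmod (\<Sum>a<k. cnj (x a) * v i a))\<^sup>2)" by blast
    define J where "J = fst ` J'"
    have finJ': "finite J'" using J'(1) finite_index finite_subset by blast
    show "\<exists>J\<subseteq>{..<n}. real (card J) \<le> (1 + d) * real (card L) \<and> Fourier_rows_bounded_below c n L J"
      unfolding Fourier_rows_bounded_below_def
    proof (intro exI[of _ J] conjI allI)
      show "J \<subseteq> {..<n}" using J' by (auto simp: J_def I_def)
      have "real (card J) \<le> real m" using card_image_le[OF finJ', of fst] J' by (simp add: J_def)
      also have "\<dots> \<le> (1 + e) * real k" by (rule m)
      also have "\<dots> \<le> (1 + d) * real k" using e by (intro mult_right_mono) auto
      finally show "real (card J) \<le> (1 + d) * real (card L)" by (simp add: k_def)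
      fix x :: "nat \<Rightarrow> complex"
      define F where "F j = (cmod (\<Sum>l\<in>L. x l * cis (2 * pi * real j * real l / real n)))\<^sup>2" for j :: nat
      \<comment> \<open>The frame bound pairs \<open>v\<close> with the conjugate of its argument,
        so it is tested at the conjugated coefficients.\<close>
      have "(\<Sum>a<k. cnj (cnj (x (h a))) * v i a) = (\<Sum>l\<in>L. x l * cis (2 * pi * real (fst i) * real l / real n)) / complex_of_real r" for i
        unfolding v_def by (subst sum.reindex_bij_betw[OF h, symmetric]) (simp add: sum_divide_distrib)
      then have Fi: "(cmod (\<Sum>a<k. cnj (cnj (x (h a))) * v i a))\<^sup>2 = F (fst i) / (real n * real Q)" for i
        using r by (simp add: F_def norm_divide power_divide)
      have "e\<^sup>2 / 96 * real k / real (card I) * (\<Sum>l\<in>L. (cmod (x l))\<^sup>2) \<le> (\<Sum>i\<in>J'. F (fst i) / (real n * real Q))"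
        using bound[of "\<lambda>a. cnj (x (h a))"] unfolding Fi
        by (subst sum.reindex_bij_betw[OF h, symmetric]) simp
      also have "\<dots> \<le> (\<Sum>i\<in>J \<times> {..<Q}. F (fst i) / (real n * real Q))"
      proof (intro sum_mono2)
        show "finite (J \<times> {..<Q})" using finJ' by (simp add: J_def)
        show "J' \<subseteq> J \<times> {..<Q}" using J' by (force simp: J_def I_def)
      qed (simp add: F_def)
      also have "\<dots> = (\<Sum>j\<in>J. F j) / real n"
        using Q by (simp add: sum.cartesian_product' sum_divide_distrib)
      finally have "e\<^sup>2 / 96 * real k / real (card I) * (\<Sum>l\<in>L. (cmod (x l))\<^sup>2) * real n \<le> (\<Sum>j\<in>J. F j)"
        using n by (simp add: pos_le_divide_eq)
      moreover have "e\<^sup>2 / 96 * real k / real (card I) * (\<Sum>l\<in>L. (cmod (x l))\<^sup>2) * real n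
         = c * real (card L) * (\<Sum>l\<in>L. (cmod (x l))\<^sup>2)"
        using n Q by (simp add: c_def cardI k_def)
      ultimately show "c * real (card L) * (\<Sum>l\<in>L. (cmod (x l))\<^sup>2)
         \<le> (\<Sum>j\<in>J. (cmod (\<Sum>l\<in>L. x l * cis (2 * pi * real j * real l / real n)))\<^sup>2)"
        by (simp add: F_def)
    qed
  qed
qed

section \<open>Completeness of the exponentials\<close>

text \<open>Generated by rules so that sums stay in the class by definition and products follow by
  induction; explicit coefficients are recovered in \<open>trig_poly_coeffs\<close>.\<close>

inductive trig_poly :: "(real \<Rightarrow> complex) \<Rightarrow> bool" where
  monomial: "trig_poly (\<lambda>t. a * cis (real_of_int m * t))"
| add: "trig_poly f \<Longrightarrow> trig_poly g \<Longrightarrow> trig_poly (\<lambda>t. f t + g t)"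

lemma trig_poly_const: "trig_poly (\<lambda>t. a)"
  using trig_poly.monomial[of a 0] by simp

lemma trig_poly_mult:
  assumes "trig_poly f" "trig_poly g"
  shows "trig_poly (\<lambda>t. f t * g t)"
  using assms
proof (induction rule: trig_poly.induct)
  case (monomial a m)
  from monomial show ?case
  proof (induction rule: trig_poly.induct)
    case (monomial b n)
    have "(\<lambda>t. a * cis (real_of_int m * t) * (b * cis (real_of_int n * t))) =
       (\<lambda>t. (a * b) * cis (real_of_int (m + n) * t))"
      by (simp add: fun_eq_iff distrib_right flip: cis_mult)
    then show ?case by (simp only: trig_poly.monomial)
  next
    case (add f g)
    then show ?case by (simp add: distrib_left trig_poly.add)
  qed
next
  case (add f h)
  then show ?case by (simp add: distrib_right trig_poly.add)
qed

text \<open>Along the unit circle a real linear functional is a combination of cosine and sine,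
  hence of the exponentials with frequencies 1 and -1. Closure under products extends this to
  polynomials.\<close>

lemma trig_poly_real_polynomial_function:
  assumes "real_polynomial_function p"
  shows "trig_poly (\<lambda>t. complex_of_real (p (cis t)))"
  using assms
proof (induction rule: real_polynomial_function.induct)
  case (linear f)
  interpret bounded_linear f by (rule linear)
  have f: "complex_of_real (f (cis t)) = (complex_of_real (f 1) / 2 + complex_of_real (f \<i>) / (2 * \<i>)) * cis (real_of_int 1 * t)
      + (complex_of_real (f 1) / 2 - complex_of_real (f \<i>) / (2 * \<i>)) * cis (real_of_int (- 1) * t)" for t
  proof -
    have "cis t = cos t *\<^sub>R 1 + sin t *\<^sub>R \<i>" by (simp add: complex_eq_iff)
    then have "f (cis t) = cos t * f 1 + sin t * f \<i>" by (simp only: add scaleR real_scaleR_def)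
    then show ?thesis by (simp add: complex_eq_iff)
  qed
  show ?case unfolding f by (intro trig_poly.intros)
next
  case (const c) then show ?case by (simp add: trig_poly_const)
next
  case (add f g) then show ?case by (simp add: trig_poly.add)
next
  case (mult f g) then show ?case by (simp add: trig_poly_mult)
qed

lemma trig_poly_coeffs:
  assumes "trig_poly f"
  shows "\<exists>F p. finite F \<and> (\<forall>t. f t = (\<Sum>m\<in>F. p m * cis (real_of_int m * t)))"
  using assms
proof (induction rule: trig_poly.induct)
  case (monomial a m)
  show ?case by (rule exI[of _ "{m}"], rule exI[of _ "\<lambda>_. a"]) simp
next
  case (add f g)
  then obtain F p G q where F: "finite F" "\<And>t. f t = (\<Sum>m\<in>F. p m * cis (real_of_int m * t))"
    and G: "finite G" "\<And>t. g t = (\<Sum>m\<in>G. q m * cis (real_of_int m * t))" by blast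
  have "f t + g t = (\<Sum>m\<in>F \<union> G. ((if m \<in> F then p m else 0) + (if m \<in> G then q m else 0)) * cis (real_of_int m * t))" for t
  proof -
    have "f t = (\<Sum>m\<in>F \<union> G. (if m \<in> F then p m else 0) * cis (real_of_int m * t))"
      unfolding F(2) using F(1) G(1) by (intro sum.mono_neutral_cong_left) auto
    moreover have "g t = (\<Sum>m\<in>F \<union> G. (if m \<in> G then q m else 0) * cis (real_of_int m * t))"
      unfolding G(2) using F(1) G(1) by (intro sum.mono_neutral_cong_left) auto
    ultimately show ?thesis by (simp add: distrib_right sum.distrib)
  qed
  then show ?case using F(1) G(1) by (intro exI[of _ "F \<union> G"] exI) auto
qed

text \<open>Stone-Weierstrass on the unit circle, to which the periodic function is
  transported.\<close>

lemma trig_approximation: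
  fixes H :: "real \<Rightarrow> complex"
  assumes cont: "continuous_on {0..2 * pi} H" and per: "H 0 = H (2 * pi)" and e: "e > 0"
  shows "\<exists>F p. finite F \<and> (\<forall>t\<in>{0..2 * pi}. cmod (H t - (\<Sum>m\<in>F. p m * cis (real_of_int m * t))) < e)"
proof -
  define S where "S = sphere (0 :: complex) 1"
  have re: "- 1 \<le> Re z \<and> Re z \<le> 1" if "z \<in> S" for z
    using that abs_Re_le_cmod[of z] by (simp add: S_def abs_le_iff)
  have arccos_range: "0 \<le> arccos (Re z)" "arccos (Re z) \<le> pi" if "z \<in> S" for z
    using re[OF that] by (auto intro: arccos_lbound arccos_ubound)
  \<comment> \<open>The two branches of the angle meet at z = -1, where both give \<pi>, and at z =
    1, where they give 0 and 2 \<pi> and agree by periodicity of \<open>H\<close>.\<close>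
  define h where "h z = (if Im z \<ge> 0 then H (arccos (Re z)) else H (2 * pi - arccos (Re z)))" for z
  have "continuous_on ((S \<inter> {z. 0 \<le> Im z}) \<union> (S \<inter> {z. Im z \<le> 0})) h"
    unfolding h_def
  proof (rule continuous_on_cases)
    show "closed (S \<inter> {z. 0 \<le> Im z})" "closed (S \<inter> {z. Im z \<le> 0})"
      by (auto simp: S_def intro!: closed_Int closed_halfspace_Im_ge closed_halfspace_Im_le)
    show "continuous_on (S \<inter> {z. 0 \<le> Im z}) (\<lambda>z. H (arccos (Re z)))"
    proof (rule continuous_on_compose2[OF cont])
      show "continuous_on (S \<inter> {z. 0 \<le> Im z}) (\<lambda>z. arccos (Re z))"
        using re by (intro continuous_intros) auto
      show "(\<lambda>z. arccos (Re z)) ` (S \<inter> {z. 0 \<le> Im z}) \<subseteq> {0..2 * pi}"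
        using arccos_range by (fastforce intro!: image_subsetI)
    qed
    show "continuous_on (S \<inter> {z. Im z \<le> 0}) (\<lambda>z. H (2 * pi - arccos (Re z)))"
    proof (rule continuous_on_compose2[OF cont])
      show "continuous_on (S \<inter> {z. Im z \<le> 0}) (\<lambda>z. 2 * pi - arccos (Re z))"
        using re by (intro continuous_intros) auto
      show "(\<lambda>z. 2 * pi - arccos (Re z)) ` (S \<inter> {z. Im z \<le> 0}) \<subseteq> {0..2 * pi}"
        using arccos_range by (fastforce intro!: image_subsetI)
    qed
    show "\<forall>x. x \<in> S \<inter> {z. 0 \<le> Im z} \<and> \<not> 0 \<le> Im x \<or> x \<in> S \<inter> {z. Im z \<le> 0} \<and> 0 \<le> Im x \<longrightarrow>
        H (arccos (Re x)) = H (2 * pi - arccos (Re x))"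
    proof (intro allI impI)
      fix x assume "x \<in> S \<inter> {z. 0 \<le> Im z} \<and> \<not> 0 \<le> Im x \<or> x \<in> S \<inter> {z. Im z \<le> 0} \<and> 0 \<le> Im x"
      then have "Im x = 0" "cmod x = 1" by (auto simp: S_def)
      then have "Re x = 1 \<or> Re x = - 1" by (simp add: cmod_def abs_if split: if_splits)
      then show "H (arccos (Re x)) = H (2 * pi - arccos (Re x))" using per by auto
    qed
  qed
  moreover have "(S \<inter> {z. 0 \<le> Im z}) \<union> (S \<inter> {z. Im z \<le> 0}) = S" by auto
  ultimately have "continuous_on S h" by simp
  then obtain g where g: "polynomial_function g" "\<And>z. z \<in> S \<Longrightarrow> norm (h z - g z) < e"
    using Stone_Weierstrass_polynomial_function[of S h e] e by (auto simp: S_def)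
  have "real_polynomial_function (Re \<circ> g)" "real_polynomial_function (Im \<circ> g)"
    using g(1) bounded_linear_Re bounded_linear_Im unfolding polynomial_function_def by blast+
  then have "trig_poly (\<lambda>t. complex_of_real (Re (g (cis t))) + \<i> * complex_of_real (Im (g (cis t))))"
    using trig_poly_real_polynomial_function[of "Re \<circ> g"] trig_poly_real_polynomial_function[of "Im \<circ> g"]
    by (intro trig_poly.add trig_poly_mult[OF trig_poly_const]) (simp_all add: o_def)
  then have "trig_poly (\<lambda>t. g (cis t))" by (simp only: complex_eq[symmetric])
  then obtain F p where F: "finite F" "\<And>t. g (cis t) = (\<Sum>m\<in>F. p m * cis (real_of_int m * t))"
    using trig_poly_coeffs by blast
  have "h (cis t) = H t" if t: "t \<in> {0..2 * pi}" for t
  proof (cases "t \<le> pi")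
    case True
    then have "arccos (cos t) = t" using t by (simp add: arccos_cos)
    then show ?thesis using True t sin_ge_zero[of t] by (simp add: h_def)
  next
    case False
    show ?thesis
    proof (cases "t = 2 * pi")
      case True then show ?thesis using per by (simp add: h_def)
    next
      case neq: False
      have "arccos (cos (2 * pi - t)) = 2 * pi - t" using t False by (intro arccos_cos) auto
      then show ?thesis using False neq t sin_lt_zero[of t] by (simp add: h_def cos_diff)
    qed
  qed
  then have "cmod (H t - (\<Sum>m\<in>F. p m * cis (real_of_int m * t))) < e" if "t \<in> {0..2 * pi}" for t
    using g(2)[of "cis t"] F(2)[of t] that by (simp add: S_def)
  then show ?thesis using F(1) by blast
qed

lemma has_integral_cis_period:
  fixes m :: int
  assumes w: "w > 0"
  shows "((\<lambda>t. cis (2 * pi * real_of_int m * t / w)) has_integral (if m = 0 then complex_of_real w else 0)) {0..w}"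
proof (cases "m = 0")
  case True
  then show ?thesis using has_integral_const_real[of "1::complex" 0 w] w by (simp add: scaleR_conv_of_real)
next
  case False
  define a where "a = 2 * pi * real_of_int m / w"
  have a: "a \<noteq> 0" using False w by (simp add: a_def)
  have "((\<lambda>t. cis (a * t)) has_integral (cis (a * w) / (\<i> * a) - cis (a * 0) / (\<i> * a))) {0..w}"
  proof (rule fundamental_theorem_of_calculus)
    fix t
    have "((\<lambda>t. exp (\<i> * a * of_real t) / (\<i> * a)) has_vector_derivative exp (\<i> * a * of_real t)) (at t within {0..w})"
      by (rule has_vector_derivative_real_field) (auto intro!: derivative_eq_intros simp: a)
    then show "((\<lambda>t. cis (a * t) / (\<i> * a)) has_vector_derivative cis (a * t)) (at t within {0..w})"
      by (simp add: cis_conv_exp mult.assoc)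
  qed (use w in simp)
  moreover have "cis (a * w) = 1"
    using w cis_multiple_2pi[of "real_of_int m"] by (simp add: a_def)
  ultimately show ?thesis using False by (simp add: a_def)
qed

text \<open>Only this half of Parseval matters for a lower sampling bound. If P approximates
  \<open>H\<close> uniformly, the integral of |H - P|^2 is small; expanding it and completing the
  square shows that the coefficients of \<open>H\<close> at the frequencies of P already carry
  nearly all the mass. Finite sums are kept so that they can be compared with partial sums of the
  samples.\<close>

lemma Parseval_lower_bound:
  fixes H :: "real \<Rightarrow> complex"
  assumes w: "w > 0" and cont: "continuous_on {0..w} H" and per: "H 0 = H w" and e: "e > 0"
  shows "\<exists>F. finite F \<and> w * integral {0..w} (\<lambda>t. (cmod (H t))\<^sup>2) - e \<le>
     (\<Sum>m\<in>F. (cmod (integral {0..w} (\<lambda>t. H t * cis (2 * pi * real_of_int m * t / w))))\<^sup>2)"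
proof -
  define \<eta> where "\<eta> = sqrt e / w"
  have \<eta>: "\<eta> > 0" "(w * \<eta>)\<^sup>2 = e" using w e by (auto simp: \<eta>_def)
  define H' where "H' s = H (s * w / (2 * pi))" for s
  have contH': "continuous_on {0..2 * pi} H'"
    unfolding H'_def
  proof (rule continuous_on_compose2[OF cont])
    show "(\<lambda>s. s * w / (2 * pi)) ` {0..2 * pi} \<subseteq> {0..w}"
      using w by (auto simp: field_simps)
  qed (intro continuous_intros; simp)
  have perH': "H' 0 = H' (2 * pi)" using per by (simp add: H'_def)
  obtain F0 p0 where F0: "finite F0"
    "\<And>s. s \<in> {0..2 * pi} \<Longrightarrow> cmod (H' s - (\<Sum>m\<in>F0. p0 m * cis (real_of_int m * s))) < \<eta>"
    using trig_approximation[OF contH' perH' \<eta>(1)] by blast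
  define F where "F = uminus ` F0"
  define p where "p m = p0 (- m)" for m
  define E where "E m t = cis (2 * pi * real_of_int m * t / w)" for m t
  define P where "P t = (\<Sum>m\<in>F. p m * cnj (E m t))" for t
  have finF: "finite F" using F0 by (simp add: F_def)
  have close: "cmod (H t - P t) < \<eta>" if t: "t \<in> {0..w}" for t
  proof -
    have "t * (2 * pi) / w \<in> {0..2 * pi}" using t w by (auto simp: field_simps)
    from F0(2)[OF this] have "cmod (H t - (\<Sum>m\<in>F0. p0 m * cis (real_of_int m * (t * (2 * pi) / w)))) < \<eta>"
      using w by (simp add: H'_def)
    also have "(\<Sum>m\<in>F0. p0 m * cis (real_of_int m * (t * (2 * pi) / w))) = P t"
      unfolding P_def F_def by (subst sum.reindex) (auto simp: p_def E_def cis_cnj algebra_simps)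
    finally show ?thesis .
  qed
  define c where "c m = integral {0..w} (\<lambda>t. H t * E m t)" for m
  have contE: "continuous_on {0..w} (E m)" for m unfolding E_def using w by (intro continuous_intros) auto
  have c: "((\<lambda>t. H t * E m t) has_integral c m) {0..w}" for m
    unfolding c_def by (intro integrable_integral integrable_continuous_interval continuous_intros cont contE)
  have c': "((\<lambda>t. cnj (H t) * cnj (E m t)) has_integral cnj (c m)) {0..w}" for m
    using has_integral_linear[OF c bounded_linear_cnj] by (simp add: o_def)
  define a where "a = integral {0..w} (\<lambda>t. (cmod (H t))\<^sup>2)"
  have a: "((\<lambda>t. H t * cnj (H t)) has_integral complex_of_real a) {0..w}"
  proof -
    have "((\<lambda>t. (cmod (H t))\<^sup>2) has_integral a) {0..w}"
      unfolding a_def by (intro integrable_integral integrable_continuous_interval continuous_intros cont)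
    from has_integral_linear[OF this bounded_linear_of_real[where ?'a = complex]] show ?thesis
      by (simp add: o_def complex_norm_square del: of_real_power)
  qed
  have EE: "((\<lambda>t. cnj (E m t) * E m' t) has_integral (if m = m' then complex_of_real w else 0)) {0..w}" for m m'
  proof -
    have "cnj (E m t) * E m' t = cis (2 * pi * real_of_int (m' - m) * t / w)" for t
      unfolding E_def cis_cnj cis_mult by (rule arg_cong[of _ _ cis]) (simp add: algebra_simps diff_divide_distrib)
    moreover have "m' - m = 0 \<longleftrightarrow> m = m'" by auto
    ultimately show ?thesis using has_integral_cis_period[OF w, of "m' - m"] by (simp only:)
  qed
  define b where "b = integral {0..w} (\<lambda>t. (cmod (H t - P t))\<^sup>2)"
  have contP: "continuous_on {0..w} P" unfolding P_def by (intro continuous_intros contE)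
  have b: "((\<lambda>t. (H t - P t) * cnj (H t - P t)) has_integral complex_of_real b) {0..w}"
  proof -
    have "((\<lambda>t. (cmod (H t - P t))\<^sup>2) has_integral b) {0..w}"
      unfolding b_def by (intro integrable_integral integrable_continuous_interval continuous_intros cont contP)
    from has_integral_linear[OF this bounded_linear_of_real[where ?'a = complex]] show ?thesis
      by (simp add: o_def complex_norm_square del: of_real_power complex_cnj_diff)
  qed
  have expand: "(H t - P t) * cnj (H t - P t) = H t * cnj (H t)
      - (\<Sum>m\<in>F. cnj (p m) * (H t * E m t)) - (\<Sum>m\<in>F. p m * (cnj (H t) * cnj (E m t)))
      + (\<Sum>m\<in>F. \<Sum>m'\<in>F. p m * cnj (p m') * (cnj (E m t) * E m' t))" for t
  proof -
    have "P t * cnj (P t) = (\<Sum>m\<in>F. \<Sum>m'\<in>F. p m * cnj (p m') * (cnj (E m t) * E m' t))"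
      unfolding P_def by (simp add: sum_product algebra_simps)
    moreover have "H t * cnj (P t) = (\<Sum>m\<in>F. cnj (p m) * (H t * E m t))"
      unfolding P_def by (simp add: sum_distrib_left algebra_simps)
    moreover have "P t * cnj (H t) = (\<Sum>m\<in>F. p m * (cnj (H t) * cnj (E m t)))"
      unfolding P_def by (simp add: sum_distrib_right sum_distrib_left algebra_simps)
    ultimately show ?thesis by (simp add: algebra_simps)
  qed
  have "((\<lambda>t. (H t - P t) * cnj (H t - P t)) has_integral (complex_of_real a
      - (\<Sum>m\<in>F. cnj (p m) * c m) - (\<Sum>m\<in>F. p m * cnj (c m))
      + (\<Sum>m\<in>F. \<Sum>m'\<in>F. p m * cnj (p m') * (if m = m' then complex_of_real w else 0)))) {0..w}"
    unfolding expand
    by (intro has_integral_add has_integral_diff has_integral_sum has_integral_mult_right a c c' EE finF)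
  moreover have "(\<Sum>m\<in>F. \<Sum>m'\<in>F. p m * cnj (p m') * (if m = m' then complex_of_real w else 0))
      = (\<Sum>m\<in>F. p m * cnj (p m) * w)"
  proof (intro sum.cong refl)
    fix m assume m: "m \<in> F"
    have "(\<Sum>m'\<in>F. p m * cnj (p m') * (if m = m' then complex_of_real w else 0))
        = (\<Sum>m'\<in>F. if m = m' then p m * cnj (p m) * w else 0)" by (intro sum.cong) auto
    then show "(\<Sum>m'\<in>F. p m * cnj (p m') * (if m = m' then complex_of_real w else 0)) = p m * cnj (p m) * w"
      using m finF by simp
  qed
  ultimately have "((\<lambda>t. (H t - P t) * cnj (H t - P t)) has_integral (complex_of_real a
      - (\<Sum>m\<in>F. cnj (p m) * c m) - (\<Sum>m\<in>F. p m * cnj (c m)) + (\<Sum>m\<in>F. p m * cnj (p m) * w))) {0..w}"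
    by (simp only:)
  from has_integral_unique[OF b this]
  have "complex_of_real b = complex_of_real a
      - (\<Sum>m\<in>F. cnj (p m) * c m) - (\<Sum>m\<in>F. p m * cnj (c m)) + (\<Sum>m\<in>F. p m * cnj (p m) * w)" .
  also have "\<dots> = complex_of_real a + (\<Sum>m\<in>F. p m * cnj (p m) * w - cnj (p m) * c m - p m * cnj (c m))"
    by (simp add: sum_subtractf)
  \<comment> \<open>Completing the square separates the error of the coefficients of P from the
    quantity of interest.\<close>
  also have "(\<Sum>m\<in>F. p m * cnj (p m) * w - cnj (p m) * c m - p m * cnj (c m)) =
      (\<Sum>m\<in>F. (w * p m - c m) * cnj (w * p m - c m) / w - c m * cnj (c m) / w)"
    using w by (intro sum.cong refl) (simp add: field_simps)
  also have "\<dots> = complex_of_real (\<Sum>m\<in>F. (cmod (w * p m - c m))\<^sup>2 / w - (cmod (c m))\<^sup>2 / w)"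
    by (simp only: complex_norm_square of_real_sum of_real_diff of_real_divide)
  finally have "b = a + (\<Sum>m\<in>F. (cmod (w * p m - c m))\<^sup>2 / w - (cmod (c m))\<^sup>2 / w)"
    by (simp only: of_real_add[symmetric] of_real_eq_iff)
  also have "\<dots> \<ge> a - (\<Sum>m\<in>F. (cmod (c m))\<^sup>2) / w"
    using w by (simp add: sum_subtractf sum_divide_distrib[symmetric] sum_nonneg)
  finally have "a - (\<Sum>m\<in>F. (cmod (c m))\<^sup>2) / w \<le> b" .
  moreover have "b \<le> integral {0..w} (\<lambda>t. \<eta>\<^sup>2)"
    unfolding b_def
  proof (intro integral_le integrable_continuous_interval continuous_intros cont contP)
    fix t assume "t \<in> {0..w}"
    then show "(cmod (H t - P t))\<^sup>2 \<le> \<eta>\<^sup>2" using close[of t] by (intro power_mono) auto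
  qed
  ultimately have "a - (\<Sum>m\<in>F. (cmod (c m))\<^sup>2) / w \<le> w * \<eta>\<^sup>2" using w by simp
  then have "w * (a - (\<Sum>m\<in>F. (cmod (c m))\<^sup>2) / w) \<le> w * (w * \<eta>\<^sup>2)" using w by (intro mult_left_mono) auto
  also have "w * (w * \<eta>\<^sup>2) = e" using \<eta>(2) by (simp add: power2_eq_square mult.assoc mult.left_commute)
  also have "w * (a - (\<Sum>m\<in>F. (cmod (c m))\<^sup>2) / w) = w * a - (\<Sum>m\<in>F. (cmod (c m))\<^sup>2)"
    using w by (simp add: right_diff_distrib)
  finally have "w * a - e \<le> (\<Sum>m\<in>F. (cmod (c m))\<^sup>2)" by simp
  then show ?thesis using finF unfolding a_def c_def E_def by blast
qed

section \<open>The Fejer kernel\<close>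

definition triangle_fn :: "real \<Rightarrow> real" where
  "triangle_fn t = max 0 (1 - \<bar>t\<bar>)"

text \<open>The Fourier transform of \<open>triangle_fn\<close>; the value at 0 is 1 by the
  convention for \<open>sinc\<close>.\<close>

definition fejer :: "real \<Rightarrow> real" where
  "fejer x = (sinc (x / 2))\<^sup>2"

lemma continuous_on_triangle [continuous_intros]:
  "continuous_on S f \<Longrightarrow> continuous_on S (\<lambda>x. triangle_fn (f x))"
  unfolding triangle_fn_def by (intro continuous_intros)

lemma continuous_on_fejer [continuous_intros]:
  "continuous_on S f \<Longrightarrow> continuous_on S (\<lambda>x. fejer (f x))"
  unfolding fejer_def by (intro continuous_intros) auto

lemma fejer_0 [simp]: "fejer 0 = 1"
  by (simp add: fejer_def)

lemma fejer_nonneg: "0 \<le> fejer x"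
  by (simp add: fejer_def)

lemma fejer_le_1: "fejer x \<le> 1"
proof -
  have "\<bar>sinc (x / 2)\<bar> \<le> 1"
    using abs_sin_x_le_abs_x[of "x / 2"] by (simp add: divide_le_eq abs_mult)
  then show ?thesis unfolding fejer_def by (simp add: abs_square_le_1)
qed

lemma fejer_bound: "fejer x \<le> 8 / (1 + x\<^sup>2)"
proof (cases "\<bar>x\<bar> \<le> 1")
  case True
  then have "x\<^sup>2 \<le> 1" by (simp add: abs_square_le_1)
  then have "1 \<le> 8 / (1 + x\<^sup>2)" by (simp add: le_divide_eq add_pos_nonneg)
  then show ?thesis using fejer_le_1[of x] by linarith
next
  case False
  then have x: "1 \<le> x\<^sup>2" using one_le_power[of "\<bar>x\<bar>" 2] by simp
  have "(sin (x / 2))\<^sup>2 \<le> 1" by (simp add: abs_square_le_1)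
  then have "fejer x \<le> 4 / x\<^sup>2"
    using x False by (simp add: fejer_def power_divide divide_right_mono)
  also have "\<dots> \<le> 8 / (1 + x\<^sup>2)" 
  proof -
    have "8 / (2 * x\<^sup>2) \<le> 8 / (1 + x\<^sup>2)" using x by (intro divide_left_mono) (auto intro!: mult_pos_pos)
    then show ?thesis by simp
  qed
  finally show ?thesis .
qed

lemma fejer_alt: "x \<noteq> 0 \<Longrightarrow> fejer x = 2 * (1 - cos x) / x\<^sup>2"
  using cos_double_sin[of "x / 2"] by (simp add: fejer_def power_divide)

text \<open>Explicit antiderivatives on the two linear pieces. They divide by a = -i x, so x = 0 is
  treated apart.\<close>

lemma has_integral_triangle_cis:
  "((\<lambda>t. cis (- (x * t)) * complex_of_real (triangle_fn t)) has_integral complex_of_real (fejer x)) {-1..1}"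
proof (cases "x = 0")
  case True
  have 1: "((\<lambda>t. complex_of_real (triangle_fn t)) has_integral (complex_of_real (0 + 0\<^sup>2 / 2) - complex_of_real (-1 + (-1)\<^sup>2 / 2))) {-1..0}"
  proof (rule fundamental_theorem_of_calculus)
    fix t :: real assume "t \<in> {-1..0}"
    then have t: "triangle_fn t = 1 + t" by (simp add: triangle_fn_def)
    show "((\<lambda>t. complex_of_real (t + t\<^sup>2 / 2)) has_vector_derivative complex_of_real (triangle_fn t)) (at t within {- 1..0})"
      unfolding t of_real_add of_real_diff of_real_divide of_real_power
      by (rule has_vector_derivative_real_field) (auto intro!: derivative_eq_intros)
  qed simp
  have 2: "((\<lambda>t. complex_of_real (triangle_fn t)) has_integral (complex_of_real (1 - 1\<^sup>2 / 2) - complex_of_real (0 - 0\<^sup>2 / 2))) {0..1}"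
  proof (rule fundamental_theorem_of_calculus)
    fix t :: real assume "t \<in> {0..1}"
    then have t: "triangle_fn t = 1 - t" by (simp add: triangle_fn_def)
    show "((\<lambda>t. complex_of_real (t - t\<^sup>2 / 2)) has_vector_derivative complex_of_real (triangle_fn t)) (at t within {0..1})"
      unfolding t of_real_add of_real_diff of_real_divide of_real_power
      by (rule has_vector_derivative_real_field) (auto intro!: derivative_eq_intros)
  qed simp
  have "((\<lambda>t. complex_of_real (triangle_fn t)) has_integral 1) {-1..1}"
    using has_integral_combine[OF _ _ 1 2] by simp
  then show ?thesis using True by simp
next
  case False
  define a where "a = - \<i> * complex_of_real x"
  have a: "a \<noteq> 0" using False by (simp add: a_def)
  have cis: "cis (- (x * t)) = exp (a * of_real t)" for t
    by (simp add: cis_conv_exp a_def algebra_simps)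
  let ?F1 = "\<lambda>z. ((1 + z) / a - 1 / a\<^sup>2) * exp (a * z)"
  let ?F2 = "\<lambda>z. ((1 - z) / a + 1 / a\<^sup>2) * exp (a * z)"
  have 1: "((\<lambda>t. cis (- (x * t)) * complex_of_real (triangle_fn t)) has_integral (?F1 (of_real 0) - ?F1 (of_real (-1)))) {-1..0}"
  proof (rule fundamental_theorem_of_calculus)
    fix t :: real assume "t \<in> {-1..0}"
    then have t: "triangle_fn t = 1 + t" by (simp add: triangle_fn_def)
    show "((\<lambda>t. ?F1 (of_real t)) has_vector_derivative cis (- (x * t)) * complex_of_real (triangle_fn t)) (at t within {- 1..0})"
      unfolding t cis
      by (rule has_vector_derivative_real_field)
        (use a in \<open>auto intro!: derivative_eq_intros simp: field_simps power2_eq_square\<close>)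
  qed simp
  have 2: "((\<lambda>t. cis (- (x * t)) * complex_of_real (triangle_fn t)) has_integral (?F2 (of_real 1) - ?F2 (of_real 0))) {0..1}"
  proof (rule fundamental_theorem_of_calculus)
    fix t :: real assume "t \<in> {0..1}"
    then have t: "triangle_fn t = 1 - t" by (simp add: triangle_fn_def)
    show "((\<lambda>t. ?F2 (of_real t)) has_vector_derivative cis (- (x * t)) * complex_of_real (triangle_fn t)) (at t within {0..1})"
      unfolding t cis
      by (rule has_vector_derivative_real_field)
        (use a in \<open>auto intro!: derivative_eq_intros simp: field_simps power2_eq_square\<close>)
  qed simp
  have "exp a = cis (- x)" "exp (- a) = cis x" by (simp_all add: a_def cis_conv_exp)
  then have e: "exp a + exp (- a) = complex_of_real (2 * cos x)" by (simp add: complex_eq_iff)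
  have a2: "a\<^sup>2 = - complex_of_real (x\<^sup>2)" by (simp add: a_def power_mult_distrib)
  have "(?F1 (of_real 0) - ?F1 (of_real (-1))) + (?F2 (of_real 1) - ?F2 (of_real 0)) = (exp a + exp (- a) - 2) / a\<^sup>2"
    by (simp add: diff_divide_distrib add_divide_distrib algebra_simps)
  also have "\<dots> = complex_of_real (2 * (1 - cos x) / x\<^sup>2)"
    unfolding e a2 using False by (simp add: field_simps)
  finally have sum: "(?F1 (of_real 0) - ?F1 (of_real (-1))) + (?F2 (of_real 1) - ?F2 (of_real 0))
      = complex_of_real (2 * (1 - cos x) / x\<^sup>2)" .
  show ?thesis
    using has_integral_combine[OF _ _ 1 2] unfolding sum fejer_alt[OF False] by simp
qed

text \<open>Bridge from Lebesgue integrals over the line to gauge integrals over an interval, where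
  the fundamental theorem of calculus, shifts and partitions are used.\<close>

lemma lborel_integral_continuous_support:
  fixes f :: "real \<Rightarrow> complex"
  assumes "continuous_on {a..b} f" and "\<And>t. t \<notin> {a..b} \<Longrightarrow> f t = 0"
  shows "integrable lborel f" and "integral\<^sup>L lborel f = integral {a..b} f"
proof -
  have f: "f = (\<lambda>t. indicator {a..b} t *\<^sub>R f t)" using assms(2) by (auto simp: indicator_def fun_eq_iff)
  have s: "set_integrable lborel {a..b} f" using assms(1) by (rule borel_integrable_atLeastAtMost')
  show "integrable lborel f" using s unfolding set_integrable_def by (subst f)
  show "integral\<^sup>L lborel f = integral {a..b} f"
    using set_borel_integral_eq_integral(2)[OF s] unfolding set_lebesgue_integral_def by (subst f)
qed

lemma lborel_integral_triangle_cis: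
  "(\<integral>t. cis (- (x * t)) * complex_of_real (triangle_fn t) \<partial>lborel) = complex_of_real (fejer x)"
proof -
  have "(\<integral>t. cis (- (x * t)) * complex_of_real (triangle_fn t) \<partial>lborel) =
      integral {-1..1} (\<lambda>t. cis (- (x * t)) * complex_of_real (triangle_fn t))"
    by (intro lborel_integral_continuous_support continuous_intros) (auto simp: triangle_fn_def)
  also have "\<dots> = complex_of_real (fejer x)"
    by (rule integral_unique[OF has_integral_triangle_cis])
  finally show ?thesis .
qed

text \<open>A triangle of mass 1 and half-width \<open>e\<close> around \<open>s\<close>, used as a
  test function against the spectrum: its transform is the Fejer cutoff at scale \<open>e\<close>
  times the character of frequency \<open>s\<close>.\<close>

lemma lborel_integral_bump_cis:
  assumes e: "e > 0"
  shows "(\<integral>t. cis (- (x * t)) * complex_of_real (triangle_fn ((t - s) / e) / e) \<partial>lborel) =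
    cis (- (x * s)) * complex_of_real (fejer (e * x))"
proof -
  have "(\<integral>t. cis (- (x * t)) * complex_of_real (triangle_fn ((t - s) / e) / e) \<partial>lborel) =
     e *\<^sub>R (\<integral>t. cis (- (x * (s + e * t))) * complex_of_real (triangle_fn (((s + e * t) - s) / e) / e) \<partial>lborel)"
    using e by (subst lborel_integral_real_affine[of e _ s]) auto
  also have "\<dots> = (\<integral>t. cis (- (x * s)) * (cis (- (e * x * t)) * complex_of_real (triangle_fn t)) \<partial>lborel)"
    unfolding integral_scaleR_right[symmetric]
  proof (intro Bochner_Integration.integral_cong refl)
    fix t
    have "cis (- (x * (s + e * t))) = cis (- (x * s)) * cis (- (e * x * t))"
      by (simp add: cis_mult algebra_simps)
    then show "e *\<^sub>R (cis (- (x * (s + e * t))) * complex_of_real (triangle_fn (((s + e * t) - s) / e) / e))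
        = cis (- (x * s)) * (cis (- (e * x * t)) * complex_of_real (triangle_fn t))"
      using e by (simp add: scaleR_conv_of_real)
  qed
  also have "\<dots> = cis (- (x * s)) * complex_of_real (fejer (e * x))"
    by (simp add: lborel_integral_triangle_cis)
  finally show ?thesis .
qed

lemma integrable_fejer:
  assumes "e > 0"
  shows "integrable lborel (\<lambda>x. fejer (e * x))"
proof -
  have "integrable lborel (\<lambda>x::real. inverse (1 + x\<^sup>2))"
    using integrable_inverse_1_plus_square by (simp add: set_integrable_def)
  then have "integrable lborel (\<lambda>x::real. 8 * inverse (1 + x\<^sup>2))" by simp
  then have "integrable lborel fejer"
  proof (rule Bochner_Integration.integrable_bound)
    show "fejer \<in> borel_measurable lborel"
      using continuous_on_fejer[OF continuous_on_id] by (simp add: borel_measurable_continuous_onI)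
    show "AE x in lborel. norm (fejer x) \<le> norm (8 * inverse (1 + x\<^sup>2))"
      using fejer_bound by (auto simp: fejer_nonneg divide_inverse intro!: AE_I2 order_trans[OF _ abs_ge_self])
  qed
  then show ?thesis
    using lborel_integrable_real_affine[of fejer e 0] assms by simp
qed

section \<open>Fourier inversion\<close>

definition fourier :: "(real \<Rightarrow> complex) \<Rightarrow> real \<Rightarrow> complex" where
  "fourier h t = (\<integral>x. h x * cis (- (x * t)) \<partial>lborel) / (2 * pi)"

lemma measurable_cis [measurable]:
  "f \<in> borel_measurable N \<Longrightarrow> (\<lambda>x. cis (f x)) \<in> borel_measurable N"
proof -
  assume "f \<in> borel_measurable N"
  moreover have "cis \<in> borel_measurable borel"
    by (intro borel_measurable_continuous_onI continuous_intros)
  ultimately show ?thesis by (rule measurable_compose)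
qed

lemma integrable_mult_cis:
  assumes "integrable lborel h"
  shows "integrable lborel (\<lambda>x. h x * cis (x * t))"
  using assms
proof (rule Bochner_Integration.integrable_bound)
  show "(\<lambda>x. h x * cis (x * t)) \<in> borel_measurable lborel"
    using borel_measurable_integrable[OF assms] by measurable
qed (simp add: norm_mult)

lemma continuous_on_fourier:
  assumes "integrable lborel h"
  shows "continuous_on UNIV (fourier h)"
proof (intro continuous_at_imp_continuous_on ballI)
  fix t
  have [measurable]: "h \<in> borel_measurable borel" using borel_measurable_integrable[OF assms] by simp
  have "isCont (\<lambda>t. \<integral>x. h x * cis (- (x * t)) \<partial>lborel) t"
    unfolding continuous_at_sequentially
  proof safe
    fix X assume X: "X \<longlonglongrightarrow> t"
    show "((\<lambda>t. \<integral>x. h x * cis (- (x * t)) \<partial>lborel) \<circ> X) \<longlonglongrightarrow> (\<integral>x. h x * cis (- (x * t)) \<partial>lborel)"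
      unfolding comp_def
    proof (rule integral_dominated_convergence[where w = "\<lambda>x. cmod (h x)"])
      show "AE x in lborel. (\<lambda>i. h x * cis (- (x * X i))) \<longlonglongrightarrow> h x * cis (- (x * t))"
        by (intro AE_I2 tendsto_intros X isCont_tendsto_compose[of _ cis] continuous_intros)
    qed (use assms in \<open>auto simp: norm_mult\<close>)
  qed
  then show "isCont (fourier h) t" unfolding fourier_def by (intro continuous_intros) auto
qed

text \<open>Justifies the exchanges of integrals in inversion and in Plancherel, with a kernel of
  modulus 1.\<close>

lemma integrable_tensor:
  fixes f g :: "real \<Rightarrow> complex" and K :: "real \<times> real \<Rightarrow> complex"
  assumes f: "integrable lborel f" and g: "integrable lborel g"
    and K [measurable]: "K \<in> borel_measurable (lborel \<Otimes>\<^sub>M lborel)" and K1: "\<And>z. cmod (K z) \<le> 1"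
  shows "integrable (lborel \<Otimes>\<^sub>M lborel) (\<lambda>(x, y). f x * g y * K (x, y))"
proof -
  have [measurable]: "f \<in> borel_measurable borel" "g \<in> borel_measurable borel"
    using borel_measurable_integrable[OF f] borel_measurable_integrable[OF g] by simp_all
  have "integrable (lborel \<Otimes>\<^sub>M lborel) (\<lambda>(x, y). f x * g y)"
  proof (rule lborel_pair.Fubini_integrable)
    show "integrable lborel (\<lambda>x. \<integral>y. norm (case (x, y) of (x, y) \<Rightarrow> f x * g y) \<partial>lborel)"
      using f by (simp add: norm_mult integrable_norm)
    show "AE x in lborel. integrable lborel (\<lambda>y. case (x, y) of (x, y) \<Rightarrow> f x * g y)"
      using g by simp
  qed measurable
  then show ?thesis
  proof (rule Bochner_Integration.integrable_bound)
    show "AE z in lborel \<Otimes>\<^sub>M lborel. norm (case z of (x, y) \<Rightarrow> f x * g y * K (x, y)) \<le> norm (case z of (x, y) \<Rightarrow> f x * g y)"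
      using K1 by (intro AE_I2) (auto simp: norm_mult mult_left_le split: prod.split)
  qed measurable
qed

section \<open>Gaussian summation of the inverse transform\<close>

lemma gaussian_fourier:
  assumes "\<sigma> > 0"
  shows "(\<integral>t. complex_of_real (exp (- (\<sigma> * t)\<^sup>2 / 2)) * cis (u * t) \<partial>lborel) =
    complex_of_real (2 * pi * (std_normal_density (u / \<sigma>) / \<sigma>))"
proof -
  have base: "(\<integral>t. complex_of_real (exp (- t\<^sup>2 / 2)) * cis (v * t) \<partial>lborel) =
    complex_of_real (2 * pi * std_normal_density v)" for v
  proof -
    have "(\<integral>t. std_normal_density t *\<^sub>R iexp (v * t) \<partial>lborel) = complex_of_real (exp (- v\<^sup>2 / 2))"
      using fun_cong[OF char_std_normal_distribution, of v] unfolding char_def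
      by (subst (asm) integral_density) (auto simp: normal_density_nonneg)
    then have "(\<integral>t. complex_of_real (1 / sqrt (2 * pi)) * (complex_of_real (exp (- t\<^sup>2 / 2)) * cis (v * t)) \<partial>lborel)
        = complex_of_real (exp (- v\<^sup>2 / 2))"
      by (simp add: std_normal_density_def scaleR_conv_of_real cis_conv_exp mult.assoc)
    then have "complex_of_real (1 / sqrt (2 * pi)) * (\<integral>t. complex_of_real (exp (- t\<^sup>2 / 2)) * cis (v * t) \<partial>lborel)
        = complex_of_real (exp (- v\<^sup>2 / 2))" by simp
    then have "(\<integral>t. complex_of_real (exp (- t\<^sup>2 / 2)) * cis (v * t) \<partial>lborel)
        = complex_of_real (sqrt (2 * pi)) * complex_of_real (exp (- v\<^sup>2 / 2))"
      by (simp add: field_simps)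
    also have "\<dots> = complex_of_real (sqrt (2 * pi) * exp (- v\<^sup>2 / 2))" by simp
    also have "sqrt (2 * pi) * exp (- v\<^sup>2 / 2) = 2 * pi * std_normal_density v"
    proof -
      have "2 * pi * (1 / sqrt (2 * pi) * exp (- v\<^sup>2 / 2)) = (2 * pi / sqrt (2 * pi)) * exp (- v\<^sup>2 / 2)" by simp
      also have "2 * pi / sqrt (2 * pi) = sqrt (2 * pi)" by (rule real_div_sqrt) simp
      finally show ?thesis by (simp only: std_normal_density_def)
    qed
    finally show ?thesis .
  qed
  have "(\<integral>t. complex_of_real (exp (- (\<sigma> * t)\<^sup>2 / 2)) * cis (u * t) \<partial>lborel) =
    (1 / \<sigma>) *\<^sub>R (\<integral>t. complex_of_real (exp (- (\<sigma> * (0 + 1 / \<sigma> * t))\<^sup>2 / 2)) * cis (u * (0 + 1 / \<sigma> * t)) \<partial>lborel)"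
    using assms by (subst lborel_integral_real_affine[of "1 / \<sigma>" _ 0]) auto
  also have "(\<integral>t. complex_of_real (exp (- (\<sigma> * (0 + 1 / \<sigma> * t))\<^sup>2 / 2)) * cis (u * (0 + 1 / \<sigma> * t)) \<partial>lborel)
     = complex_of_real (2 * pi * std_normal_density (u / \<sigma>))"
    unfolding base[symmetric] using assms by simp
  finally show ?thesis by (simp add: scaleR_conv_of_real)
qed

lemma std_normal_density_le_exp: "std_normal_density z \<le> exp (- z\<^sup>2 / 2)"
proof -
  have "1 \<le> sqrt (2 * pi)" using pi_gt3 by (intro real_le_rsqrt) simp
  then have "1 / sqrt (2 * pi) * exp (- z\<^sup>2 / 2) \<le> 1 * exp (- z\<^sup>2 / 2)"
    by (intro mult_right_mono) auto
  then show ?thesis by (simp add: std_normal_density_def)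
qed

text \<open>A continuous integrable \<open>h\<close> may be unbounded, so dominated convergence
  cannot be applied to it directly. Near \<open>x\<close> the function is bounded and rescaling puts
  the Gaussian weight into a fixed density; away from \<open>x\<close> the kernel itself tends to 0
  uniformly.\<close>

lemma gaussian_smoothing_tendsto:
  fixes h :: "real \<Rightarrow> complex" and \<sigma> :: "nat \<Rightarrow> real"
  assumes h: "integrable lborel h" and cont: "continuous_on UNIV h"
    and \<sigma>: "\<And>n. \<sigma> n > 0" "\<sigma> \<longlonglongrightarrow> 0"
  shows "(\<lambda>n. \<integral>y. h y * complex_of_real (std_normal_density ((x - y) / \<sigma> n) / \<sigma> n) \<partial>lborel) \<longlonglongrightarrow> h x"
proof -
  have hm [measurable]: "h \<in> borel_measurable borel" using borel_measurable_integrable[OF h] by simp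
  define h1 where "h1 y = indicator (ball x 1) y *\<^sub>R h y" for y
  define h2 where "h2 y = indicator (- ball x 1) y *\<^sub>R h y" for y
  have h12: "h y = h1 y + h2 y" for y by (simp add: h1_def h2_def indicator_def)
  have i1: "integrable lborel h1" unfolding h1_def by (intro integrable_mult_indicator h) simp
  have i2: "integrable lborel h2" unfolding h2_def by (intro integrable_mult_indicator h) simp
  have [measurable]: "h1 \<in> borel_measurable borel" "h2 \<in> borel_measurable borel"
    using borel_measurable_integrable[OF i1] borel_measurable_integrable[OF i2] by simp_all
  define D where "D n y = complex_of_real (std_normal_density ((x - y) / \<sigma> n) / \<sigma> n)" for n y
  have D_bound: "cmod (D n y) \<le> 1 / \<sigma> n" for n y
  proof -
    have "std_normal_density z \<le> 1" for z
      using std_normal_density_le_exp[of z] by (rule order_trans) simp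
    then show ?thesis
      using \<sigma>(1)[of n] by (simp add: D_def norm_divide normal_density_nonneg divide_right_mono)
  qed
  have D_meas [measurable]: "D n \<in> borel_measurable borel" for n unfolding D_def by measurable
  have iD: "integrable lborel (\<lambda>y. g y * D n y)" if g: "integrable lborel g" for g :: "real \<Rightarrow> complex" and n
  proof (rule Bochner_Integration.integrable_bound[of _ "\<lambda>y. complex_of_real (1 / \<sigma> n) * g y"])
    show "(\<lambda>y. g y * D n y) \<in> borel_measurable lborel" using borel_measurable_integrable[OF g] by simp
    show "AE y in lborel. norm (g y * D n y) \<le> norm (complex_of_real (1 / \<sigma> n) * g y)"
    proof (intro AE_I2)
      fix y
      have "cmod (D n y) * cmod (g y) \<le> 1 / \<sigma> n * cmod (g y)" by (intro mult_right_mono D_bound) simp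
      then show "norm (g y * D n y) \<le> norm (complex_of_real (1 / \<sigma> n) * g y)"
        using \<sigma>(1)[of n] by (simp add: norm_mult norm_divide mult.commute)
    qed
  qed (use g in simp)
  have split: "(\<integral>y. h y * D n y \<partial>lborel) = (\<integral>y. h1 y * D n y \<partial>lborel) + (\<integral>y. h2 y * D n y \<partial>lborel)" for n
    unfolding h12 distrib_right by (rule Bochner_Integration.integral_add[OF iD[OF i1] iD[OF i2]])
  have lim1: "(\<lambda>n. \<integral>y. h1 y * D n y \<partial>lborel) \<longlonglongrightarrow> h x"
  proof -
    have eq: "(\<integral>y. h1 y * D n y \<partial>lborel) = (\<integral>u. h1 (x + \<sigma> n * u) * complex_of_real (std_normal_density u) \<partial>lborel)" for n
    proof -
      have "(\<integral>y. h1 y * D n y \<partial>lborel) = \<sigma> n *\<^sub>R (\<integral>u. h1 (x + \<sigma> n * u) * D n (x + \<sigma> n * u) \<partial>lborel)"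
        using \<sigma>(1)[of n] by (subst lborel_integral_real_affine[of "\<sigma> n" _ x]) auto
      also have "\<dots> = (\<integral>u. h1 (x + \<sigma> n * u) * complex_of_real (std_normal_density u) \<partial>lborel)"
        unfolding integral_scaleR_right[symmetric] using \<sigma>(1)[of n]
        by (intro Bochner_Integration.integral_cong refl)
          (simp add: D_def scaleR_conv_of_real std_normal_density_def)
      finally show ?thesis .
    qed
    have "bounded (h ` cball x 1)"
      by (intro compact_imp_bounded compact_continuous_image continuous_on_subset[OF cont]) auto
    then obtain B where B: "\<And>y. y \<in> cball x 1 \<Longrightarrow> cmod (h y) \<le> B"
      unfolding bounded_iff by blast
    have B0: "0 \<le> B" using order_trans[OF norm_ge_zero B[of x]] by simp
    have B1: "cmod (h1 y) \<le> B" for y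
      using B[of y] B0 by (auto simp: h1_def indicator_def)
    have "(\<lambda>n. \<integral>u. h1 (x + \<sigma> n * u) * complex_of_real (std_normal_density u) \<partial>lborel)
       \<longlonglongrightarrow> (\<integral>u. h x * complex_of_real (std_normal_density u) \<partial>lborel)"
    proof (rule integral_dominated_convergence[where w = "\<lambda>u. B * std_normal_density u"])
      show "integrable lborel (\<lambda>u. B * std_normal_density u)"
        by (simp add: integrable_normal_density)
      show "AE u in lborel. (\<lambda>n. h1 (x + \<sigma> n * u) * complex_of_real (std_normal_density u))
          \<longlonglongrightarrow> h x * complex_of_real (std_normal_density u)"
      proof (intro AE_I2 tendsto_intros)
        fix u
        have lim: "(\<lambda>n. x + \<sigma> n * u) \<longlonglongrightarrow> x"
          using tendsto_add[OF tendsto_const[of x] tendsto_mult[OF \<sigma>(2) tendsto_const[of u]]] by simp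
        have "isCont h x" using cont by (simp add: continuous_on_eq_continuous_at)
        then have "(\<lambda>n. h (x + \<sigma> n * u)) \<longlonglongrightarrow> h x" using lim by (rule isCont_tendsto_compose)
        moreover have "\<forall>\<^sub>F n in sequentially. x + \<sigma> n * u \<in> ball x 1"
          using lim by (rule topological_tendstoD) auto
        then have "\<forall>\<^sub>F n in sequentially. h (x + \<sigma> n * u) = h1 (x + \<sigma> n * u)"
          by eventually_elim (simp add: h1_def)
        ultimately show "(\<lambda>n. h1 (x + \<sigma> n * u)) \<longlonglongrightarrow> h x"
          by (rule Lim_transform_eventually)
      qed
      show "AE u in lborel. norm (h1 (x + \<sigma> n * u) * complex_of_real (std_normal_density u)) \<le> B * std_normal_density u" for n
        using B1 by (intro AE_I2) (simp add: norm_mult normal_density_nonneg mult_right_mono)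
    qed auto
    also have "(\<integral>u. h x * complex_of_real (std_normal_density u) \<partial>lborel) = h x"
      by (simp add: integral_normal_density)
    finally show ?thesis unfolding eq .
  qed
  have lim2: "(\<lambda>n. \<integral>y. h2 y * D n y \<partial>lborel) \<longlonglongrightarrow> 0"
  proof (rule Lim_null_comparison)
    \<comment> \<open>At distance at least 1 the kernel is at most exp (-z^2 / 2) /
      \<open>\<sigma>\<close> with |z| at least 1 / \<open>\<sigma>\<close>; the crude bound 2 / z^2
      for the exponential already gives 2 \<open>\<sigma>\<close>.\<close>
    have "cmod (h2 y * D n y) \<le> 2 * \<sigma> n * cmod (h2 y)" for n y
    proof (cases "y \<in> ball x 1")
      case True
      then show ?thesis by (simp add: h2_def)
    next
      case False
      define z where "z = (x - y) / \<sigma> n"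
      have s: "\<sigma> n > 0" by (rule \<sigma>)
      have "1 \<le> (x - y)\<^sup>2" using False one_le_power[of "\<bar>x - y\<bar>" 2] by (simp add: dist_real_def)
      then have z: "1 / (\<sigma> n)\<^sup>2 \<le> z\<^sup>2" by (simp add: z_def power_divide divide_right_mono)
      have z0: "0 < z\<^sup>2" using z s by (smt (verit) zero_less_divide_1_iff zero_less_power)
      have "exp (- z\<^sup>2 / 2) \<le> 2 / z\<^sup>2"
      proof -
        have "z\<^sup>2 / 2 \<le> exp (z\<^sup>2 / 2)" using exp_ge_add_one_self[of "z\<^sup>2 / 2"] by linarith
        then have "inverse (exp (z\<^sup>2 / 2)) \<le> inverse (z\<^sup>2 / 2)" using z0 by (intro le_imp_inverse_le) auto
        then show ?thesis by (simp add: exp_minus)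
      qed
      also have "\<dots> \<le> 2 * (\<sigma> n)\<^sup>2"
      proof -
        have "1 \<le> z\<^sup>2 * (\<sigma> n)\<^sup>2" using z s by (simp add: divide_le_eq)
        then show ?thesis using z0 by (simp add: divide_le_eq mult.commute mult.left_commute)
      qed
      finally have "exp (- z\<^sup>2 / 2) \<le> 2 * (\<sigma> n)\<^sup>2" .
      then have "std_normal_density z / \<sigma> n \<le> 2 * (\<sigma> n)\<^sup>2 / \<sigma> n"
        using s std_normal_density_le_exp[of z] by (intro divide_right_mono) auto
      then have "cmod (D n y) \<le> 2 * \<sigma> n"
        using s by (simp add: D_def z_def[symmetric] norm_divide normal_density_nonneg power2_eq_square)
      then show ?thesis by (simp add: norm_mult mult.commute[of "cmod (h2 y)"] mult_right_mono)
    qed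
    then have "cmod (\<integral>y. h2 y * D n y \<partial>lborel) \<le> (\<integral>y. 2 * \<sigma> n * cmod (h2 y) \<partial>lborel)" for n
      using i2 by (intro Bochner_Integration.integral_norm_bound_integral iD) auto
    then show "\<forall>\<^sub>F n in sequentially. norm (\<integral>y. h2 y * D n y \<partial>lborel) \<le> 2 * \<sigma> n * (\<integral>y. cmod (h2 y) \<partial>lborel)"
      by (intro always_eventually allI) simp
    show "(\<lambda>n. 2 * \<sigma> n * (\<integral>y. cmod (h2 y) \<partial>lborel)) \<longlonglongrightarrow> 0"
      using tendsto_mult[OF tendsto_mult[OF tendsto_const[of 2] \<sigma>(2)] tendsto_const] by simp
  qed
  show ?thesis
    using tendsto_add[OF lim1 lim2] unfolding D_def[symmetric] split by simp
qed

text \<open>Compact support makes the transform integrable. Damped by a wide Gaussian, the inverse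
  integral becomes by Fubini a narrow Gaussian average of \<open>h\<close>; removing the damping
  gives \<open>h x\<close> on one side and the undamped integral on the other.\<close>

lemma fourier_inversion:
  assumes h: "integrable lborel h" and cont: "continuous_on UNIV h"
    and supp: "\<And>t. t \<notin> {a..b} \<Longrightarrow> fourier h t = 0"
  shows "h x = (\<integral>t. fourier h t * cis (x * t) \<partial>lborel)"
proof -
  define \<sigma> :: "nat \<Rightarrow> real" where "\<sigma> n = inverse (real (Suc n))" for n
  have \<sigma>: "\<And>n. \<sigma> n > 0" "\<sigma> \<longlonglongrightarrow> 0"
    unfolding \<sigma>_def using LIMSEQ_inverse_real_of_nat by auto
  have [measurable]: "h \<in> borel_measurable borel" using borel_measurable_integrable[OF h] by simp
  note cft = continuous_on_fourier[OF h]
  have [measurable]: "fourier h \<in> borel_measurable borel" using cft by (rule borel_measurable_continuous_onI)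
  have ift: "integrable lborel (fourier h)"
    by (rule lborel_integral_continuous_support[OF continuous_on_subset[OF cft] supp]) auto
  define E where "E n t = complex_of_real (exp (- (\<sigma> n * t)\<^sup>2 / 2))" for n t
  have [measurable]: "E n \<in> borel_measurable borel" for n unfolding E_def by measurable
  have iE: "integrable lborel (E n)" for n
  proof -
    have "integrable lborel (\<lambda>u. complex_of_real (sqrt (2 * pi) * std_normal_density u))"
      by (intro integrable_of_real integrable_mult_right) (simp add: integrable_normal_density)
    then have "integrable lborel (\<lambda>u. complex_of_real (sqrt (2 * pi) * std_normal_density (0 + \<sigma> n * u)))"
      using \<sigma>(1)[of n] by (intro lborel_integrable_real_affine) auto
    then show ?thesis unfolding E_def[abs_def] by (simp add: std_normal_density_def)
  qed
  have swap: "(\<integral>t. fourier h t * cis (x * t) * E n t \<partial>lborel) =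
     (\<integral>y. h y * complex_of_real (std_normal_density ((x - y) / \<sigma> n) / \<sigma> n) \<partial>lborel)" for n
  proof -
    have int: "integrable (lborel \<Otimes>\<^sub>M lborel) (\<lambda>(y, t). h y * E n t * (\<lambda>(y, t). cis ((x - y) * t)) (y, t))"
      by (rule integrable_tensor[OF h iE]) (auto simp: split_beta)
    have "(\<integral>t. fourier h t * cis (x * t) * E n t \<partial>lborel) =
        (\<integral>t. (\<integral>y. h y * E n t * cis ((x - y) * t) \<partial>lborel) / (2 * pi) \<partial>lborel)"
    proof (intro Bochner_Integration.integral_cong refl)
      fix t
      have "(\<integral>y. h y * E n t * cis ((x - y) * t) \<partial>lborel) = (\<integral>y. (h y * cis (- (y * t))) * (cis (x * t) * E n t) \<partial>lborel)"
      proof (intro Bochner_Integration.integral_cong refl)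
        fix y
        have "cis ((x - y) * t) = cis (- (y * t)) * cis (x * t)" by (simp add: cis_mult algebra_simps)
        then show "h y * E n t * cis ((x - y) * t) = (h y * cis (- (y * t))) * (cis (x * t) * E n t)" by simp
      qed
      then show "fourier h t * cis (x * t) * E n t = (\<integral>y. h y * E n t * cis ((x - y) * t) \<partial>lborel) / (2 * pi)"
        by (simp add: fourier_def)
    qed
    also have "\<dots> = (\<integral>t. \<integral>y. h y * E n t * cis ((x - y) * t) \<partial>lborel \<partial>lborel) / (2 * pi)"
      by simp
    also have "(\<integral>t. \<integral>y. h y * E n t * cis ((x - y) * t) \<partial>lborel \<partial>lborel)
        = (\<integral>y. \<integral>t. h y * E n t * cis ((x - y) * t) \<partial>lborel \<partial>lborel)"
      using lborel_pair.Fubini_integral[of "\<lambda>y t. h y * E n t * cis ((x - y) * t)"] int by simp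
    also have "\<dots> = (\<integral>y. h y * complex_of_real (2 * pi * (std_normal_density ((x - y) / \<sigma> n) / \<sigma> n)) \<partial>lborel)"
      by (simp only: mult.assoc integral_mult_right_zero E_def gaussian_fourier[OF \<sigma>(1)])
    also have "\<dots> = complex_of_real (2 * pi) * (\<integral>y. h y * complex_of_real (std_normal_density ((x - y) / \<sigma> n) / \<sigma> n) \<partial>lborel)"
      unfolding integral_mult_right_zero[symmetric] by (simp only: of_real_mult mult_ac)
    also have "\<dots> / (2 * pi) = (\<integral>y. h y * complex_of_real (std_normal_density ((x - y) / \<sigma> n) / \<sigma> n) \<partial>lborel)"
      by simp
    finally show ?thesis .
  qed
  have "(\<lambda>n. \<integral>t. fourier h t * cis (x * t) * E n t \<partial>lborel) \<longlonglongrightarrow> h x"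
    unfolding swap by (rule gaussian_smoothing_tendsto[OF h cont \<sigma>])
  moreover have "(\<lambda>n. \<integral>t. fourier h t * cis (x * t) * E n t \<partial>lborel) \<longlonglongrightarrow> (\<integral>t. fourier h t * cis (x * t) \<partial>lborel)"
  proof (rule integral_dominated_convergence[where w = "\<lambda>t. cmod (fourier h t)"])
    show "integrable lborel (\<lambda>t. cmod (fourier h t))" using ift by simp
    show "AE t in lborel. (\<lambda>n. fourier h t * cis (x * t) * E n t) \<longlonglongrightarrow> fourier h t * cis (x * t)"
    proof (intro AE_I2)
      fix t
      have "(\<lambda>n. exp (- (\<sigma> n * t)\<^sup>2 / 2)) \<longlonglongrightarrow> exp (- (0 * t)\<^sup>2 / 2)"
        by (intro tendsto_intros \<sigma>(2)) simp
      then have "(\<lambda>n. E n t) \<longlonglongrightarrow> complex_of_real (exp (- (0 * t)\<^sup>2 / 2))"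
        unfolding E_def by (rule tendsto_of_real)
      then show "(\<lambda>n. fourier h t * cis (x * t) * E n t) \<longlonglongrightarrow> fourier h t * cis (x * t)"
        using tendsto_mult[OF tendsto_const[of "fourier h t * cis (x * t)"], of "\<lambda>n. E n t"] by fastforce
    qed
    show "AE t in lborel. norm (fourier h t * cis (x * t) * E n t) \<le> cmod (fourier h t)" for n
      by (intro AE_I2) (simp add: norm_mult E_def mult_left_le)
  qed measurable
  ultimately show ?thesis by (rule LIMSEQ_unique)
qed

text \<open>Inversion is inserted for the conjugate factor and the integrals are exchanged. The
  factor 2 \<pi> comes from the normalization of \<open>fourier\<close>.\<close>

lemma Plancherel:
  assumes h: "integrable lborel h" and cont: "continuous_on UNIV h"
    and supp: "\<And>t. t \<notin> {a..b} \<Longrightarrow> fourier h t = 0"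
  shows "(\<integral>x. (cmod (h x))\<^sup>2 \<partial>lborel) = 2 * pi * integral {a..b} (\<lambda>t. (cmod (fourier h t))\<^sup>2)"
proof -
  note cft = continuous_on_fourier[OF h]
  have ift: "integrable lborel (fourier h)"
    by (rule lborel_integral_continuous_support[OF continuous_on_subset[OF cft] supp]) auto
  then have ift': "integrable lborel (\<lambda>t. cnj (fourier h t))" by simp
  have int: "integrable (lborel \<Otimes>\<^sub>M lborel) (\<lambda>(x, t). h x * cnj (fourier h t) * (\<lambda>(x, t). cis (- (x * t))) (x, t))"
    by (rule integrable_tensor[OF h ift']) (auto simp: split_beta)
  have "complex_of_real (\<integral>x. (cmod (h x))\<^sup>2 \<partial>lborel) = (\<integral>x. h x * cnj (h x) \<partial>lborel)"
    by (simp only: integral_complex_of_real[symmetric] complex_norm_square)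
  also have "\<dots> = (\<integral>x. (\<integral>t. h x * cnj (fourier h t) * cis (- (x * t)) \<partial>lborel) \<partial>lborel)"
  proof (intro Bochner_Integration.integral_cong refl)
    fix x
    have "cnj (h x) = cnj (\<integral>t. fourier h t * cis (x * t) \<partial>lborel)"
      by (rule arg_cong[OF fourier_inversion[OF h cont supp]])
    also have "\<dots> = (\<integral>t. cnj (fourier h t * cis (x * t)) \<partial>lborel)"
      by (rule Bochner_Integration.integral_cnj[symmetric])
    also have "\<dots> = (\<integral>t. cnj (fourier h t) * cis (- (x * t)) \<partial>lborel)"
      by (simp add: cis_cnj)
    finally show "h x * cnj (h x) = (\<integral>t. h x * cnj (fourier h t) * cis (- (x * t)) \<partial>lborel)"
      by (simp add: mult.assoc)
  qed
  also have "\<dots> = (\<integral>t. (\<integral>x. h x * cnj (fourier h t) * cis (- (x * t)) \<partial>lborel) \<partial>lborel)"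
    using lborel_pair.Fubini_integral[of "\<lambda>x t. h x * cnj (fourier h t) * cis (- (x * t))"] int by simp
  also have "\<dots> = (\<integral>t. complex_of_real (2 * pi * (cmod (fourier h t))\<^sup>2) \<partial>lborel)"
  proof (intro Bochner_Integration.integral_cong refl)
    fix t
    have "(\<integral>x. h x * cnj (fourier h t) * cis (- (x * t)) \<partial>lborel) = (\<integral>x. cnj (fourier h t) * (h x * cis (- (x * t))) \<partial>lborel)"
      by (simp add: mult.assoc mult.left_commute)
    also have "\<dots> = cnj (fourier h t) * (complex_of_real (2 * pi) * fourier h t)"
      by (simp add: fourier_def)
    also have "\<dots> = complex_of_real (2 * pi) * (fourier h t * cnj (fourier h t))" by simp
    also have "\<dots> = complex_of_real (2 * pi * (cmod (fourier h t))\<^sup>2)"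
      by (simp only: complex_norm_square[symmetric] of_real_mult)
    finally show "(\<integral>x. h x * cnj (fourier h t) * cis (- (x * t)) \<partial>lborel) = complex_of_real (2 * pi * (cmod (fourier h t))\<^sup>2)" .
  qed
  also have "\<dots> = integral {a..b} (\<lambda>t. complex_of_real (2 * pi * (cmod (fourier h t))\<^sup>2))"
    by (intro lborel_integral_continuous_support continuous_intros continuous_on_subset[OF cft]) (auto simp: supp)
  also have "\<dots> = complex_of_real (integral {a..b} (\<lambda>t. 2 * pi * (cmod (fourier h t))\<^sup>2))"
  proof -
    have "((\<lambda>t. 2 * pi * (cmod (fourier h t))\<^sup>2) has_integral integral {a..b} (\<lambda>t. 2 * pi * (cmod (fourier h t))\<^sup>2)) {a..b}"
      by (intro integrable_integral integrable_continuous_interval continuous_intros continuous_on_subset[OF cft]) auto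
    from has_integral_linear[OF this bounded_linear_of_real[where ?'a = complex]]
    show ?thesis unfolding o_def by (rule integral_unique)
  qed
  finally show ?thesis by (simp only: of_real_eq_iff) simp
qed

lemma norm_fourier_le: "cmod (fourier h t) \<le> (\<integral>x. cmod (h x) \<partial>lborel) / (2 * pi)"
proof -
  have "cmod (\<integral>x. h x * cis (- (x * t)) \<partial>lborel) \<le> (\<integral>x. cmod (h x * cis (- (x * t))) \<partial>lborel)"
    by (rule integral_norm_bound)
  then show ?thesis by (simp add: fourier_def norm_divide norm_mult divide_right_mono)
qed

lemma fourier_diff:
  assumes "integrable lborel f" "integrable lborel g"
  shows "fourier (\<lambda>x. f x - g x) t = fourier f t - fourier g t"
  using integrable_mult_cis[OF assms(1), of "- t"] integrable_mult_cis[OF assms(2), of "- t"]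
  by (simp add: fourier_def left_diff_distrib diff_divide_distrib)

section \<open>Fejer cutoffs of Paley-Wiener functions\<close>

definition fejer_cutoff :: "(real \<Rightarrow> complex) \<Rightarrow> real \<Rightarrow> real \<Rightarrow> complex" where
  "fejer_cutoff f e x = f x * complex_of_real (fejer (e * x))"

context
  fixes f :: "real \<Rightarrow> complex" and S :: "real set"
  assumes f: "f \<in> PW S"
begin

lemma PW_continuous: "continuous_on UNIV f"
  using f by (simp add: PW_def)

lemma PW_measurable [measurable]: "f \<in> borel_measurable borel"
  using PW_continuous by (rule borel_measurable_continuous_onI)

lemma PW_square_integrable: "integrable lborel (\<lambda>x. (cmod (f x))\<^sup>2)"
  using f by (simp add: PW_def square_integrable_def)

lemma fejer_cutoff_continuous: "continuous_on UNIV (fejer_cutoff f e)"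
  unfolding fejer_cutoff_def by (intro continuous_intros PW_continuous)

lemma fejer_cutoff_measurable [measurable]: "fejer_cutoff f e \<in> borel_measurable borel"
  using fejer_cutoff_continuous by (rule borel_measurable_continuous_onI)

lemma norm_fejer_cutoff_le: "cmod (fejer_cutoff f e x) \<le> cmod (f x)"
  by (simp add: fejer_cutoff_def norm_mult fejer_nonneg mult_left_le fejer_le_1)

text \<open>A product of two square integrable functions; since the kernel b lies in [0, 1], b^2 is
  at most b and the majorant a^2 + b is available.\<close>

lemma fejer_cutoff_integrable:
  assumes "e > 0"
  shows "integrable lborel (fejer_cutoff f e)"
proof (rule Bochner_Integration.integrable_bound[of _ "\<lambda>x. (cmod (f x))\<^sup>2 + fejer (e * x)"])
  show "AE x in lborel. norm (fejer_cutoff f e x) \<le> norm ((cmod (f x))\<^sup>2 + fejer (e * x))"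
  proof (intro AE_I2)
    fix x
    define a b where "a = cmod (f x)" and "b = fejer (e * x)"
    have ab: "0 \<le> a" "0 \<le> b" "b \<le> 1" by (auto simp: a_def b_def fejer_nonneg fejer_le_1)
    have "b * b \<le> b * 1" using ab by (intro mult_left_mono) auto
    moreover have "2 * (a * b) \<le> a\<^sup>2 + b * b" using zero_le_power2[of "a - b"] by (simp add: power2_eq_square algebra_simps)
    ultimately have "a * b \<le> a\<^sup>2 + b" using ab mult_nonneg_nonneg[of a b] by linarith
    then show "norm (fejer_cutoff f e x) \<le> norm ((cmod (f x))\<^sup>2 + fejer (e * x))"
      using ab by (simp add: fejer_cutoff_def norm_mult a_def b_def)
  qed
qed (use PW_square_integrable integrable_fejer[OF assms] in auto)

text \<open>The abstract support condition, tested on the bump of half-width \<open>e\<close> at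
  \<open>t\<close>, is literally the transform of the cutoff at \<open>t\<close>. This turns the
  distributional hypothesis into pointwise vanishing of a continuous function.\<close>

lemma fourier_fejer_cutoff_zero:
  assumes e: "e > 0" and disj: "{t - e..t + e} \<inter> S = {}"
  shows "fourier (fejer_cutoff f e) t = 0"
proof -
  define \<phi> where "\<phi> s = complex_of_real (triangle_fn ((s - t) / e) / e)" for s
  have "continuous_on UNIV \<phi>" unfolding \<phi>_def using e by (intro continuous_intros) auto
  moreover have "\<phi> s = 0" if "s \<notin> {t - e..t + e}" for s
  proof -
    have "1 \<le> \<bar>s - t\<bar> / e" using that e by (auto simp: le_divide_eq)
    then have "1 \<le> \<bar>(s - t) / e\<bar>" using e by (simp add: abs_divide)
    then show ?thesis by (simp add: \<phi>_def triangle_fn_def)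
  qed
  ultimately have test: "continuous_on UNIV \<phi> \<and> compact {t - e..t + e} \<and> {t - e..t + e} \<inter> S = {} \<and>
      (\<forall>s. s \<notin> {t - e..t + e} \<longrightarrow> \<phi> s = 0)" using disj by blast
  have "fourier_supported_in f S" using f by (simp add: PW_def)
  with test have "(\<integral>x. f x * (\<integral>s. cis (- (x * s)) * \<phi> s \<partial>lborel) / (2 * pi) \<partial>lborel) = 0"
    unfolding fourier_supported_in_def by blast
  then have "(\<integral>x. f x * (cis (- (x * t)) * complex_of_real (fejer (e * x))) / (2 * pi) \<partial>lborel) = 0"
    unfolding \<phi>_def lborel_integral_bump_cis[OF e] .
  then show ?thesis by (simp add: fourier_def fejer_cutoff_def mult_ac)
qed

end

section \<open>Smoothing of Paley--Wiener functions\<close>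

lemma PW_fourier_cutoff_support:
  assumes f: "f \<in> PW S" and S: "S \<subseteq> {0..2 * pi}" and e: "e > 0"
    and t: "t \<notin> {- e..2 * pi + e}"
  shows "fourier (fejer_cutoff f e) t = 0"
proof (rule fourier_fejer_cutoff_zero[OF f e])
  have "x \<notin> {t - e..t + e}" if "x \<in> {0..2 * pi}" for x using t that by auto
  then show "{t - e..t + e} \<inter> S = {}" using S by blast
qed

lemma cmod_add_square_le: "(cmod (a + b))\<^sup>2 \<le> 2 * (cmod a)\<^sup>2 + 2 * (cmod b)\<^sup>2"
proof -
  have "(cmod (a + b))\<^sup>2 \<le> (cmod a + cmod b)\<^sup>2" by (intro power_mono norm_triangle_ineq) simp
  also have "\<dots> \<le> 2 * (cmod a)\<^sup>2 + 2 * (cmod b)\<^sup>2"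
    using zero_le_power2[of "cmod a - cmod b"] by (simp add: power2_eq_square algebra_simps)
  finally show ?thesis .
qed

text \<open>Smoothing spills spectrum out of \<open>[0, 2\<pi>]\<close>, where integer sampling aliases it.  The mass near
  the two end points tends to zero because the cutoffs form a Cauchy family in \<open>L\<^sup>2\<close>, and each
  single one has bounded Fourier transform.\<close>
lemma fejer_cutoff_interior_mass:
  assumes f: "f \<in> PW S" and S: "S \<subseteq> {0..2 * pi}" and \<tau>: "\<tau> > 0" and e0: "e0 > 0"
  shows "\<exists>e. 0 < e \<and> e < e0 \<and> e < 1 \<and>
    L2_norm_sq f - \<tau> \<le> 2 * pi * integral {e..2 * pi - e} (\<lambda>t. (cmod (fourier (fejer_cutoff f e) t))\<^sup>2)"
proof -
  define s :: "nat \<Rightarrow> real" where "s n = inverse (real (Suc n))" for n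
  have s: "s n > 0" "s n \<le> 1" for n by (auto simp: s_def inverse_le_1_iff)
  have s0: "s \<longlonglongrightarrow> 0" unfolding s_def by (rule LIMSEQ_inverse_real_of_nat)
  define F where "F n = fejer_cutoff f (s n)" for n
  define G where "G n = fourier (F n)" for n
  note [measurable] = PW_measurable[OF f]
  have [measurable]: "F n \<in> borel_measurable borel" for n unfolding F_def by (rule fejer_cutoff_measurable[OF f])
  have iF: "integrable lborel (F n)" for n unfolding F_def by (rule fejer_cutoff_integrable[OF f s(1)])
  have cF: "continuous_on UNIV (F n)" for n unfolding F_def by (rule fejer_cutoff_continuous[OF f])
  have F_lim: "(\<lambda>n. F n x) \<longlonglongrightarrow> f x" for x
  proof -
    have "isCont fejer 0" using continuous_on_fejer[OF continuous_on_id, of UNIV] by (simp add: continuous_on_eq_continuous_at)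
    moreover have "(\<lambda>n. s n * x) \<longlonglongrightarrow> 0" using tendsto_mult[OF s0 tendsto_const[of x]] by simp
    ultimately have "(\<lambda>n. fejer (s n * x)) \<longlonglongrightarrow> 1" using isCont_tendsto_compose[of 0 fejer] by fastforce
    from tendsto_mult[OF tendsto_const[of "f x"] tendsto_of_real[OF this, where ?'a = complex]]
    show ?thesis by (simp add: F_def fejer_cutoff_def)
  qed
  have F_le: "cmod (F n x) \<le> cmod (f x)" for n x unfolding F_def by (rule norm_fejer_cutoff_le[OF f])
  note i2 = PW_square_integrable[OF f]
  have iF2: "integrable lborel (\<lambda>x. (cmod (F n x))\<^sup>2)" for n
    using i2 by (rule Bochner_Integration.integrable_bound) (auto intro!: power_mono F_le)
  have diff_le: "(cmod (f x - F n x))\<^sup>2 \<le> 4 * (cmod (f x))\<^sup>2" for n x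
  proof -
    have "(cmod (F n x))\<^sup>2 \<le> (cmod (f x))\<^sup>2" by (intro power_mono F_le) simp
    moreover have "(cmod (f x - F n x))\<^sup>2 \<le> 2 * (cmod (f x))\<^sup>2 + 2 * (cmod (F n x))\<^sup>2"
      using cmod_add_square_le[of "f x" "- F n x"] by simp
    ultimately show ?thesis by linarith
  qed
  have iD: "integrable lborel (\<lambda>x. (cmod (f x - F n x))\<^sup>2)" for n
    by (rule Bochner_Integration.integrable_bound[of _ "\<lambda>x. 4 * (cmod (f x))\<^sup>2"]) (use i2 diff_le in auto)
  have lim_norm: "(\<lambda>n. \<integral>x. (cmod (F n x))\<^sup>2 \<partial>lborel) \<longlonglongrightarrow> L2_norm_sq f"
    unfolding L2_norm_sq_def
    by (rule integral_dominated_convergence[where w = "\<lambda>x. (cmod (f x))\<^sup>2"])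
      (use i2 in \<open>auto intro!: tendsto_intros F_lim power_mono F_le\<close>)
  have lim_diff: "(\<lambda>n. \<integral>x. (cmod (f x - F n x))\<^sup>2 \<partial>lborel) \<longlonglongrightarrow> (\<integral>x. (cmod (f x - f x))\<^sup>2 \<partial>lborel)"
    by (rule integral_dominated_convergence[where w = "\<lambda>x. 4 * (cmod (f x))\<^sup>2"])
      (use i2 diff_le in \<open>auto intro!: tendsto_eq_intros F_lim\<close>)
  \<comment> \<open>The losses are three times \<open>\<tau>\<close> / 4: from the norm of the
    cutoff, from the bounded part near the end points, and from 16 \<open>\<eta>\<close>, the
    contribution of the distance between two cutoffs.\<close>
  define \<eta> where "\<eta> = \<tau> / 64"
  have \<eta>: "\<eta> > 0" using \<tau> by (simp add: \<eta>_def)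
  have "\<forall>\<^sub>F n in sequentially. (\<integral>x. (cmod (f x - F n x))\<^sup>2 \<partial>lborel) < \<eta>"
    using order_tendstoD(2)[OF lim_diff, of \<eta>] \<eta> by simp
  then obtain m where m: "\<And>n. n \<ge> m \<Longrightarrow> (\<integral>x. (cmod (f x - F n x))\<^sup>2 \<partial>lborel) < \<eta>"
    unfolding eventually_sequentially by blast
  \<comment> \<open>The bound belongs to the fixed index m, so n can still be taken so large that
    B^2 \<open>s n\<close> is small; the analogous bound for \<open>G n\<close> might grow with
    n.\<close>
  define B where "B = (\<integral>x. cmod (F m x) \<partial>lborel) / (2 * pi)"
  have B: "cmod (G m t) \<le> B" for t unfolding G_def B_def by (rule norm_fourier_le)
  have "(\<lambda>n. 16 * pi * B\<^sup>2 * s n) \<longlonglongrightarrow> 16 * pi * B\<^sup>2 * 0" by (intro tendsto_intros s0)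
  then have ev1: "\<forall>\<^sub>F n in sequentially. 16 * pi * B\<^sup>2 * s n < \<tau> / 4"
    using \<tau> by (intro order_tendstoD(2)) auto
  have ev2: "\<forall>\<^sub>F n in sequentially. L2_norm_sq f - \<tau> / 4 < (\<integral>x. (cmod (F n x))\<^sup>2 \<partial>lborel)"
    using \<tau> by (intro order_tendstoD(1)[OF lim_norm]) simp
  have ev3: "\<forall>\<^sub>F n in sequentially. s n < min e0 1"
    using e0 by (intro order_tendstoD(2)[OF s0]) simp
  have "\<forall>\<^sub>F n in sequentially. n \<ge> m" by (rule eventually_ge_at_top)
  with ev1 ev2 ev3 have "\<forall>\<^sub>F n in sequentially. 16 * pi * B\<^sup>2 * s n < \<tau> / 4 \<and>
      L2_norm_sq f - \<tau> / 4 < (\<integral>x. (cmod (F n x))\<^sup>2 \<partial>lborel) \<and> s n < min e0 1 \<and> n \<ge> m"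
    by eventually_elim auto
  then obtain n where n: "16 * pi * B\<^sup>2 * s n < \<tau> / 4"
      "L2_norm_sq f - \<tau> / 4 < (\<integral>x. (cmod (F n x))\<^sup>2 \<partial>lborel)" "s n < min e0 1" "n \<ge> m"
    by (auto simp: eventually_sequentially)
  define e where "e = s n"
  have e: "0 < e" "e < 1" "e < e0" using s n by (auto simp: e_def)
  have cG: "continuous_on T (G k)" for k T
    unfolding G_def by (rule continuous_on_subset[OF continuous_on_fourier[OF iF]]) simp
  have suppG: "G k t = 0" if "t \<notin> {- s k..2 * pi + s k}" for k t
    unfolding G_def F_def by (rule PW_fourier_cutoff_support[OF f S s(1) that])
  have intG: "(\<lambda>t. (cmod (G k t))\<^sup>2) integrable_on {c..d}" for k c d
    by (intro integrable_continuous_interval continuous_intros cG)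
  have intGG: "(\<lambda>t. (cmod (G n t - G m t))\<^sup>2) integrable_on {c..d}" for c d
    by (intro integrable_continuous_interval continuous_intros cG)
  have total: "(\<integral>x. (cmod (F n x))\<^sup>2 \<partial>lborel) = 2 * pi * integral {- e..2 * pi + e} (\<lambda>t. (cmod (G n t))\<^sup>2)"
    unfolding G_def by (rule Plancherel[OF iF cF]) (use suppG[of _ n] in \<open>auto simp: G_def e_def\<close>)
  define d where "d = integral {- 1..2 * pi + 1} (\<lambda>t. (cmod (G n t - G m t))\<^sup>2)"
  have d: "2 * pi * d \<le> 4 * \<eta>"
  proof -
    have "2 * pi * d = (\<integral>x. (cmod (F n x - F m x))\<^sup>2 \<partial>lborel)"
    proof -
      have diff: "fourier (\<lambda>x. F n x - F m x) t = G n t - G m t" for t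
        unfolding G_def by (rule fourier_diff[OF iF iF])
      have "(\<integral>x. (cmod (F n x - F m x))\<^sup>2 \<partial>lborel) =
          2 * pi * integral {- 1..2 * pi + 1} (\<lambda>t. (cmod (fourier (\<lambda>x. F n x - F m x) t))\<^sup>2)"
      \<comment> \<open>One interval serves both transforms because every scale is at most
        1.\<close>
      proof (rule Plancherel)
        show "integrable lborel (\<lambda>x. F n x - F m x)" using iF by simp
        show "continuous_on UNIV (\<lambda>x. F n x - F m x)" by (intro continuous_intros cF)
        fix t :: real assume "t \<notin> {- 1..2 * pi + 1}"
        then have "t \<notin> {- s n..2 * pi + s n}" "t \<notin> {- s m..2 * pi + s m}"
          using s(2)[of n] s(2)[of m] by auto
        then show "fourier (\<lambda>x. F n x - F m x) t = 0" by (simp add: diff suppG)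
      qed
      then show ?thesis by (simp add: diff d_def)
    qed
    also have "\<dots> \<le> (\<integral>x. 2 * (cmod (f x - F n x))\<^sup>2 + 2 * (cmod (f x - F m x))\<^sup>2 \<partial>lborel)"
    proof (rule integral_mono')
      show "integrable lborel (\<lambda>x. 2 * (cmod (f x - F n x))\<^sup>2 + 2 * (cmod (f x - F m x))\<^sup>2)"
        using iD by simp
      fix x show "(cmod (F n x - F m x))\<^sup>2 \<le> 2 * (cmod (f x - F n x))\<^sup>2 + 2 * (cmod (f x - F m x))\<^sup>2"
        using cmod_add_square_le[of "F n x - f x" "f x - F m x"] by (simp add: norm_minus_commute)
    qed simp
    also have "\<dots> = 2 * (\<integral>x. (cmod (f x - F n x))\<^sup>2 \<partial>lborel) + 2 * (\<integral>x. (cmod (f x - F m x))\<^sup>2 \<partial>lborel)"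
      using iD by simp
    also have "\<dots> \<le> 4 * \<eta>" using m[of n] m[of m] n(4) by simp
    finally show ?thesis .
  qed
  have edge: "integral {c - e..c + e} (\<lambda>t. (cmod (G n t))\<^sup>2) \<le> 4 * e * B\<^sup>2 + 2 * d" if c: "c \<in> {0..2 * pi}" for c
  proof -
    have "integral {c - e..c + e} (\<lambda>t. (cmod (G n t))\<^sup>2) \<le>
        integral {c - e..c + e} (\<lambda>t. 2 * B\<^sup>2 + 2 * (cmod (G n t - G m t))\<^sup>2)"
    proof (rule integral_le[OF intG])
      show "(\<lambda>t. 2 * B\<^sup>2 + 2 * (cmod (G n t - G m t))\<^sup>2) integrable_on {c - e..c + e}"
        by (intro integrable_continuous_interval continuous_intros cG)
      fix t
      have "(cmod (G m t))\<^sup>2 \<le> B\<^sup>2" by (intro power_mono B) simp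
      then show "(cmod (G n t))\<^sup>2 \<le> 2 * B\<^sup>2 + 2 * (cmod (G n t - G m t))\<^sup>2"
        using cmod_add_square_le[of "G m t" "G n t - G m t"] by simp
    qed
    also have "\<dots> = integral {c - e..c + e} (\<lambda>t. 2 * B\<^sup>2) + integral {c - e..c + e} (\<lambda>t. 2 * (cmod (G n t - G m t))\<^sup>2)"
      by (intro integral_add integrable_continuous_interval continuous_intros cG)
    also have "\<dots> = 4 * e * B\<^sup>2 + 2 * integral {c - e..c + e} (\<lambda>t. (cmod (G n t - G m t))\<^sup>2)"
      using e by simp
    also have "integral {c - e..c + e} (\<lambda>t. (cmod (G n t - G m t))\<^sup>2) \<le> d"
      unfolding d_def using c e by (intro integral_subset_le intGG) auto
    finally show ?thesis by simp
  qed
  have "integral {- e..2 * pi + e} (\<lambda>t. (cmod (G n t))\<^sup>2) = integral {- e..e} (\<lambda>t. (cmod (G n t))\<^sup>2)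
      + integral {e..2 * pi - e} (\<lambda>t. (cmod (G n t))\<^sup>2) + integral {2 * pi - e..2 * pi + e} (\<lambda>t. (cmod (G n t))\<^sup>2)"
  proof -
    have "e \<le> 2 * pi - e" using e pi_gt3 by linarith
    then have "integral {- e..2 * pi + e} (\<lambda>t. (cmod (G n t))\<^sup>2) = integral {- e..2 * pi - e} (\<lambda>t. (cmod (G n t))\<^sup>2)
        + integral {2 * pi - e..2 * pi + e} (\<lambda>t. (cmod (G n t))\<^sup>2)"
      "integral {- e..2 * pi - e} (\<lambda>t. (cmod (G n t))\<^sup>2) = integral {- e..e} (\<lambda>t. (cmod (G n t))\<^sup>2)
        + integral {e..2 * pi - e} (\<lambda>t. (cmod (G n t))\<^sup>2)"
      using e by (auto intro!: Henstock_Kurzweil_Integration.integral_combine[symmetric] intG)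
    then show ?thesis by simp
  qed
  then have "integral {- e..2 * pi + e} (\<lambda>t. (cmod (G n t))\<^sup>2) \<le>
      integral {e..2 * pi - e} (\<lambda>t. (cmod (G n t))\<^sup>2) + 8 * e * B\<^sup>2 + 4 * d"
    using edge[of 0] edge[of "2 * pi"] by simp
  then have "2 * pi * integral {- e..2 * pi + e} (\<lambda>t. (cmod (G n t))\<^sup>2) \<le>
      2 * pi * (integral {e..2 * pi - e} (\<lambda>t. (cmod (G n t))\<^sup>2) + 8 * e * B\<^sup>2 + 4 * d)"
    by (intro mult_left_mono) auto
  then have "L2_norm_sq f - \<tau> / 4 \<le> 2 * pi * integral {e..2 * pi - e} (\<lambda>t. (cmod (G n t))\<^sup>2)
      + 16 * pi * B\<^sup>2 * e + 4 * (2 * pi * d)"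
    using n(2) unfolding total by (simp add: algebra_simps)
  then have "L2_norm_sq f - \<tau> \<le> 2 * pi * integral {e..2 * pi - e} (\<lambda>t. (cmod (G n t))\<^sup>2)"
    using n(1) d \<tau> unfolding e_def[symmetric] \<eta>_def by linarith
  then show ?thesis using e unfolding G_def F_def e_def by blast
qed

section \<open>Periodization and sampling\<close>

lemma integral_partition:
  fixes F :: "real \<Rightarrow> 'b::euclidean_space"
  assumes cont: "continuous_on UNIV F" and w: "w > 0"
  shows "integral {a..a + real N * w} F = (\<Sum>q<N. integral {0..w} (\<lambda>t. F (t + (a + real q * w))))"
proof (induction N)
  case 0
  then show ?case by simp
next
  case (Suc N)
  have int: "F integrable_on {c..d}" for c d
    by (intro integrable_continuous_interval continuous_on_subset[OF cont]) simp
  have "integral {a..a + real (Suc N) * w} F =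
      integral {a..a + real N * w} F + integral {a + real N * w..a + real (Suc N) * w} F"
    using w by (intro Henstock_Kurzweil_Integration.integral_combine[symmetric] int) (auto simp: algebra_simps)
  also have "integral {a + real N * w..a + real (Suc N) * w} F = integral {0..w} (\<lambda>t. F (t + (a + real N * w)))"
    using integral_shift[of 0 "a + real N * w" w F] continuous_on_subset[OF cont]
    by (simp add: o_def algebra_simps)
  finally show ?case using Suc by simp
qed

text \<open>The cells of [-2 \<pi>, 4 \<pi>], grouped into those that coincide modulo 2
  \<pi>.\<close>

lemma sum_three_blocks:
  fixes a :: "nat \<Rightarrow> 'a::comm_monoid_add"
  shows "(\<Sum>q<3 * n. a q) = (\<Sum>l<n. a l + a (l + n) + a (l + 2 * n))"
proof -
  have shift: "(\<Sum>q<m + n. a q) = (\<Sum>q<m. a q) + (\<Sum>l<n. a (l + m))" for m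
    by (induction n) (simp_all add: add.assoc add.commute[of m])
  have "(\<Sum>q<3 * n. a q) = (\<Sum>q<(n + n) + n. a q)" by (simp add: numeral_3_eq_3 add.assoc)
  also have "\<dots> = (\<Sum>l<n. a l) + (\<Sum>l<n. a (l + n)) + (\<Sum>l<n. a (l + (n + n)))"
    by (simp only: shift)
  finally show ?thesis by (simp add: sum.distrib mult_2)
qed

definition residue_set :: "nat set \<Rightarrow> nat \<Rightarrow> int set" where
  "residue_set J n = {int j + int n * m | j m. j \<in> J}"

lemma inj_on_residue:
  assumes "J \<subseteq> {..<n}"
  shows "inj_on (\<lambda>(j, m). int j + int n * m) (J \<times> UNIV)"
proof (rule inj_onI, clarify)
  fix i j :: nat and l m :: int
  assume ij: "i \<in> J" "j \<in> J" and eq: "int i + int n * l = int j + int n * m"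
  then have lt: "int i < int n" "int j < int n" using assms by auto
  have "(int i + int n * l) mod int n = (int j + int n * m) mod int n" using eq by simp
  then have "int i = int j" using lt by simp
  then show "i = j \<and> l = m" using eq lt by auto
qed

text \<open>Folding g(t) cis(j t) into one cell of length w gives H_j, whose Fourier coefficients
  are the samples on the class j + nZ. Since the offsets of the cells are multiples of w, H_j(t) is
  up to a unimodular factor the j-th Fourier row applied to the values of the 2 \<pi>-periodization
  at t + l w, and these vanish for l outside \<open>L\<close>. The row bound holds at each t;
  integration and Parseval finish.\<close>

lemma periodization_sampling_bound:
  fixes g :: "real \<Rightarrow> complex" and n :: nat and L J :: "nat set"
  assumes cont: "continuous_on UNIV g" and e: "0 < e" "e < 1"
    and supp: "\<And>t. t \<notin> {- e..2 * pi + e} \<Longrightarrow> g t = 0"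
    and n: "n > 0" and L: "L \<subseteq> {..<n}" and J: "J \<subseteq> {..<n}"
    and vanish: "\<And>l t. l < n \<Longrightarrow> l \<notin> L \<Longrightarrow> 0 \<le> t \<Longrightarrow> t \<le> 2 * pi / n \<Longrightarrow>
       g (t + l * (2 * pi / n) - 2 * pi) + g (t + l * (2 * pi / n)) + g (t + l * (2 * pi / n) + 2 * pi) = 0"
    and c: "c \<ge> 0"
    and rows: "Fourier_rows_bounded_below c n L J"
    and \<tau>: "\<tau> > 0"
  shows "\<exists>F. finite F \<and> F \<subseteq> residue_set J n \<and>
    2 * pi / n * (c * real (card L)) * integral {e..2 * pi - e} (\<lambda>t. (cmod (g t))\<^sup>2) - \<tau>
      \<le> (\<Sum>\<mu>\<in>F. (cmod (\<integral>t. g t * cis (real_of_int \<mu> * t) \<partial>lborel))\<^sup>2)"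
proof -
  define w where "w = 2 * pi / real n"
  have w: "w > 0" "real n * w = 2 * pi" using n by (auto simp: w_def)
  have finJ: "finite J" using J finite_subset by blast
  define h where "h x = (\<integral>t. g t * cis (x * t) \<partial>lborel)" for x
  have r: "- (2 * pi) + real (3 * n) * w = 4 * pi"
  proof -
    have "real (3 * n) * w = 3 * (real n * w)" by simp
    then show ?thesis unfolding w(2) by simp
  qed
  have pi1: "e < pi" using e pi_gt3 by linarith
  define P where "P t = g (t - 2 * pi) + g t + g (t + 2 * pi)" for t
  have contg: "continuous_on T (\<lambda>t. g (t + d))" for T d
    by (rule continuous_on_compose2[OF cont]) (auto intro!: continuous_intros)
  have contP: "continuous_on T P" for T
    unfolding P_def using contg[of T "- (2 * pi)"] contg[of T 0] contg[of T "2 * pi"]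
    by (intro continuous_intros) auto
  have contP': "continuous_on T (\<lambda>t. P (t + d))" for T d
    by (rule continuous_on_compose2[OF contP[of UNIV]]) (auto intro!: continuous_intros)
  define H where "H j t = (\<Sum>q<3 * n. g (t + (- (2 * pi) + real q * w)) * cis (real j * (t + (- (2 * pi) + real q * w))))" for j t
  have contH: "continuous_on {0..w} (H j)" for j
    unfolding H_def by (intro continuous_intros contg)
  \<comment> \<open>Moving t across the cell shifts the sum by one index; the two end terms vanish
    because they lie outside the support.\<close>
  have perH: "H j 0 = H j w" for j
  proof -
    define a where "a q = g (- (2 * pi) + real q * w) * cis (real j * (- (2 * pi) + real q * w))" for q
    have a0: "a 0 = 0" "a (3 * n) = 0"
    proof -
      show "a 0 = 0" using supp[of "- (2 * pi)"] pi1 e by (simp add: a_def)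
      show "a (3 * n) = 0" unfolding a_def r using supp[of "4 * pi"] pi1 by simp
    qed
    have "H j 0 = (\<Sum>q<3 * n. a q)" by (simp add: H_def a_def)
    also have "\<dots> = (\<Sum>q<3 * n. a (Suc q))"
      using sum.lessThan_Suc_shift[of a "3 * n"] a0 by simp
    also have "\<dots> = H j w" by (simp add: H_def a_def algebra_simps)
    finally show ?thesis .
  qed
  have coeff: "integral {0..w} (\<lambda>t. H j t * cis (2 * pi * real_of_int m * t / w)) = h (real_of_int (int j + int n * m))" for j m
  proof -
    define \<mu> where "\<mu> = real_of_int (int j + int n * m)"
    define \<Phi> where "\<Phi> t = g t * cis (\<mu> * t)" for t
    have cont\<Phi>: "continuous_on UNIV \<Phi>" unfolding \<Phi>_def by (intro continuous_intros cont)
    have "h \<mu> = integral {- (2 * pi)..- (2 * pi) + real (3 * n) * w} \<Phi>"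
      unfolding h_def \<Phi>_def[symmetric]
    proof (rule lborel_integral_continuous_support(2))
      show "continuous_on {- (2 * pi)..- (2 * pi) + real (3 * n) * w} \<Phi>" by (rule continuous_on_subset[OF cont\<Phi>]) simp
      fix t assume "t \<notin> {- (2 * pi)..- (2 * pi) + real (3 * n) * w}"
      then have "t \<notin> {- e..2 * pi + e}" unfolding r using pi1 by auto
      then show "\<Phi> t = 0" by (simp add: \<Phi>_def supp)
    qed
    also have "\<dots> = (\<Sum>q<3 * n. integral {0..w} (\<lambda>t. \<Phi> (t + (- (2 * pi) + real q * w))))"
      by (rule integral_partition[OF cont\<Phi> w(1)])
    also have "\<dots> = integral {0..w} (\<lambda>t. \<Sum>q<3 * n. \<Phi> (t + (- (2 * pi) + real q * w)))"
    proof (rule integral_sum[symmetric])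
      show "(\<lambda>t. \<Phi> (t + (- (2 * pi) + real q * w))) integrable_on {0..w}" for q
        unfolding \<Phi>_def by (intro integrable_continuous_interval continuous_intros contg)
    qed simp
    also have "\<dots> = integral {0..w} (\<lambda>t. H j t * cis (2 * pi * real_of_int m * t / w))"
    proof (rule integral_cong)
      fix t
      have "cis (\<mu> * (t + (- (2 * pi) + real q * w))) =
         cis (real j * (t + (- (2 * pi) + real q * w))) * cis (2 * pi * real_of_int m * t / w)" for q
      \<comment> \<open>The class j + n m sees the offset q w only through j, because n w = 2 \<pi>
        makes the remaining phase an integer multiple of 2 \<pi>.\<close>
      proof -
        have nw: "real n = 2 * pi / w" using w by (simp add: field_simps)
        have "real n * real_of_int m * (t + (- (2 * pi) + real q * w)) =
            2 * pi * real_of_int m * t / w + 2 * pi * real_of_int (m * int q - int n * m)"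
        proof -
          have "real n * real_of_int m * (real q * w) = real_of_int m * real q * (2 * pi)"
            unfolding w(2)[symmetric] by simp
          moreover have "real n * real_of_int m * t = 2 * pi * real_of_int m * t / w"
            unfolding nw by simp
          ultimately show ?thesis by (simp add: algebra_simps)
        qed
        then have "\<mu> * (t + (- (2 * pi) + real q * w)) = real j * (t + (- (2 * pi) + real q * w))
            + (2 * pi * real_of_int m * t / w + 2 * pi * real_of_int (m * int q - int n * m))"
          unfolding \<mu>_def by (simp add: distrib_right)
        moreover have "cis (2 * pi * real_of_int (m * int q - int n * m)) = 1"
          by (rule cis_multiple_2pi) simp
        ultimately show ?thesis by (simp only: cis_mult[symmetric]) simp
      qed
      then show "(\<Sum>q<3 * n. \<Phi> (t + (- (2 * pi) + real q * w))) = H j t * cis (2 * pi * real_of_int m * t / w)"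
        unfolding \<Phi>_def H_def by (simp only: sum_distrib_right mult.assoc)
    qed
    finally show ?thesis by (simp add: \<mu>_def)
  qed
  have H_eq: "H j t = cis (real j * t) * (\<Sum>l<n. P (t + real l * w) * cis (2 * pi * real j * real l / real n))" for j t
  proof -
    define a where "a q = g (t + (- (2 * pi) + real q * w)) * cis (real j * (t + (- (2 * pi) + real q * w)))" for q
    have a_eq: "a q = cis (real j * t) * (g (t + (- (2 * pi) + real q * w)) * cis (2 * pi * real j * real l / real n))"
      if q: "real q = real l + real n * real p" for q l p :: nat
    proof -
      have qw: "real q * w = real l * w + 2 * pi * real p" unfolding q using w(2) by (simp add: algebra_simps)
      have "real j * (t + (- (2 * pi) + real q * w)) = real j * t + (2 * pi * real j * real l / real n + 2 * pi * real_of_int (int j * int p - int j))"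
        unfolding qw by (simp add: w_def algebra_simps)
      moreover have "cis (2 * pi * real_of_int (int j * int p - int j)) = 1"
        by (rule cis_multiple_2pi) simp
      ultimately have "cis (real j * (t + (- (2 * pi) + real q * w))) = cis (real j * t) * cis (2 * pi * real j * real l / real n)"
        by (simp only: cis_mult[symmetric]) simp
      then show ?thesis by (simp add: a_def)
    qed
    have "H j t = (\<Sum>l<n. a l + a (l + n) + a (l + 2 * n))"
      unfolding H_def a_def[symmetric] by (rule sum_three_blocks)
    also have "\<dots> = (\<Sum>l<n. cis (real j * t) * (P (t + real l * w) * cis (2 * pi * real j * real l / real n)))"
    proof (intro sum.cong refl)
      fix l
      have args: "t + (- (2 * pi) + real l * w) = t + real l * w - 2 * pi"
        "t + (- (2 * pi) + real (l + n) * w) = t + real l * w"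
        "t + (- (2 * pi) + real (l + 2 * n) * w) = t + real l * w + 2 * pi"
        using w(2) by (auto simp: algebra_simps)
      show "a l + a (l + n) + a (l + 2 * n) = cis (real j * t) * (P (t + real l * w) * cis (2 * pi * real j * real l / real n))"
        using a_eq[of l l 0] a_eq[of "l + n" l 1] a_eq[of "l + 2 * n" l 2] unfolding args
        by (simp add: P_def algebra_simps)
    qed
    finally show ?thesis by (simp add: sum_distrib_left)
  qed
  have P0: "P (t + real l * w) = 0" if "l < n" "l \<notin> L" "t \<in> {0..w}" for l t
    using vanish[of l t] that by (simp add: P_def w_def)
  have pointwise: "c * real (card L) * (\<Sum>l<n. (cmod (P (t + real l * w)))\<^sup>2) \<le> (\<Sum>j\<in>J. (cmod (H j t))\<^sup>2)" if t: "t \<in> {0..w}" for t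
  proof -
    have "(\<Sum>l<n. (cmod (P (t + real l * w)))\<^sup>2) = (\<Sum>l\<in>L. (cmod (P (t + real l * w)))\<^sup>2)"
      using L P0[OF _ _ t] by (intro sum.mono_neutral_right) auto
    moreover have "cmod (H j t) = cmod (\<Sum>l\<in>L. P (t + real l * w) * cis (2 * pi * real j * real l / real n))" for j
    proof -
      have "(\<Sum>l<n. P (t + real l * w) * cis (2 * pi * real j * real l / real n))
          = (\<Sum>l\<in>L. P (t + real l * w) * cis (2 * pi * real j * real l / real n))"
        using L P0[OF _ _ t] by (intro sum.mono_neutral_right) auto
      then show ?thesis by (simp add: H_eq norm_mult)
    qed
    ultimately show ?thesis
      using rows[unfolded Fourier_rows_bounded_below_def, rule_format, of "\<lambda>l. P (t + real l * w)"] by simp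
  qed
  have mass: "integral {e..2 * pi - e} (\<lambda>t. (cmod (g t))\<^sup>2) \<le> integral {0..w} (\<lambda>t. \<Sum>l<n. (cmod (P (t + real l * w)))\<^sup>2)"
  proof -
    have "integral {e..2 * pi - e} (\<lambda>t. (cmod (g t))\<^sup>2) = integral {e..2 * pi - e} (\<lambda>t. (cmod (P t))\<^sup>2)"
    \<comment> \<open>Strictly inside the interval both translates by 2 \<pi> leave the closed
      support; the two end points form a null set.\<close>
    proof (rule integral_spike[of "{e, 2 * pi - e}"])
      fix t assume "t \<in> {e..2 * pi - e} - {e, 2 * pi - e}"
      then have "t - 2 * pi \<notin> {- e..2 * pi + e}" "t + 2 * pi \<notin> {- e..2 * pi + e}" by auto
      then show "(cmod (P t))\<^sup>2 = (cmod (g t))\<^sup>2" by (simp add: P_def supp)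
    qed simp
    also have "\<dots> \<le> integral {0..0 + real n * w} (\<lambda>t. (cmod (P t))\<^sup>2)"
      using e w(2) by (intro integral_subset_le integrable_continuous_interval continuous_intros contP) auto
    also have "\<dots> = (\<Sum>l<n. integral {0..w} (\<lambda>t. (cmod (P (t + (0 + real l * w))))\<^sup>2))"
      by (rule integral_partition[OF _ w(1)]) (intro continuous_intros contP)
    also have "\<dots> = integral {0..w} (\<lambda>t. \<Sum>l<n. (cmod (P (t + real l * w)))\<^sup>2)"
      by (subst integral_sum) (auto intro!: integrable_continuous_interval continuous_intros contP')
    finally show ?thesis .
  qed
  \<comment> \<open>An equal share of the error for each class; the added 1 covers an empty
    \<open>J\<close>.\<close>
  define \<tau>' where "\<tau>' = \<tau> / (real (card J) + 1)"
  have \<tau>': "\<tau>' > 0" using \<tau> by (simp add: \<tau>'_def)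
  have "\<forall>j. \<exists>F. finite F \<and> w * integral {0..w} (\<lambda>t. (cmod (H j t))\<^sup>2) - \<tau>' \<le>
     (\<Sum>m\<in>F. (cmod (h (real_of_int (int j + int n * m))))\<^sup>2)"
    using Parseval_lower_bound[OF w(1) contH perH \<tau>'] unfolding coeff by blast
  then obtain Fs where Fs: "\<And>j. finite (Fs j)" "\<And>j. w * integral {0..w} (\<lambda>t. (cmod (H j t))\<^sup>2) - \<tau>' \<le>
     (\<Sum>m\<in>Fs j. (cmod (h (real_of_int (int j + int n * m))))\<^sup>2)" by metis
  define F where "F = (\<lambda>(j, m). int j + int n * m) ` (SIGMA j:J. Fs j)"
  \<comment> \<open>Different pairs (j, m) give different sample points, so no sample is counted
    twice.\<close>
  have inj: "inj_on (\<lambda>(j, m). int j + int n * m) (SIGMA j:J. Fs j)"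
    by (rule inj_on_subset[OF inj_on_residue[OF J]]) auto
  have "finite F" unfolding F_def using finJ Fs(1) by (intro finite_imageI finite_SigmaI) auto
  moreover have "F \<subseteq> residue_set J n" unfolding F_def residue_set_def by auto
  moreover have "2 * pi / n * (c * real (card L)) * integral {e..2 * pi - e} (\<lambda>t. (cmod (g t))\<^sup>2) - \<tau>
      \<le> (\<Sum>\<mu>\<in>F. (cmod (h (real_of_int \<mu>)))\<^sup>2)"
  proof -
    have "w * (c * real (card L)) * integral {e..2 * pi - e} (\<lambda>t. (cmod (g t))\<^sup>2)
        \<le> w * (c * real (card L)) * integral {0..w} (\<lambda>t. \<Sum>l<n. (cmod (P (t + real l * w)))\<^sup>2)"
      using mass w c by (intro mult_left_mono) auto
    also have "\<dots> = w * integral {0..w} (\<lambda>t. c * real (card L) * (\<Sum>l<n. (cmod (P (t + real l * w)))\<^sup>2))"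
      by simp
    also have "\<dots> \<le> w * integral {0..w} (\<lambda>t. \<Sum>j\<in>J. (cmod (H j t))\<^sup>2)"
      using w by (intro mult_left_mono integral_le integrable_continuous_interval continuous_intros contP' contH pointwise) auto
    also have "\<dots> = (\<Sum>j\<in>J. w * integral {0..w} (\<lambda>t. (cmod (H j t))\<^sup>2))"
      using finJ by (subst integral_sum) (auto intro!: integrable_continuous_interval continuous_intros contH simp: sum_distrib_left)
    also have "\<dots> \<le> (\<Sum>j\<in>J. (\<Sum>m\<in>Fs j. (cmod (h (real_of_int (int j + int n * m))))\<^sup>2) + \<tau>')"
      by (intro sum_mono) (use Fs(2) in \<open>simp add: diff_le_eq\<close>)
    also have "\<dots> = (\<Sum>\<mu>\<in>F. (cmod (h (real_of_int \<mu>)))\<^sup>2) + real (card J) * \<tau>'"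
      unfolding F_def sum.reindex[OF inj] using finJ Fs(1)
      by (simp add: sum.distrib sum.Sigma case_prod_beta)
    also have "real (card J) * \<tau>' \<le> \<tau>" using \<tau> by (simp add: \<tau>'_def field_simps)
    finally show ?thesis by (simp add: w_def)
  qed
  ultimately show ?thesis unfolding h_def by blast
qed

section \<open>Periodic sampling sets\<close>

text \<open>A window of length \<open>r\<close> meets each residue class between r/n - 1 and r/n + 1
  times. The error is bounded independently of \<open>x\<close> and \<open>r\<close>, which yields
  uniform density.\<close>

lemma residue_set_window_count:
  assumes J: "J \<subseteq> {..<n}" and n: "n > 0" and r: "r \<ge> 0"
  shows "real (card J) * (r / real n - 1) \<le> real (window_count (residue_set J n) x r)"
    and "real (window_count (residue_set J n) x r) \<le> real (card J) * (r / real n + 1)"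
proof -
  have finJ: "finite J" using J finite_subset by blast
  define A where "A j = {\<lceil>(x - real j) / real n\<rceil>..\<lfloor>(x + r - real j) / real n\<rfloor>}" for j :: nat
  have mem: "x \<le> real_of_int (int j + int n * m) \<and> real_of_int (int j + int n * m) \<le> x + r \<longleftrightarrow> m \<in> A j" for j m
  proof -
    have "m \<in> A j \<longleftrightarrow> (x - real j) / real n \<le> real_of_int m \<and> real_of_int m \<le> (x + r - real j) / real n"
      unfolding A_def by (simp add: ceiling_le_iff le_floor_iff)
    also have "\<dots> \<longleftrightarrow> x - real j \<le> real_of_int m * real n \<and> real_of_int m * real n \<le> x + r - real j"
      using n by (simp add: pos_divide_le_eq pos_le_divide_eq)
    finally show ?thesis by (auto simp: algebra_simps)
  qed
  have "{l \<in> residue_set J n. x \<le> real_of_int l \<and> real_of_int l \<le> x + r} = (\<lambda>(j, m). int j + int n * m) ` (SIGMA j:J. A j)"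
  proof (rule Set.set_eqI)
    fix y
    show "y \<in> {l \<in> residue_set J n. x \<le> real_of_int l \<and> real_of_int l \<le> x + r}
        \<longleftrightarrow> y \<in> (\<lambda>(j, m). int j + int n * m) ` (SIGMA j:J. A j)"
      unfolding residue_set_def mem_Collect_eq using mem by (fastforce simp del: of_int_add of_int_mult)
  qed
  then have "window_count (residue_set J n) x r = card (SIGMA j:J. A j)"
    unfolding window_count_def
    by (simp add: card_image inj_on_subset[OF inj_on_residue[OF J]] Sigma_mono)
  also have "\<dots> = (\<Sum>j\<in>J. card (A j))" using finJ by (simp add: A_def)
  finally have count: "real (window_count (residue_set J n) x r) = (\<Sum>j\<in>J. real (card (A j)))" by simp
  have cardA: "r / real n - 1 \<le> real (card (A j)) \<and> real (card (A j)) \<le> r / real n + 1" for j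
  proof -
    define a b where "a = (x - real j) / real n" and "b = (x + r - real j) / real n"
    have ab: "b = a + r / real n" by (simp add: a_def b_def add_divide_distrib diff_divide_distrib)
    have rn: "0 \<le> r / real n" using r by simp
    have "card (A j) = nat (\<lfloor>b\<rfloor> - \<lceil>a\<rceil> + 1)" by (simp add: A_def a_def b_def)
    \<comment> \<open>Truncation by \<open>nat\<close> is harmless: a \<le> b gives floor b -
      ceiling a \<ge> -1.\<close>
    moreover have "real (nat (\<lfloor>b\<rfloor> - \<lceil>a\<rceil> + 1)) = real_of_int (\<lfloor>b\<rfloor> - \<lceil>a\<rceil> + 1)"
      using ab rn by (simp add: of_nat_nat) linarith
    ultimately show ?thesis using ab by linarith
  qed
  show "real (card J) * (r / real n - 1) \<le> real (window_count (residue_set J n) x r)"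
    unfolding count using sum_mono[of J "\<lambda>_. r / real n - 1" "\<lambda>j. real (card (A j))"] cardA by simp
  show "real (window_count (residue_set J n) x r) \<le> real (card J) * (r / real n + 1)"
    unfolding count using sum_mono[of J "\<lambda>j. real (card (A j))" "\<lambda>_. r / real n + 1"] cardA by simp
qed

lemma residue_set_uniform_density:
  assumes J: "J \<subseteq> {..<n}" and n: "n > 0"
  shows "has_uniform_density (residue_set J n) (real (card J) / real n)"
proof -
  define \<Lambda> where "\<Lambda> = residue_set J n"
  define lo where "lo r = real (card J) * (r / real n - 1)" for r
  define hi where "hi r = real (card J) * (r / real n + 1)" for r
  have b: "lo r \<le> real (window_count \<Lambda> x r)" "real (window_count \<Lambda> x r) \<le> hi r" if "r \<ge> 0" for r x
    unfolding \<Lambda>_def lo_def hi_def using residue_set_window_count[OF J n that] by auto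
  have mn: "lo r \<le> min_window \<Lambda> r \<and> min_window \<Lambda> r \<le> hi r" if r: "r \<ge> 0" for r
  proof
    show "lo r \<le> min_window \<Lambda> r" unfolding min_window_def by (rule cINF_greatest) (use b[OF r] in auto)
    have "min_window \<Lambda> r \<le> real (window_count \<Lambda> 0 r)"
      unfolding min_window_def by (rule cINF_lower) (use b[OF r] in \<open>auto intro!: bdd_belowI2[of _ "lo r"]\<close>)
    then show "min_window \<Lambda> r \<le> hi r" using b[OF r, of 0] by linarith
  qed
  have mx: "lo r \<le> max_window \<Lambda> r \<and> max_window \<Lambda> r \<le> hi r" if r: "r \<ge> 0" for r
  proof
    show "max_window \<Lambda> r \<le> hi r" unfolding max_window_def by (rule cSUP_least) (use b[OF r] in auto)
    have "real (window_count \<Lambda> 0 r) \<le> max_window \<Lambda> r"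
      unfolding max_window_def by (rule cSUP_upper) (use b[OF r] in \<open>auto intro!: bdd_aboveI2[of _ _ "hi r"]\<close>)
    then show "lo r \<le> max_window \<Lambda> r" using b[OF r, of 0] by linarith
  qed
  have lim: "((\<lambda>r. W r / r) \<longlongrightarrow> real (card J) / real n) at_top"
    if W: "\<And>r. r \<ge> 0 \<Longrightarrow> lo r \<le> W r \<and> W r \<le> hi r" for W
  proof (rule tendsto_sandwich)
    show "\<forall>\<^sub>F r in at_top. lo r / r \<le> W r / r"
      by (rule eventually_mono[OF eventually_gt_at_top[of 0]]) (use W in \<open>auto intro!: divide_right_mono\<close>)
    show "\<forall>\<^sub>F r in at_top. W r / r \<le> hi r / r"
      by (rule eventually_mono[OF eventually_gt_at_top[of 0]]) (use W in \<open>auto intro!: divide_right_mono\<close>)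
    have inv: "((\<lambda>r::real. 1 / r) \<longlongrightarrow> 0) at_top"
      using tendsto_inverse_0_at_top[OF filterlim_ident] by (simp add: divide_inverse)
    have *: "((\<lambda>r. real (card J) * (1 / real n - 1 / r)) \<longlongrightarrow> real (card J) * (1 / real n - 0)) at_top"
      by (intro tendsto_intros inv)
    have "\<forall>\<^sub>F r in at_top. real (card J) * (1 / real n - 1 / r) = lo r / r"
      using eventually_gt_at_top[of 0] by eventually_elim (simp add: lo_def field_simps)
    from Lim_transform_eventually[OF * this] show "((\<lambda>r. lo r / r) \<longlongrightarrow> real (card J) / real n) at_top" by simp
    have *: "((\<lambda>r. real (card J) * (1 / real n + 1 / r)) \<longlongrightarrow> real (card J) * (1 / real n + 0)) at_top"
      by (intro tendsto_intros inv)
    have "\<forall>\<^sub>F r in at_top. real (card J) * (1 / real n + 1 / r) = hi r / r"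
      using eventually_gt_at_top[of 0] by eventually_elim (simp add: hi_def field_simps)
    from Lim_transform_eventually[OF * this] show "((\<lambda>r. hi r / r) \<longlongrightarrow> real (card J) / real n) at_top" by simp
  qed
  show ?thesis
    unfolding has_uniform_density_def \<Lambda>_def[symmetric] using lim mn mx by blast
qed

text \<open>Cell l is kept if \<open>S\<close> comes within one cell width of it. This margin
  absorbs the widening of the spectrum by the cutoff, whose scale is smaller than a cell.\<close>

definition near_cells :: "real set \<Rightarrow> nat \<Rightarrow> nat set" where
  "near_cells S n = {l. l < n \<and> (\<exists>s\<in>S. (real l - 1) * (2 * pi / n) \<le> s \<and> s \<le> (real l + 2) * (2 * pi / n))}"

lemma near_cells_measure_ge:
  assumes S: "compact S" "S \<subseteq> {0..2 * pi}" and n: "n > 0"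
  shows "measure lborel S \<le> real (card (near_cells S n)) * (2 * pi / n)"
proof -
  define w where "w = 2 * pi / real n"
  have w: "w > 0" "real n * w = 2 * pi" using n by (auto simp: w_def)
  define I where "I l = {real l * w..(real l + 1) * w}" for l :: nat
  have fin: "finite (near_cells S n)" unfolding near_cells_def by auto
  have "S \<subseteq> (\<Union>l\<in>near_cells S n. I l)"
  proof
    fix s assume s: "s \<in> S"
    then have s2: "0 \<le> s" "s \<le> 2 * pi" using S by auto
    \<comment> \<open>The minimum matters for s = 2 \<pi>, which would otherwise fall into cell
      n.\<close>
    define l where "l = min (nat \<lfloor>s / w\<rfloor>) (n - 1)"
    have "real l * w \<le> s \<and> s \<le> (real l + 1) * w"
    proof -
      have q: "0 \<le> s / w" "s / w \<le> real n" using s2 w by (auto simp: pos_divide_le_eq)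
      have "real l \<le> s / w \<and> s / w \<le> real l + 1"
      proof (cases "nat \<lfloor>s / w\<rfloor> \<le> n - 1")
        case True
        then have "real l = real_of_int \<lfloor>s / w\<rfloor>" using q by (simp add: l_def)
        then show ?thesis by linarith
      next
        case False
        then have "l = n - 1" "real n \<le> real_of_int \<lfloor>s / w\<rfloor>" using q n by (auto simp: l_def)
        then show ?thesis using q n by (simp add: of_nat_diff) linarith
      qed
      then show ?thesis using w by (simp add: pos_divide_le_eq pos_le_divide_eq)
    qed
    moreover have "l < n" using n by (auto simp: l_def)
    moreover have "(real l - 1) * w \<le> real l * w" "(real l + 1) * w \<le> (real l + 2) * w"
      using w by (auto intro!: mult_right_mono)
    ultimately have "l \<in> near_cells S n" "s \<in> I l"
      using s unfolding near_cells_def I_def w_def[symmetric] by (auto intro!: bexI[of _ s])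
    then show "s \<in> (\<Union>l\<in>near_cells S n. I l)" by blast
  qed
  then have "measure lborel S \<le> measure lborel (\<Union>l\<in>near_cells S n. I l)"
  proof (rule measure_mono_fmeasurable)
    show "S \<in> sets lborel" using borel_compact[OF S(1)] by simp
    show "(\<Union>l\<in>near_cells S n. I l) \<in> fmeasurable lborel"
      unfolding I_def by (intro fmeasurable.finite_UN fin fmeasurable_compact compact_Icc)
  qed
  also have "\<dots> \<le> (\<Sum>l\<in>near_cells S n. measure lborel (I l))"
    using fin by (intro measure_UNION_le) (auto simp: I_def)
  also have "\<dots> = real (card (near_cells S n)) * w"
    using w by (simp add: I_def algebra_simps)
  finally show ?thesis by (simp add: w_def)
qed

text \<open>By outer regularity \<open>S\<close> has an open neighbourhood of almost the same
  measure, and by compactness this contains a uniform neighbourhood. All points of a kept cell lie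
  within two cell widths of \<open>S\<close>, so for a fine grid the cells stay inside.\<close>

lemma near_cells_measure_le:
  assumes S: "compact S" and \<epsilon>: "\<epsilon> > 0"
  shows "\<exists>\<rho>>0. \<forall>n. n > 0 \<and> 2 * (2 * pi / real n) < \<rho> \<longrightarrow>
     real (card (near_cells S n)) * (2 * pi / n) \<le> measure lborel S + \<epsilon>"
proof -
  have Sb: "S \<in> sets borel" using S by (rule borel_compact)
  obtain U where U: "open U" "S \<subseteq> U" "emeasure lborel (U - S) < ennreal \<epsilon>"
    using outer_regular_lborel[OF Sb \<epsilon>] by auto
  have emS: "emeasure lborel S < \<infinity>" by (rule emeasure_bounded_finite[OF compact_imp_bounded[OF S]])
  have fS: "S \<in> fmeasurable lborel" using Sb emS by (simp add: fmeasurable_def)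
  have fUS: "U - S \<in> fmeasurable lborel" using U Sb by (auto simp: fmeasurable_def intro: less_trans)
  have U_eq: "U = S \<union> (U - S)" using U by auto
  then have fU: "U \<in> fmeasurable lborel" using fmeasurable.Un[OF fS fUS] by simp
  have "measure lborel U \<le> measure lborel S + measure lborel (U - S)"
    by (subst U_eq) (rule measure_Un_le; use U Sb in simp)
  also have "measure lborel (U - S) \<le> \<epsilon>"
    using U(3) \<epsilon> unfolding measure_def by (simp add: enn2real_leI less_imp_le)
  finally have mU: "measure lborel U \<le> measure lborel S + \<epsilon>" by simp
  obtain \<rho> where \<rho>: "\<rho> > 0" "(\<Union>x\<in>S. ball x \<rho>) \<subseteq> U"
    using compact_subset_open_imp_ball_epsilon_subset[OF S U(1,2)] by blast
  show ?thesis
  proof (intro exI[of _ \<rho>] conjI \<rho>(1) allI impI)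
    fix n :: nat assume "n > 0 \<and> 2 * (2 * pi / real n) < \<rho>"
    then have n: "n > 0" "2 * (2 * pi / real n) < \<rho>" by auto
    define w where "w = 2 * pi / real n"
    have w: "w > 0" using n by (auto simp: w_def)
    \<comment> \<open>Half-open cells are disjoint, so their measures add up exactly.\<close>
    define I where "I l = {real l * w..<(real l + 1) * w}" for l :: nat
    have fin: "finite (near_cells S n)" unfolding near_cells_def by auto
    have "real (card (near_cells S n)) * w = (\<Sum>l\<in>near_cells S n. measure lborel (I l))"
      using w by (simp add: I_def algebra_simps)
    also have "\<dots> = measure lborel (\<Union>l\<in>near_cells S n. I l)"
    proof (rule measure_finite_Union[symmetric])
      show "disjoint_family_on I (near_cells S n)"
        unfolding disjoint_family_on_def
      proof safe
        fix k l x assume kl: "k \<noteq> l" "x \<in> I k" "x \<in> I l"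
        then have "real k * w < (real l + 1) * w" "real l * w < (real k + 1) * w" by (auto simp: I_def)
        then have "real k < real l + 1" "real l < real k + 1" using w by auto
        then show "x \<in> {}" using kl by linarith
      qed
      show "emeasure lborel (I l) \<noteq> \<infinity>" for l
        unfolding I_def using w by (subst emeasure_lborel_Ico) (auto intro!: mult_right_mono)
    qed (use fin in \<open>auto simp: I_def\<close>)
    also have "\<dots> \<le> measure lborel U"
    proof (rule measure_mono_fmeasurable[OF _ _ fU])
      show "(\<Union>l\<in>near_cells S n. I l) \<subseteq> U"
      proof safe
        fix l x assume l: "l \<in> near_cells S n" and x: "x \<in> I l"
        obtain s where s: "s \<in> S" "(real l - 1) * w \<le> s" "s \<le> (real l + 2) * w"
          using l unfolding near_cells_def w_def by auto
        have "\<bar>s - x\<bar> \<le> 2 * w" using s x by (auto simp: I_def algebra_simps abs_le_iff)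
        then have "x \<in> ball s \<rho>" using n(2) by (simp add: w_def dist_real_def)
        then show "x \<in> U" using \<rho>(2) s by blast
      qed
    qed (auto simp: I_def fin)
    finally show "real (card (near_cells S n)) * (2 * pi / n) \<le> measure lborel S + \<epsilon>"
      using mU by (simp add: w_def)
  qed
qed

text \<open>Inserting both end points forces the first and the last cell into the set, which takes care of
  the part of the smoothed spectrum that leaves \<open>[0, 2\<pi>]\<close> and wraps around.\<close>
lemma near_cells_vanish:
  assumes f: "f \<in> PW S" and S: "S \<subseteq> {0..2 * pi}" and n: "n > 0" and e: "0 < e" "e < 2 * pi / n"
    and l: "l < n" "l \<notin> near_cells (insert 0 (insert (2 * pi) S)) n" and t: "0 \<le> t" "t \<le> 2 * pi / n"
  defines "g \<equiv> fourier (fejer_cutoff f e)"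
  shows "g (t + l * (2 * pi / n) - 2 * pi) + g (t + l * (2 * pi / n)) + g (t + l * (2 * pi / n) + 2 * pi) = 0"
proof -
  define w where "w = 2 * pi / real n"
  have w: "w > 0" "real n * w = 2 * pi" using n by (auto simp: w_def)
  have ew: "e < w" and tw: "t \<le> w" using e t by (auto simp: w_def)
  have far: "\<not> ((real l - 1) * w \<le> s \<and> s \<le> (real l + 2) * w)" if "s \<in> insert 0 (insert (2 * pi) S)" for s
    using l that unfolding near_cells_def w_def[symmetric] by blast
  note supp = PW_fourier_cutoff_support[OF f S e(1)]
  have "real l \<ge> 1"
  proof (rule ccontr)
    assume "\<not> real l \<ge> 1"
    then have "l = 0" by simp
    then show False using far[of 0] w by simp
  qed
  then have lw: "w \<le> real l * w" using w mult_right_mono[of 1 "real l" w] by simp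
  have "real l + 2 \<le> real n"
  proof (rule ccontr)
    assume "\<not> real l + 2 \<le> real n"
    then have "\<not> l + 2 \<le> n" by linarith
    then have "n = l + 1" using l(1) by linarith
    then have "real l + 1 = real n" by simp
    then have "(real l - 1) * w \<le> real n * w" "real n * w \<le> (real l + 2) * w"
      using w(1) by (auto intro!: mult_right_mono)
    then show False using far[of "2 * pi"] unfolding w(2) by simp
  qed
  then have nw: "real l * w + 2 * w \<le> 2 * pi"
    using mult_right_mono[of "real l + 2" "real n" w] w by (simp add: distrib_right)
  \<comment> \<open>As cell l is neither first nor last, both translates miss [0, 2 \<pi>] by at
    least w, which exceeds \<open>e\<close>; the middle value vanishes since \<open>S\<close> stays
    more than \<open>e\<close> away.\<close>
  have "g (t + real l * w - 2 * pi) = 0"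
    unfolding g_def by (rule supp) (use nw tw ew in auto)
  moreover have "g (t + real l * w + 2 * pi) = 0"
    unfolding g_def by (rule supp) (use lw t ew in auto)
  moreover have "g (t + real l * w) = 0"
    unfolding g_def
  proof (rule fourier_fejer_cutoff_zero[OF f e(1)], rule equals0I)
    fix s assume "s \<in> {t + real l * w - e..t + real l * w + e} \<inter> S"
    then show False using far[of s] t(1) tw ew by (auto simp: algebra_simps)
  qed
  ultimately show ?thesis unfolding w_def[symmetric] by simp
qed

text \<open>The cutoff scale and the finite set of samples both depend on the error, so each
  approximation is compared with the full sum, the supremum of its finite partial sums, before the
  error tends to 0. An infinite sum makes the claim trivial.\<close>

lemma residue_set_sampling:
  assumes f: "f \<in> PW S" and S: "S \<subseteq> {0..2 * pi}" and n: "n > 0"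
    and J: "J \<subseteq> {..<n}" and c: "c \<ge> 0"
  defines "L \<equiv> near_cells (insert 0 (insert (2 * pi) S)) n"
  assumes rows: "Fourier_rows_bounded_below c n L J"
  shows "ennreal (c * real (card L) / real n * L2_norm_sq f)
    \<le> (\<Sum>\<^sub>\<infinity>l\<in>residue_set J n. ennreal ((cmod (f (real_of_int l)))\<^sup>2))"
proof -
  define X where "X = (\<Sum>\<^sub>\<infinity>l\<in>residue_set J n. ennreal ((cmod (f (real_of_int l)))\<^sup>2))"
  define K where "K = c * real (card L) / real n"
  have K: "K \<ge> 0" using c by (simp add: K_def)
  have finite_le: "ennreal (\<Sum>l\<in>F. (cmod (f (real_of_int l)))\<^sup>2) \<le> X" if F: "finite F" "F \<subseteq> residue_set J n" for F
  proof -
    have "(\<Sum>l\<in>F. ennreal ((cmod (f (real_of_int l)))\<^sup>2)) \<le> X"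
      unfolding X_def using F by (subst nonneg_infsum_complete) (auto intro!: SUP_upper2[of F])
    then show ?thesis by (simp add: sum_ennreal)
  qed
  have approx: "\<exists>F. finite F \<and> F \<subseteq> residue_set J n \<and> K * (L2_norm_sq f - \<tau>) - \<tau> \<le> (\<Sum>l\<in>F. (cmod (f (real_of_int l)))\<^sup>2)"
    if \<tau>: "\<tau> > 0" for \<tau>
  proof -
    have "0 < 2 * pi / real n" using n by simp
    from fejer_cutoff_interior_mass[OF f S \<tau> this]
    obtain e where e: "0 < e" "e < 2 * pi / n" "e < 1"
      "L2_norm_sq f - \<tau> \<le> 2 * pi * integral {e..2 * pi - e} (\<lambda>t. (cmod (fourier (fejer_cutoff f e) t))\<^sup>2)" by blast
    define g where "g = fourier (fejer_cutoff f e)"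
    note ih = fejer_cutoff_integrable[OF f e(1)]
    note ch = fejer_cutoff_continuous[OF f, of e]
    note supp = PW_fourier_cutoff_support[OF f S e(1)]
    have Ln: "L \<subseteq> {..<n}" by (auto simp: L_def near_cells_def)
    have cg: "continuous_on UNIV g" unfolding g_def by (rule continuous_on_fourier[OF ih])
    have suppg: "g t = 0" if "t \<notin> {- e..2 * pi + e}" for t unfolding g_def by (rule supp[OF that])
    have van: "g (t + l * (2 * pi / n) - 2 * pi) + g (t + l * (2 * pi / n)) + g (t + l * (2 * pi / n) + 2 * pi) = 0"
      if "l < n" "l \<notin> L" "0 \<le> t" "t \<le> 2 * pi / n" for l t
      unfolding g_def by (rule near_cells_vanish[OF f S n e(1,2) that(1) that(2)[unfolded L_def] that(3,4)])
    obtain F where F: "finite F" "F \<subseteq> residue_set J n"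
      "2 * pi / n * (c * real (card L)) * integral {e..2 * pi - e} (\<lambda>t. (cmod (g t))\<^sup>2) - \<tau>
         \<le> (\<Sum>\<mu>\<in>F. (cmod (\<integral>t. g t * cis (real_of_int \<mu> * t) \<partial>lborel))\<^sup>2)"
      using periodization_sampling_bound[OF cg e(1,3) suppg n Ln J van c rows \<tau>] by blast
    have inv: "(\<integral>t. g t * cis (real_of_int \<mu> * t) \<partial>lborel) = fejer_cutoff f e (real_of_int \<mu>)" for \<mu>
      unfolding g_def by (rule fourier_inversion[OF ih ch supp, symmetric])
    have "K * (L2_norm_sq f - \<tau>) \<le> K * (2 * pi * integral {e..2 * pi - e} (\<lambda>t. (cmod (g t))\<^sup>2))"
      using e(4) K unfolding g_def by (intro mult_left_mono) auto
    also have "\<dots> = 2 * pi / n * (c * real (card L)) * integral {e..2 * pi - e} (\<lambda>t. (cmod (g t))\<^sup>2)"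
      by (simp add: K_def)
    finally have "K * (L2_norm_sq f - \<tau>) - \<tau> \<le> (\<Sum>\<mu>\<in>F. (cmod (fejer_cutoff f e (real_of_int \<mu>)))\<^sup>2)"
      using F(3) unfolding inv by linarith
    also have "\<dots> \<le> (\<Sum>\<mu>\<in>F. (cmod (f (real_of_int \<mu>)))\<^sup>2)"
      by (intro sum_mono power_mono norm_fejer_cutoff_le[OF f]) simp
    finally show ?thesis using F by blast
  qed
  have "ennreal (K * L2_norm_sq f) \<le> X"
  proof (cases "X = \<top>")
    case False
    then obtain y where y: "X = ennreal y" "y \<ge> 0" by (cases X) auto
    have "K * L2_norm_sq f \<le> y + \<epsilon>" if \<epsilon>: "\<epsilon> > 0" for \<epsilon>
    proof -
      \<comment> \<open>The error enters twice: multiplied by K through the lost mass, and once more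
        through Parseval.\<close>
      define \<tau> where "\<tau> = \<epsilon> / (K + 1)"
      have "(K + 1) * \<tau> = \<epsilon>" using K by (simp add: \<tau>_def)
      then have \<tau>2: "K * \<tau> + \<tau> = \<epsilon>" by (simp add: distrib_right)
      have \<tau>: "\<tau> > 0" using \<epsilon> K by (simp add: \<tau>_def)
      obtain F where F: "finite F" "F \<subseteq> residue_set J n"
        "K * (L2_norm_sq f - \<tau>) - \<tau> \<le> (\<Sum>l\<in>F. (cmod (f (real_of_int l)))\<^sup>2)"
        using approx[OF \<tau>] by blast
      have "(\<Sum>l\<in>F. (cmod (f (real_of_int l)))\<^sup>2) \<le> y"
        using finite_le[OF F(1,2)] y by simp
      then show ?thesis using F(3) \<tau>2 by (simp add: right_diff_distrib)
    qed
    then have "K * L2_norm_sq f \<le> y" by (rule field_le_epsilon)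
    then show ?thesis unfolding y by (rule ennreal_leI)
  qed simp
  then show ?thesis by (simp add: K_def X_def)
qed

text \<open>The density budget is spent twice, a factor 1 + a for covering \<open>S\<close> by cells
  and another for selecting rows. \<open>C\<close> is the constant of the row selection and is
  obtained before \<open>S\<close>; the grid size n depends on \<open>S\<close> and affects neither
  constant.\<close>

theorem theorem1:
  fixes d :: real
  assumes "d > 0"
  shows "\<exists>C > 0. \<forall>S :: real set.
           compact S \<and> S \<subseteq> {0..2 * pi} \<and> measure lborel S > 0 \<longrightarrow>
           (\<exists>\<Lambda> :: int set. \<exists>D. has_uniform_density \<Lambda> D \<and> D < (1 + d) * nmeasure S \<and>
              (\<forall>f \<in> PW S. ennreal (C * nmeasure S * L2_norm_sq f)
                 \<le> (\<Sum>\<^sub>\<infinity>l\<in>\<Lambda>. ennreal ((cmod (f (real_of_int l)))\<^sup>2))))"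
proof -
  \<comment> \<open>With a \<le> 1/3 one has (1 + a)^2 \<le> 1 + 7a/3 < 1 + 3a \<le> 1 + d.\<close>
  define a where "a = min d 1 / 3"
  have a: "0 < a" "3 * a \<le> d" "3 * a \<le> 1" using assms by (auto simp: a_def)
  have "a * a \<le> a * (1 / 3)" using a by (intro mult_left_mono) auto
  moreover have "(1 + a) * (1 + a) = 1 + 2 * a + a * a" by (simp add: algebra_simps)
  ultimately have a2: "(1 + a) * (1 + a) < 1 + d" using a by linarith
  from Fourier_matrix_row_selection[OF a(1)] obtain c k0 where c: "c > 0"
    and select: "\<And>n L. L \<subseteq> {..<n} \<Longrightarrow> k0 \<le> card L \<Longrightarrow>
      \<exists>J\<subseteq>{..<n}. real (card J) \<le> (1 + a) * real (card L) \<and> Fourier_rows_bounded_below c n L J"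
    by blast
  show ?thesis
  proof (intro exI[of _ c] conjI c allI impI)
    fix S :: "real set" assume "compact S \<and> S \<subseteq> {0..2 * pi} \<and> measure lborel S > 0"
    then have S: "compact S" "S \<subseteq> {0..2 * pi}" and pos: "measure lborel S > 0" by auto
    define \<mu> where "\<mu> = measure lborel S"
    define T where "T = insert 0 (insert (2 * pi) S)"
    have T: "compact T" "T \<subseteq> {0..2 * pi}" using S by (auto simp: T_def)
    have mT: "measure lborel T = \<mu>"
    proof -
      have [measurable]: "S \<in> sets borel" using S(1) by (rule borel_compact)
      have "emeasure lborel T = emeasure lborel S"
      proof (rule emeasure_eq_AE)
        show "AE x in lborel. x \<in> T \<longleftrightarrow> x \<in> S"
          using AE_lborel_singleton[of 0] AE_lborel_singleton[of "2 * pi"] by eventually_elim (auto simp: T_def)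
      qed (auto simp: T_def)
      then show ?thesis by (simp add: measure_def \<mu>_def)
    qed
    have "a * \<mu> > 0" using a pos by (simp add: \<mu>_def)
    from near_cells_measure_le[OF T(1) this] obtain \<rho> where \<rho>: "\<rho> > 0"
      "\<And>n. n > 0 \<Longrightarrow> 2 * (2 * pi / real n) < \<rho> \<Longrightarrow> real (card (near_cells T n)) * (2 * pi / n) \<le> \<mu> + a * \<mu>"
      unfolding mT by blast
    \<comment> \<open>The first bound makes the cells fine enough for the measure estimate; the
      second forces at least \<open>k0\<close> cells, since they cover measure
      \<open>\<mu>\<close>.\<close>
    obtain n :: nat where n: "real n > max (4 * pi / \<rho>) (real k0 * (2 * pi) / \<mu>)"
      using reals_Archimedean2 by blast
    have n0: "n > 0"
    proof -
      have "0 < 4 * pi / \<rho>" using \<rho>(1) by simp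
      also have "\<dots> < real n" using n by simp
      finally show ?thesis by simp
    qed
    have "2 * (2 * pi / real n) < \<rho>"
      using n n0 \<rho>(1) by (simp add: field_simps)
    from \<rho>(2)[OF n0 this] have upper: "real (card (near_cells T n)) * (2 * pi / n) \<le> (1 + a) * \<mu>"
      by (simp add: algebra_simps)
    have lower: "\<mu> \<le> real (card (near_cells T n)) * (2 * pi / n)"
      using near_cells_measure_ge[OF T n0] by (simp add: mT)
    define L where "L = near_cells T n"
    have "real k0 * (2 * pi) < \<mu> * real n" using n pos by (simp add: \<mu>_def divide_less_eq mult.commute)
    also have "\<dots> \<le> real (card L) * (2 * pi)" using lower n0 by (simp add: L_def field_simps)
    finally have "k0 \<le> card L" by simp
    moreover have "L \<subseteq> {..<n}" by (auto simp: L_def near_cells_def)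
    ultimately obtain J where J: "J \<subseteq> {..<n}" "real (card J) \<le> (1 + a) * real (card L)"
      and rows: "Fourier_rows_bounded_below c n L J"
      using select by blast
    have nm: "nmeasure S = \<mu> / (2 * pi)" by (simp add: nmeasure_def \<mu>_def)
    have lower': "nmeasure S \<le> real (card L) / real n"
      using lower n0 unfolding nm L_def by (simp add: field_simps)
    have upper': "real (card L) / real n \<le> (1 + a) * nmeasure S"
    proof -
      have "real (card L) / real n = real (card L) * (2 * pi / n) / (2 * pi)" by simp
      also have "\<dots> \<le> (1 + a) * \<mu> / (2 * pi)" using upper unfolding L_def by (intro divide_right_mono) auto
      finally show ?thesis by (simp add: nm)
    qed
    have "real (card J) / real n \<le> (1 + a) * (real (card L) / real n)"
      using J(2) divide_right_mono[of "real (card J)" "(1 + a) * real (card L)" "real n"] by simp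
    also have "\<dots> \<le> (1 + a) * ((1 + a) * nmeasure S)"
      using upper' a by (intro mult_left_mono) auto
    also have "\<dots> < (1 + d) * nmeasure S"
    proof -
      have "0 < nmeasure S" using pos by (simp add: nmeasure_def)
      then show ?thesis using a2 by (simp add: mult.assoc[symmetric])
    qed
    finally have density: "real (card J) / real n < (1 + d) * nmeasure S" .
    have "ennreal (c * nmeasure S * L2_norm_sq f)
        \<le> (\<Sum>\<^sub>\<infinity>l\<in>residue_set J n. ennreal ((cmod (f (real_of_int l)))\<^sup>2))" if f: "f \<in> PW S" for f
    proof -
      have "0 \<le> L2_norm_sq f" unfolding L2_norm_sq_def by simp
      then have "c * nmeasure S * L2_norm_sq f \<le> c * real (card L) / real n * L2_norm_sq f"
        using mult_left_mono[OF lower', of c] c by (intro mult_right_mono) simp_all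
      then have "ennreal (c * nmeasure S * L2_norm_sq f) \<le> ennreal (c * real (card L) / real n * L2_norm_sq f)"
        by (rule ennreal_leI)
      also have "\<dots> \<le> (\<Sum>\<^sub>\<infinity>l\<in>residue_set J n. ennreal ((cmod (f (real_of_int l)))\<^sup>2))"
        unfolding L_def T_def
        by (rule residue_set_sampling[OF f S(2) n0 J(1) less_imp_le[OF c] rows[unfolded L_def T_def]])
      finally show ?thesis .
    qed
    then show "\<exists>\<Lambda> D. has_uniform_density \<Lambda> D \<and> D < (1 + d) * nmeasure S \<and>
              (\<forall>f \<in> PW S. ennreal (c * nmeasure S * L2_norm_sq f)
                 \<le> (\<Sum>\<^sub>\<infinity>l\<in>\<Lambda>. ennreal ((cmod (f (real_of_int l)))\<^sup>2)))"
      using residue_set_uniform_density[OF J(1) n0] density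
      by (intro exI[of _ "residue_set J n"] exI[of _ "real (card J) / real n"]) simp
  qed
qed

end
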